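(* Let $G$ be a simple regular graph on $n$ vertices with girth $g<n$ and Euler characteristic $\chi$. Then \[ a(G)\leq \frac{2n}{(n-g)(g-2)}\left(2-\frac{g\chi}{n}\right). \]
   Context: $a(G)$ is the second smallest eigenvalue of the Laplacian $L=D-A$ ($A$ adjacency matrix, $D$ diagonal degree matrix). The girth is the length of a shortest cycle. Surfaces: orientable $S_h$ with Euler characteristic $2-2h$, non-orientable $N_k$ with Euler characteristic $2-k$. The Euler characteristic of a graph is the Euler characteristic of the surface of minimum genus (in the orientable or in the non-orientable setting, either one) in which the graph embeds. *)

theory Defs
  imports
    "HOL-Analysis.Analysis"
    "HOL-Library.Extended_Nat"
    "HOL-Library.Multiset"
    "HOL-Computational_Algebra.Polynomial"
begin

section \<open>Finite simple graphs\<close>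

text \<open>The vertex set is a whole finite type; edges are two-element sets of vertices.\<close>

definition simple_graph :: "'v::finite set set \<Rightarrow> bool" where
  "simple_graph E \<longleftrightarrow> (\<forall>e\<in>E. card e = 2)"

definition degree_of :: "'v::finite set set \<Rightarrow> 'v \<Rightarrow> nat" where
  "degree_of E v = card {e \<in> E. v \<in> e}"

definition regular_graph :: "'v::finite set set \<Rightarrow> bool" where
  "regular_graph E \<longleftrightarrow> (\<exists>d. \<forall>v. degree_of E v = d)"

definition is_cycle :: "'v::finite set set \<Rightarrow> 'v list \<Rightarrow> bool" where
  "is_cycle E vs \<longleftrightarrow> 3 \<le> length vs \<and> distinct vs \<and>
     (\<forall>i<length vs. {vs ! i, vs ! (Suc i mod length vs)} \<in> E)"

text \<open>The girth of a forest is \<open>\<infinity>\<close>.\<close>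

definition girth :: "'v::finite set set \<Rightarrow> enat" where
  "girth E = (INF vs\<in>{vs. is_cycle E vs}. enat (length vs))"


section \<open>The Laplacian and its second smallest eigenvalue\<close>

definition adjacency_matrix :: "'v::finite set set \<Rightarrow> real^'v^'v" where
  "adjacency_matrix E = (\<chi> u v. if {u, v} \<in> E then 1 else 0)"

definition degree_matrix :: "'v::finite set set \<Rightarrow> real^'v^'v" where
  "degree_matrix E = (\<chi> u v. if u = v then real (degree_of E u) else 0)"

definition laplacian :: "'v::finite set set \<Rightarrow> real^'v^'v" where
  "laplacian E = degree_matrix E - adjacency_matrix E"

definition charpoly :: "real^'n^'n \<Rightarrow> real poly" where
  "charpoly A = det (mat [:0, 1:] - (\<chi> i j. [:A $ i $ j:]))"

text \<open>Eigenvalues are counted with multiplicity. For a graph with at least two vertices the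
  list below has length at least two, as the Laplacian is symmetric.\<close>

definition algebraic_connectivity :: "'v::finite set set \<Rightarrow> real" where
  "algebraic_connectivity E = sorted_list_of_multiset (proots (charpoly (laplacian E))) ! 1"


section \<open>Quotient spaces\<close>

definition quotient_topology :: "'a topology \<Rightarrow> ('a \<Rightarrow> 'b) \<Rightarrow> 'b topology" where
  "quotient_topology X f =
     topology (\<lambda>U. U \<subseteq> f ` topspace X \<and> openin X {x \<in> topspace X. f x \<in> U})"

lemma openin_quotient_topology:
  "openin (quotient_topology X f) U \<longleftrightarrow>
     U \<subseteq> f ` topspace X \<and> openin X {x \<in> topspace X. f x \<in> U}"
proof -
  have "istopology (\<lambda>U. U \<subseteq> f ` topspace X \<and> openin X {x \<in> topspace X. f x \<in> U})"
    unfolding istopology_def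
  proof (intro conjI allI impI; (elim conjE)?)
    fix S T
    assume "openin X {x \<in> topspace X. f x \<in> S}" "openin X {x \<in> topspace X. f x \<in> T}"
    then have "openin X ({x \<in> topspace X. f x \<in> S} \<inter> {x \<in> topspace X. f x \<in> T})"
      by (rule openin_Int)
    moreover have "{x \<in> topspace X. f x \<in> S} \<inter> {x \<in> topspace X. f x \<in> T}
        = {x \<in> topspace X. f x \<in> S \<inter> T}"
      by auto
    ultimately show "openin X {x \<in> topspace X. f x \<in> S \<inter> T}"
      by simp
  next
    fix \<K>
    assume "\<forall>K\<in>\<K>. K \<subseteq> f ` topspace X \<and> openin X {x \<in> topspace X. f x \<in> K}"
    then have "openin X (\<Union>K\<in>\<K>. {x \<in> topspace X. f x \<in> K})"
      by blast
    moreover have "(\<Union>K\<in>\<K>. {x \<in> topspace X. f x \<in> K}) = {x \<in> topspace X. f x \<in> \<Union>\<K>}"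
      by auto
    ultimately show "openin X {x \<in> topspace X. f x \<in> \<Union>\<K>}"
      by simp
  qed auto
  then show ?thesis
    by (simp add: quotient_topology_def topology_inverse')
qed

lemma topspace_quotient_topology: "topspace (quotient_topology X f) = f ` topspace X"
proof
  show "topspace (quotient_topology X f) \<subseteq> f ` topspace X"
    using openin_quotient_topology openin_topspace by metis
  have "{x \<in> topspace X. f x \<in> f ` topspace X} = topspace X"
    by auto
  then have "openin (quotient_topology X f) (f ` topspace X)"
    by (simp add: openin_quotient_topology)
  then show "f ` topspace X \<subseteq> topspace (quotient_topology X f)"
    by (rule openin_subset)
qed

lemma quotient_map_quotient_topology: "quotient_map X (quotient_topology X f) f"
  by (auto simp: quotient_map_def topspace_quotient_topology openin_quotient_topology)

text \<open>The quotient of \<open>X\<close> by the smallest equivalence relation containing \<open>r\<close>.\<close>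

definition glue :: "'a topology \<Rightarrow> 'a rel \<Rightarrow> 'a set topology" where
  "glue X r = quotient_topology X (\<lambda>x. (r \<union> r\<inverse>)\<^sup>* `` {x})"


section \<open>Closed surfaces\<close>

text \<open>The sphere is the one-point compactification of the complex plane. We remove from it
  \<open>m\<close> open unit discs, centred at \<open>0, 3, 6, \<dots>\<close>, whose closures are disjoint.\<close>

definition hole_centre :: "nat \<Rightarrow> complex" where
  "hole_centre j = of_nat (3 * j)"

definition holed_sphere :: "nat \<Rightarrow> complex option topology" where
  "holed_sphere m =
     subtopology (Alexandroff_compactification euclidean)
       (- Some ` (\<Union>j<m. ball (hole_centre j) 1))"

text \<open>\<open>S h\<close>: the sphere with \<open>h\<close> handles. The boundary circles of the discs \<open>2 * i\<close> and
  \<open>2 * i + 1\<close> are glued by \<open>u \<mapsto> cnj u\<close>, i.e. with opposite orientations. Since this map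
  extends to the holomorphic map \<open>u \<mapsto> 1 / u\<close>, exchanging the two sides of the unit circle,
  the result is orientable; its Euler characteristic is \<open>2 - 2 * h\<close>.\<close>

definition orientable_surface :: "nat \<Rightarrow> complex option set topology" where
  "orientable_surface h = glue (holed_sphere (2 * h))
     {(Some (hole_centre (2 * i) + u), Some (hole_centre (2 * i + 1) + cnj u)) |i u.
        i < h \<and> cmod u = 1}"

text \<open>\<open>N k\<close>: the sphere with \<open>k\<close> crosscaps. On every boundary circle antipodal points are
  identified; for \<open>k \<ge> 1\<close> the result is non-orientable, of Euler characteristic \<open>2 - k\<close>.\<close>

definition nonorientable_surface :: "nat \<Rightarrow> complex option set topology" where
  "nonorientable_surface k = glue (holed_sphere k)
     {(Some (hole_centre j + u), Some (hole_centre j - u)) |j u. j < k \<and> cmod u = 1}"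


section \<open>Embeddings of graphs and the Euler characteristic of a graph\<close>

text \<open>Vertices are sent to distinct points and edges to arcs joining their end points; the
  interior of an arc meets neither a vertex nor another arc.\<close>

definition embeds_in :: "'v::finite set set \<Rightarrow> 'p topology \<Rightarrow> bool" where
  "embeds_in E X \<longleftrightarrow>
     (\<exists>(p :: 'v \<Rightarrow> 'p) (\<gamma> :: 'v set \<Rightarrow> real \<Rightarrow> 'p).
        inj p \<and> range p \<subseteq> topspace X \<and>
        (\<forall>e\<in>E. embedding_map (top_of_set {0..1}) X (\<gamma> e) \<and> {\<gamma> e 0, \<gamma> e 1} = p ` e \<and>
               \<gamma> e ` {0<..<1} \<inter> range p = {}) \<and>
        (\<forall>e\<in>E. \<forall>e'\<in>E. e \<noteq> e' \<longrightarrow> \<gamma> e ` {0<..<1} \<inter> \<gamma> e' ` {0<..<1} = {}))"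

definition has_orientable_genus :: "'v::finite set set \<Rightarrow> nat \<Rightarrow> bool" where
  "has_orientable_genus E h \<longleftrightarrow>
     embeds_in E (orientable_surface h) \<and>
     (\<forall>h'<h. \<not> embeds_in E (orientable_surface h'))"

definition has_nonorientable_genus :: "'v::finite set set \<Rightarrow> nat \<Rightarrow> bool" where
  "has_nonorientable_genus E k \<longleftrightarrow>
     1 \<le> k \<and> embeds_in E (nonorientable_surface k) \<and>
     (\<forall>k'. 1 \<le> k' \<and> k' < k \<longrightarrow> \<not> embeds_in E (nonorientable_surface k'))"

text \<open>The Euler characteristic of a graph may be taken in the orientable or in the
  non-orientable setting, so it is a relation rather than a function.\<close>

definition has_euler_characteristic :: "'v::finite set set \<Rightarrow> int \<Rightarrow> bool" where
  "has_euler_characteristic E c \<longleftrightarrow>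
     (\<exists>h. has_orientable_genus E h \<and> c = 2 - 2 * int h) \<or>
     (\<exists>k. has_nonorientable_genus E k \<and> c = 2 - int k)"

end

theory Submission
  imports Defs "HOL-Library.Z2"
begin

text \<open>Let \<open>G\<close> be \<open>d\<close>-regular with \<open>m\<close> edges. The Rayleigh quotient of the projection of the
  indicator of a shortest cycle to the complement of the constants gives \<open>a(G) \<le> n (d - 2) / (n - g)\<close>,
  so it remains to prove Euler's inequality \<open>g (m - n + \<chi>) \<le> 2 m\<close>.

  The surface is covered by a fine grid of closed tiles. A graph embedded by arbitrary arcs becomes a
  minor of the adjacency graph of the tiles: the branch set of a vertex consists of the tiles that
  meet its star, extended along one side of each edge. On the square complex dual to the tiling,
  every cocycle modulo 2 differs from a coboundary by a combination of \<open>r = 2 - \<chi>\<close> fixed cochains. Hence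
  at least \<open>2 ^ (m - n + 1 - r)\<close> even edge sets of \<open>G\<close> are boundaries of unions of regions of the
  complement. Each region with non-empty boundary has at least \<open>g\<close> boundary edges, as its
  boundary is an even edge set, and each edge bounds at most two regions. Counting both ways gives
  the inequality.\<close>

section \<open>Eigenvalues of symmetric matrices\<close>

text \<open>The arcs may be wild and the complement of the graph need not consist of discs, so faces
  cannot be counted directly. Working modulo 2 avoids both difficulties and treats orientable and
  non-orientable surfaces alike. In the dual complex the tiles are the vertices, their common sides
  the edges and their corners the faces.

  All holes are centred on the real axis and every gluing negates \<open>Im\<close>, so upper arcs
  are glued to lower arcs. Cutting along the real axis leaves two half-planes with bumps;
  subtracting the height \<open>profile\<close> of the bumps straightens them, and they are cut into
  squares of side \<open>1 / N\<close> up to distance \<open>N\<close>. All topology then sits in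
  the gluing of the two bottom lines. The \<open>r\<close> fixed cochains are segments of the upper
  bottom line between identified real points.

  A fine mesh separates only disjoint closed sets, while arcs meet at vertices. Hence every arc is
  cut into thirds: the outer thirds join the stars of the vertices, and a middle third touches only
  the stars of its own two ends.\<close>

lemma poly_det:
  fixes M :: "real poly^'n^'n"
  shows "poly (det M) t = det (\<chi> i j. poly (M $ i $ j) t)"
  by (simp add: det_def poly_sum poly_prod of_int_poly)

lemma sum_const_poly: "(\<Sum>k\<in>S. [:f k:]) = [:\<Sum>k\<in>S. f k:]"
  by (induction S rule: infinite_finite_induct) simp_all

lemma prod_const_poly: "(\<Prod>k\<in>S. [:f k:]) = [:\<Prod>k\<in>S. f k:]"
  for f :: "'a \<Rightarrow> 'b::comm_semiring_1"
  by (induction S rule: infinite_finite_induct) (simp_all add: one_pCons mult.commute)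

lemma det_const_poly:
  fixes P :: "real^'n^'n"
  shows "det (\<chi> i j. [:P $ i $ j:]) = [:det P:]"
  by (simp add: det_def prod_const_poly of_int_poly sum_const_poly mult.commute)

text \<open>The value at \<open>-1\<close> is the determinant of \<open>- (mat 1 + A)\<close>, whose
  kernel is trivial for positive semidefinite \<open>A\<close>. Without this, \<open>proots\<close>
  would not reflect divisibility.\<close>

lemma charpoly_nonzero:
  fixes A :: "real^'n^'n"
  assumes psd: "\<And>x. 0 \<le> x \<bullet> (A *v x)"
  shows "charpoly A \<noteq> 0"
proof
  assume "charpoly A = 0"
  then have "poly (charpoly A) (-1) = 0" by simp
  moreover have "(\<chi> i j. poly ((mat [:0, 1:] - (\<chi> i j. [:A $ i $ j:])) $ i $ j) (-1)) = - (mat 1 + A)"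
    by (simp add: vec_eq_iff mat_def)
  ultimately have "det (- (mat 1 + A)) = 0"
    by (simp add: charpoly_def poly_det)
  then have "\<not> invertible (- (mat 1 + A))"
    by (simp add: invertible_det_nz)
  then obtain x where "x \<noteq> 0" "(- (mat 1 + A)) *v x = 0"
    by (metis invertible_left_inverse matrix_left_invertible_ker)
  then have "x + A *v x = 0"
    by (metis (no_types, lifting) add.inverse_inverse add.inverse_neutral matrix_vector_mul_lid matrix_vector_mult_add_rdistrib
        minus_mult_left scaleR_minus1_left scaleR_matrix_vector_assoc)
  then have "x \<bullet> x + x \<bullet> (A *v x) = 0"
    by (metis inner_add_right inner_zero_right)
  then show False
    using psd[of x] \<open>x \<noteq> 0\<close> by (smt (verit) inner_gt_zero_iff)
qed

text \<open>Put \<open>v\<close> and \<open>w\<close> into columns \<open>a\<close> and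
  \<open>b\<close> of the identity matrix; the nonzero minor \<open>ind\<close> makes the result
  \<open>P\<close> invertible. Columns \<open>a\<close> and \<open>b\<close> of the characteristic
  matrix times \<open>P\<close> are then divisible by one linear factor each. The case
  \<open>c = \<mu>\<close> is included, so multiplicities come out right.\<close>

lemma charpoly_dvd_of_eigenvectors:
  fixes A :: "real^'n^'n"
  assumes v: "A *v v = c *s v" and w: "A *v w = \<mu> *s w"
    and ind: "v $ a * w $ b \<noteq> v $ b * w $ a"
  shows "[:-c, 1:] * [:-\<mu>, 1:] dvd charpoly A"
proof -
  have ab: "a \<noteq> b" using ind by auto
  define P :: "real^'n^'n" where
    "P = (\<chi> i j. if j = a then v $ i else if j = b then w $ i else if i = j then 1 else 0)"
  define M :: "real poly^'n^'n" where "M = mat [:0, 1:] - (\<chi> i j. [:A $ i $ j:])"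
  define P' :: "real poly^'n^'n" where "P' = (\<chi> i j. [:P $ i $ j:])"
  have "det P \<noteq> 0"
  proof -
    have "x = 0" if x: "P *v x = 0" for x
    proof -
      have row: "(\<Sum>j\<in>UNIV. P $ i $ j * x $ j) = 0" for i
        using x by (simp add: vec_eq_iff matrix_vector_mult_def)
      have split: "(\<Sum>j\<in>UNIV. P $ i $ j * x $ j)
          = v $ i * x $ a + w $ i * x $ b + (if i = a \<or> i = b then 0 else x $ i)" for i
      proof -
        have "P $ i $ j * x $ j = (if j = a then v $ i * x $ a else 0) + (if j = b then w $ i * x $ b else 0)
           + (if j = i then (if i = a \<or> i = b then 0 else x $ i) else 0)" for j
          using ab by (auto simp: P_def)
        then show ?thesis by (simp add: sum.distrib)
      qed
      have e: "v $ i * x $ a + w $ i * x $ b + (if i = a \<or> i = b then 0 else x $ i) = 0" for i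
        using row[of i] split[of i] by simp
      have ea: "v $ a * x $ a + w $ a * x $ b = 0" and eb: "v $ b * x $ a + w $ b * x $ b = 0"
        using e[of a] e[of b] by simp_all
      have "(v $ a * w $ b - v $ b * w $ a) * x $ a = 0"
        using ea eb by algebra
      moreover have "(v $ a * w $ b - v $ b * w $ a) * x $ b = 0"
        using ea eb by algebra
      ultimately have "x $ a = 0" "x $ b = 0" using ind by auto
      then show "x = 0"
        using e by (auto simp: vec_eq_iff split: if_splits) (metis add_0)
    qed
    then have "invertible P"
      by (metis invertible_left_inverse matrix_left_invertible_ker)
    then show ?thesis by (simp add: invertible_det_nz)
  qed
  have detP': "det P' = [:det P:]"
    unfolding P'_def by (rule det_const_poly)
  define Q where "Q = M ** P'"
  have col: "Q $ i $ j = [:- \<kappa>, 1:] * [:x $ i:]"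
    if x: "A *v x = \<kappa> *s x" and j: "\<And>k. P $ k $ j = x $ k" for i j x \<kappa>
  proof -
    have "Q $ i $ j = (\<Sum>k\<in>UNIV. (if i = k then [:0, 1:] else 0) * [:x $ k:] - [:A $ i $ k * x $ k:])"
      using j by (simp add: Q_def matrix_matrix_mult_def M_def P'_def mat_def smult_diff_right mult.commute)
    also have "\<dots> = [:0, 1:] * [:x $ i:] - [:\<Sum>k\<in>UNIV. A $ i $ k * x $ k:]"
      by (simp add: sum_subtractf sum_const_poly if_distrib[of "smult _"] cong: if_cong)
    also have "(\<Sum>k\<in>UNIV. A $ i $ k * x $ k) = \<kappa> * x $ i"
      using x by (simp add: vec_eq_iff matrix_vector_mult_def)
    finally show ?thesis by simp
  qed
  have colc: "Q $ i $ a = [:- c, 1:] * [:v $ i:]" for i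
    by (rule col[OF v]) (simp add: P_def)
  have cold: "Q $ i $ b = [:- \<mu>, 1:] * [:w $ i:]" for i
    by (rule col[OF w]) (use ab in \<open>simp add: P_def\<close>)
  \<comment> \<open>\<open>det_row_mul\<close> extracts factors from rows, whereas the factors of
    \<open>Q\<close> sit in columns.\<close>
  have "transpose Q = (\<chi> j. if j = a then [:- c, 1:] *s (\<chi> i. [:v $ i:])
          else (if j = b then [:- \<mu>, 1:] *s (\<chi> i. [:w $ i:]) else (\<chi> i. Q $ i $ j)))"
    by (auto simp: vec_eq_iff transpose_def colc cold)
  then have "det (transpose Q) = [:- c, 1:] * det (\<chi> j. if j = a then (\<chi> i. [:v $ i:])
          else (if j = b then [:- \<mu>, 1:] *s (\<chi> i. [:w $ i:]) else (\<chi> i. Q $ i $ j)))"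
    using det_row_mul[of a "[:- c, 1:]" "\<lambda>_. \<chi> i. [:v $ i:]"
       "\<lambda>j. if j = b then [:- \<mu>, 1:] *s (\<chi> i. [:w $ i:]) else (\<chi> i. Q $ i $ j)"]
    by simp
  also have "(\<chi> j. if j = a then (\<chi> i. [:v $ i:])
          else (if j = b then [:- \<mu>, 1:] *s (\<chi> i. [:w $ i:]) else (\<chi> i. Q $ i $ j)))
     = (\<chi> j. if j = b then [:- \<mu>, 1:] *s (\<chi> i. [:w $ i:])
          else (if j = a then (\<chi> i. [:v $ i:]) else (\<chi> i. Q $ i $ j)))"
    using ab by (auto simp: vec_eq_iff)
  also have "det \<dots> = [:- \<mu>, 1:] * det (\<chi> j. if j = b then (\<chi> i. [:w $ i:])
          else (if j = a then (\<chi> i. [:v $ i:]) else (\<chi> i. Q $ i $ j)))"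
    using det_row_mul[of b "[:- \<mu>, 1:]" "\<lambda>_. \<chi> i. [:w $ i:]"
       "\<lambda>j. if j = a then (\<chi> i. [:v $ i:]) else (\<chi> i. Q $ i $ j)"]
    by simp
  finally have "[:- c, 1:] * [:- \<mu>, 1:] dvd det (transpose Q)"
    by (simp only: mult.assoc[symmetric] dvd_triv_left)
  then have "[:- c, 1:] * [:- \<mu>, 1:] dvd charpoly A * [:det P:]"
    by (simp only: det_transpose Q_def det_mul detP' charpoly_def M_def)
  moreover have "is_unit [:det P:]"
    using \<open>det P \<noteq> 0\<close> by (simp add: is_unit_const_poly_iff dvd_field_iff)
  ultimately show ?thesis
    by (simp only: dvd_mult_unit_iff)
qed

text \<open>Two occurrences, even of equal values, sit at different positions, so one of them has
  index at least 1.\<close>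

lemma sorted_nth_1_le:
  fixes xs :: "'a::linorder list"
  assumes "sorted xs" "{#x, y#} \<subseteq># mset xs"
  shows "xs ! 1 \<le> max x y"
proof -
  have "\<exists>i j. i < length xs \<and> j < length xs \<and> i \<noteq> j \<and> xs ! i = x \<and> xs ! j = y"
  proof -
    have "x \<in># mset xs" using assms(2) by (metis insert_subset_eq_iff)
    then obtain i where i: "i < length xs" "xs ! i = x" by (auto simp: in_set_conv_nth)
    have "y \<in># mset xs - {#x#}"
      using assms(2) by (metis insert_subset_eq_iff single_subset_iff)
    then have y: "y \<in> set (remove1 x xs)" by (metis mset_remove1 set_mset_mset)
    show ?thesis
    proof (cases "x = y")
      case False
      then have "y \<in> set xs" using y by (simp add: in_set_remove1)
      then show ?thesis using i False by (metis in_set_conv_nth)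
    next
      case True
      then have "count (mset xs) x \<ge> 2"
        using assms(2) by (metis count_add_mset count_single mset_subset_eq_count numeral_2_eq_2)
      then have "card {i. i < length xs \<and> xs ! i = x} \<ge> 2"
        by (simp add: count_mset count_list_eq_length_filter length_filter_conv_card eq_commute)
      then obtain i j where "i \<noteq> j" "i \<in> {i. i < length xs \<and> xs ! i = x}" "j \<in> {i. i < length xs \<and> xs ! i = x}"
        using card_le_Suc0_iff_eq[of "{i. i < length xs \<and> xs ! i = x}"] by force
      then show ?thesis using True by blast
    qed
  qed
  then obtain i j where ij: "i < length xs" "j < length xs" "i \<noteq> j" "xs ! i = x" "xs ! j = y" by blast
  then have "1 \<le> max i j" by linarith
  then have "xs ! 1 \<le> xs ! max i j"
    using assms(1) ij by (intro sorted_nth_mono) auto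
  then show ?thesis using ij by (auto simp: max_def split: if_splits)
qed

text \<open>Minimise the Rayleigh quotient on the unit sphere of the complement of \<open>v\<close>.
  At a minimiser \<open>w\<close> the residual \<open>A *v w - \<mu> *\<^sub>R w\<close> is
  orthogonal to every vector of that complement; as \<open>A *v v = 0\<close>, the residual itself
  lies there and hence vanishes.\<close>

lemma exists_min_eigenvector_orthogonal:
  fixes A :: "real^'n^'n" and v u :: "real^'n"
  assumes sym: "transpose A = A" and Av: "A *v v = 0"
    and u: "u \<noteq> 0" "u \<bullet> v = 0"
  obtains w \<mu> where "w \<bullet> v = 0" "w \<noteq> 0" "A *v w = \<mu> *s w" "\<mu> * (u \<bullet> u) \<le> u \<bullet> (A *v u)"
proof -
  have symi: "x \<bullet> (A *v y) = (A *v x) \<bullet> y" for x y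
    using sym by (metis dot_lmul_matrix matrix_vector_mul_assoc transpose_matrix_vector)
  define S where "S = sphere 0 1 \<inter> {x. v \<bullet> x = 0}"
  have "compact S" unfolding S_def by (intro compact_Int_closed closed_hyperplane) auto
  moreover have "(1 / norm u) *\<^sub>R u \<in> S" using u by (auto simp: S_def inner_commute)
  moreover have "continuous_on S (\<lambda>x. x \<bullet> (A *v x))"
    by (intro continuous_intros matrix_vector_mult_linear_continuous_on)
  ultimately obtain w where w: "w \<in> S" and min: "\<And>x. x \<in> S \<Longrightarrow> w \<bullet> (A *v w) \<le> x \<bullet> (A *v x)"
    using continuous_attains_inf[of S "\<lambda>x. x \<bullet> (A *v x)"] by blast
  define \<mu> where "\<mu> = w \<bullet> (A *v w)"
  have ww: "w \<bullet> w = 1" and vw: "v \<bullet> w = 0" using w by (auto simp: S_def dot_square_norm)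
  have ray: "\<mu> * (x \<bullet> x) \<le> x \<bullet> (A *v x)" if "v \<bullet> x = 0" for x
  proof (cases "x = 0")
    case False
    then have "(1 / norm x) *\<^sub>R x \<in> S" using that by (auto simp: S_def)
    from min[OF this] have "\<mu> \<le> (1 / norm x)^2 * (x \<bullet> (A *v x))"
      by (simp add: \<mu>_def matrix_vector_mult_scaleR power2_eq_square)
    then show ?thesis using False
      by (simp add: dot_square_norm field_simps)
  qed simp
  have key: "(A *v w - \<mu> *\<^sub>R w) \<bullet> y = 0" if y: "v \<bullet> y = 0" for y
  proof -
    define \<beta> where "\<beta> = (A *v w - \<mu> *\<^sub>R w) \<bullet> y"
    define \<alpha> where "\<alpha> = y \<bullet> (A *v y) - \<mu> * (y \<bullet> y)"
    have q: "0 \<le> 2 * t * \<beta> + t^2 * \<alpha>" for t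
    proof -
      have "v \<bullet> (w + t *\<^sub>R y) = 0" using y vw by (simp add: inner_add_right)
      from ray[OF this] have "\<mu> * ((w + t *\<^sub>R y) \<bullet> (w + t *\<^sub>R y)) \<le> (w + t *\<^sub>R y) \<bullet> (A *v (w + t *\<^sub>R y))" .
      moreover have "(w + t *\<^sub>R y) \<bullet> (w + t *\<^sub>R y) = 1 + 2 * t * (w \<bullet> y) + t^2 * (y \<bullet> y)"
        using ww by (simp add: inner_add_left inner_add_right inner_commute power2_eq_square)
      moreover have "(w + t *\<^sub>R y) \<bullet> (A *v (w + t *\<^sub>R y)) = \<mu> + 2 * t * ((A *v w) \<bullet> y) + t^2 * (y \<bullet> (A *v y))"
      proof -
        have "w \<bullet> (A *v y) = (A *v w) \<bullet> y" by (rule symi)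
        then show ?thesis
          by (simp add: \<mu>_def matrix_vector_right_distrib matrix_vector_mult_scaleR inner_add_left inner_add_right
             inner_commute power2_eq_square distrib_left)
      qed
      ultimately have "\<mu> * (1 + 2 * t * (w \<bullet> y) + t^2 * (y \<bullet> y))
          \<le> \<mu> + 2 * t * ((A *v w) \<bullet> y) + t^2 * (y \<bullet> (A *v y))"
        by (simp only:)
      then show ?thesis
        by (simp add: \<beta>_def \<alpha>_def inner_diff_left algebra_simps)
    qed
    have "\<beta> = 0"
    proof (rule ccontr)
      assume "\<beta> \<noteq> 0"
      \<comment> \<open>\<open>D\<close> is a positive upper bound for \<open>\<alpha>\<close>; the
        chosen \<open>t\<close> minimises \<open>2 * t * \<beta> + t^2 * D\<close>, with negative
        value \<open>- (\<beta>^2) / D\<close>.\<close>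
      define D where "D = \<bar>\<alpha>\<bar> + 1"
      define t where "t = - \<beta> / D"
      have D: "D > 0" by (simp add: D_def)
      have "2 * t * \<beta> + t^2 * \<alpha> \<le> 2 * t * \<beta> + t^2 * D"
        by (intro add_left_mono mult_left_mono) (auto simp: D_def)
      also have "\<dots> = - (\<beta>^2) / D"
        using D by (simp add: t_def power2_eq_square field_simps)
      also have "\<dots> < 0" using D \<open>\<beta> \<noteq> 0\<close> by (simp add: divide_neg_pos)
      finally show False using q[of t] by simp
    qed
    then show ?thesis by (simp add: \<beta>_def)
  qed
  have "v \<bullet> (A *v w - \<mu> *\<^sub>R w) = 0"
    using vw Av by (simp add: inner_diff_right symi)
  from key[OF this] have "A *v w = \<mu> *s w" by (simp add: scalar_mult_eq_scaleR)
  moreover have "w \<noteq> 0" using ww by auto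
  moreover have "\<mu> * (u \<bullet> u) \<le> u \<bullet> (A *v u)" using ray u by (simp add: inner_commute)
  ultimately show ?thesis using that vw by (simp add: inner_commute)
qed

text \<open>The all-ones vector and a minimising eigenvector orthogonal to it are independent, so
  \<open>0\<close> and \<open>\<mu>\<close> are two roots counted with multiplicity, and neither
  exceeds \<open>\<rho>\<close>.\<close>

lemma second_eigenvalue_le:
  fixes A :: "real^'n^'n" and u :: "real^'n"
  assumes sym: "transpose A = A" and psd: "\<And>x. 0 \<le> x \<bullet> (A *v x)" and A1: "A *v 1 = 0"
    and u: "u \<noteq> 0" "u \<bullet> 1 = 0" and \<rho>: "u \<bullet> (A *v u) \<le> \<rho> * (u \<bullet> u)"
  shows "sorted_list_of_multiset (proots (charpoly A)) ! 1 \<le> \<rho>"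
proof -
  obtain w \<mu> where w: "w \<bullet> 1 = 0" "w \<noteq> 0" "A *v w = \<mu> *s w" and \<mu>: "\<mu> * (u \<bullet> u) \<le> u \<bullet> (A *v u)"
    using exists_min_eigenvector_orthogonal[OF sym A1 u] by blast
  have "\<exists>a b. w $ a \<noteq> w $ b"
  proof (rule ccontr)
    assume "\<not> ?thesis"
    then have "w = (w $ undefined) *\<^sub>R 1" by (auto simp: vec_eq_iff)
    then have "w \<bullet> w = 0" using w(1) by (metis inner_scaleR_right mult_zero_right)
    then show False using w(2) by simp
  qed
  then obtain a b where "w $ a \<noteq> w $ b" by blast
  then have dvd: "[:- 0, 1:] * [:- \<mu>, 1:] dvd charpoly A"
    using charpoly_dvd_of_eigenvectors[of A 1 0 w \<mu> a b] A1 w by simp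
  then obtain q where q: "charpoly A = [:- 0, 1:] * [:- \<mu>, 1:] * q" by (rule dvdE)
  then have "q \<noteq> 0" using charpoly_nonzero[OF psd] by auto
  then have "proots (charpoly A) = {#0, \<mu>#} + proots q"
    unfolding q by (subst proots_mult; (subst proots_mult)?) (auto simp: proots_linear_factor)
  then have "{#0, \<mu>#} \<subseteq># mset (sorted_list_of_multiset (proots (charpoly A)))" by simp
  then have "sorted_list_of_multiset (proots (charpoly A)) ! 1 \<le> max 0 \<mu>"
    by (intro sorted_nth_1_le) simp_all
  moreover have "u \<bullet> u > 0" using u by simp
  then have "\<mu> \<le> \<rho>" "0 \<le> \<rho>"
    using \<mu> \<rho> psd[of u] by (smt (verit) mult_le_cancel_right mult_neg_pos)+
  ultimately show ?thesis by linarith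
qed

section \<open>Cycles and the Laplacian of a graph\<close>

text \<open>Take a longest path. By parity its first vertex \<open>v0\<close> has a second edge in
  \<open>z\<close>; by maximality the other end of that edge is on the path, which closes a
  cycle.\<close>

lemma even_edge_set_has_cycle:
  fixes z :: "'v::finite set set"
  assumes simple: "simple_graph z" and ne: "z \<noteq> {}" and ev: "\<And>v. even (card {e\<in>z. v \<in> e})"
  shows "\<exists>vs. is_cycle z vs"
proof -
  define path where "path vs \<longleftrightarrow> 2 \<le> length vs \<and> distinct vs \<and>
      (\<forall>i. Suc i < length vs \<longrightarrow> {vs ! i, vs ! Suc i} \<in> z)" for vs :: "'v list"
  obtain a b where ab: "{a, b} \<in> z" "a \<noteq> b"
  proof -
    obtain e where "e \<in> z" using ne by blast
    moreover obtain a b where "e = {a, b}" "a \<noteq> b"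
      using simple \<open>e \<in> z\<close> by (auto simp: simple_graph_def card_2_iff)
    ultimately show thesis using that by blast
  qed
  have "path [a, b]" using ab by (auto simp: path_def less_Suc_eq)
  moreover have "\<forall>vs. path vs \<longrightarrow> length vs < Suc CARD('v)"
    using card_mono[OF finite subset_UNIV] by (metis path_def distinct_card le_imp_less_Suc)
  ultimately obtain vs where vs: "path vs" and max: "\<And>ws. path ws \<Longrightarrow> length ws \<le> length vs"
    using ex_has_greatest_nat[of path "[a, b]" length "Suc CARD('v)"] by blast
  define v0 v1 where "v0 = vs ! 0" and "v1 = vs ! 1"
  have len: "2 \<le> length vs" and dist: "distinct vs"
    and edges: "\<And>i. Suc i < length vs \<Longrightarrow> {vs ! i, vs ! Suc i} \<in> z"
    using vs by (auto simp: path_def)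
  have e01: "{v0, v1} \<in> z" using edges[of 0] len by (simp add: v0_def v1_def)
  have "card {e\<in>z. v0 \<in> e} \<noteq> 1" using ev[of v0] by auto
  then have "{e\<in>z. v0 \<in> e} \<noteq> {{v0, v1}}" by force
  moreover have "{v0, v1} \<in> {e\<in>z. v0 \<in> e}" using e01 by simp
  ultimately obtain e where e: "e \<in> z" "v0 \<in> e" "e \<noteq> {v0, v1}" by blast
  have "card e = 2" using e simple by (simp add: simple_graph_def)
  then obtain p q where "e = {p, q}" "p \<noteq> q" by (auto simp: card_2_iff)
  then obtain w where w: "e = {v0, w}" "w \<noteq> v0" using e(2) by (cases "p = v0") auto
  have "w \<noteq> v1" using e w by auto
  have "w \<in> set vs"
  proof (rule ccontr)
    assume "w \<notin> set vs"
    have "path (w # vs)"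
      unfolding path_def
    proof (intro conjI allI impI)
      fix i assume i: "Suc i < length (w # vs)"
      show "{(w # vs) ! i, (w # vs) ! Suc i} \<in> z"
      proof (cases i)
        case 0
        then show ?thesis using w e by (simp add: v0_def insert_commute)
      next
        case (Suc j)
        then show ?thesis using edges[of j] i by simp
      qed
    qed (use len dist \<open>w \<notin> set vs\<close> in auto)
    from max[OF this] show False by simp
  qed
  then obtain j where j: "j < length vs" "vs ! j = w" by (auto simp: in_set_conv_nth)
  have "j \<noteq> 0" using j w v0_def by metis
  moreover have "j \<noteq> 1" using j \<open>w \<noteq> v1\<close> v1_def by metis
  ultimately have "2 \<le> j" by simp
  have "is_cycle z (take (Suc j) vs)"
    unfolding is_cycle_def
  proof (intro conjI allI impI)
    show "3 \<le> length (take (Suc j) vs)" using \<open>2 \<le> j\<close> j by simp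
    show "distinct (take (Suc j) vs)" using dist by simp
    fix i assume i: "i < length (take (Suc j) vs)"
    have l: "length (take (Suc j) vs) = Suc j" using j by simp
    show "{take (Suc j) vs ! i, take (Suc j) vs ! (Suc i mod length (take (Suc j) vs))} \<in> z"
    proof (cases "i = j")
      case True
      then show ?thesis using w e j unfolding l by (simp add: v0_def insert_commute)
    next
      case False
      then have "i < j" using i l by simp
      then show ?thesis using edges[of i] j unfolding l by simp
    qed
  qed
  then show ?thesis by blast
qed

text \<open>Converts a length counted in vertices into a number of edges: from length three on, the
  pairs of consecutive vertices are distinct edges.\<close>

lemma cycle_length_le_card:
  fixes E :: "'v::finite set set"
  assumes "is_cycle E vs"
  shows "length vs \<le> card E"
proof -
  define n where "n = length vs"
  have n: "3 \<le> n" and dist: "distinct vs"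
    and edges: "\<And>i. i < n \<Longrightarrow> {vs ! i, vs ! (Suc i mod n)} \<in> E"
    using assms by (auto simp: is_cycle_def n_def)
  have "inj_on (\<lambda>i. {vs ! i, vs ! (Suc i mod n)}) {..<n}"
  proof (rule inj_onI)
    fix i j assume ij: "i \<in> {..<n}" "j \<in> {..<n}"
      and eq: "{vs ! i, vs ! (Suc i mod n)} = {vs ! j, vs ! (Suc j mod n)}"
    have lt: "i < n" "j < n" "Suc i mod n < n" "Suc j mod n < n" using ij n by auto
    have "i = j \<or> (i = Suc j mod n \<and> Suc i mod n = j)"
      using eq lt dist by (auto simp: doubleton_eq_iff nth_eq_iff_index_eq n_def)
    then show "i = j"
    proof
      assume a: "i = Suc j mod n \<and> Suc i mod n = j"
      consider "Suc j < n" "Suc i < n" | "Suc j = n" | "Suc i = n" using lt by linarith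
      then show ?thesis using a n by cases auto
    qed
  qed
  then have "card ((\<lambda>i. {vs ! i, vs ! (Suc i mod n)}) ` {..<n}) = n" by (simp add: card_image)
  moreover have "(\<lambda>i. {vs ! i, vs ! (Suc i mod n)}) ` {..<n} \<subseteq> E" using edges by auto
  ultimately show ?thesis by (metis card_mono finite n_def)
qed

lemma girth_le_card_even_edge_set:
  fixes E :: "'v::finite set set"
  assumes "simple_graph E" "girth E = enat g" "z \<subseteq> E" "z \<noteq> {}" "\<And>v. even (card {e\<in>z. v \<in> e})"
  shows "g \<le> card z"
proof -
  have "simple_graph z" using assms(1,3) by (auto simp: simple_graph_def)
  then obtain vs where vs: "is_cycle z vs" using even_edge_set_has_cycle assms(4,5) by blast
  then have "is_cycle E vs" using assms(3) by (auto simp: is_cycle_def)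
  then have "girth E \<le> enat (length vs)" unfolding girth_def by (intro INF_lower) simp
  then show ?thesis using assms(2) cycle_length_le_card[OF vs] by simp
qed

lemma girth_attained:
  fixes E :: "'v::finite set set"
  assumes "girth E = enat g"
  shows "\<exists>vs. is_cycle E vs \<and> length vs = g"
proof -
  let ?A = "(\<lambda>vs. enat (length vs)) ` {vs. is_cycle E vs}"
  have ne: "?A \<noteq> {}" using assms unfolding girth_def by (metis Inf_empty enat.distinct(1) top_enat_def)
  then have "Inf ?A = (LEAST x. x \<in> ?A)" unfolding Inf_enat_def by (rule if_not_P)
  then have "Inf ?A \<in> ?A" using ne by (metis LeastI ex_in_conv)
  then show ?thesis using assms unfolding girth_def by auto
qed

lemma handshake:
  fixes E :: "'v::finite set set"
  assumes "simple_graph E"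
  shows "(\<Sum>v\<in>UNIV. degree_of E v) = 2 * card E"
proof -
  have "(\<Sum>v\<in>UNIV. degree_of E v) = (\<Sum>v\<in>UNIV. \<Sum>e\<in>E. if v \<in> e then 1 else 0)"
    by (simp add: degree_of_def sum.If_cases Int_def)
  also have "\<dots> = (\<Sum>e\<in>E. \<Sum>v\<in>UNIV. if v \<in> e then 1 else 0)" by (rule sum.swap)
  also have "\<dots> = (\<Sum>e\<in>E. 2)"
    using assms by (intro sum.cong refl) (simp add: sum.If_cases simple_graph_def)
  finally show ?thesis by simp
qed

lemma degree_of_eq_card_neighbours:
  fixes E :: "'v::finite set set"
  assumes "simple_graph E"
  shows "degree_of E u = card {v. {u, v} \<in> E}"
proof -
  have "bij_betw (\<lambda>v. {u, v}) {v. {u, v} \<in> E} {e\<in>E. u \<in> e}"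
  proof (rule bij_betwI')
    fix e assume "e \<in> {e\<in>E. u \<in> e}"
    moreover from this obtain p q where "e = {p, q}"
      using assms by (auto simp: simple_graph_def card_2_iff)
    ultimately show "\<exists>v\<in>{v. {u, v} \<in> E}. e = {u, v}" by (auto simp: insert_commute)
  qed (auto simp: doubleton_eq_iff)
  then show ?thesis by (simp add: degree_of_def bij_betw_same_card)
qed

lemma laplacian_mult_vec:
  fixes E :: "'v::finite set set"
  assumes "simple_graph E"
  shows "(laplacian E *v x) $ u = (\<Sum>v\<in>UNIV. of_bool ({u, v} \<in> E) * (x $ u - x $ v))"
proof -
  have "(laplacian E *v x) $ u = (\<Sum>v\<in>UNIV. (if u = v then real (degree_of E u) * x $ v else 0)
      - of_bool ({u, v} \<in> E) * x $ v)"
    unfolding matrix_vector_mult_def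
    by (auto intro!: sum.cong simp: laplacian_def degree_matrix_def adjacency_matrix_def left_diff_distrib)
  also have "\<dots> = real (degree_of E u) * x $ u - (\<Sum>v\<in>UNIV. of_bool ({u, v} \<in> E) * x $ v)"
    by (simp add: sum_subtractf)
  also have "real (degree_of E u) * x $ u = (\<Sum>v\<in>UNIV. of_bool ({u, v} \<in> E) * x $ u)"
    by (simp add: degree_of_eq_card_neighbours[OF assms])
  finally show ?thesis by (simp add: right_diff_distrib sum_subtractf)
qed

lemma transpose_laplacian: "transpose (laplacian E) = laplacian E"
  by (auto simp: vec_eq_iff transpose_def laplacian_def degree_matrix_def adjacency_matrix_def insert_commute)

text \<open>Adding the double sum and its copy with \<open>u\<close> and \<open>v\<close> exchanged
  gives a sum of squares.\<close>

lemma laplacian_psd: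
  fixes E :: "'v::finite set set"
  assumes "simple_graph E"
  shows "0 \<le> x \<bullet> (laplacian E *v x)"
proof -
  let ?a = "\<lambda>u v. of_bool ({u, v} \<in> E) :: real"
  have 1: "x \<bullet> (laplacian E *v x) = (\<Sum>u\<in>UNIV. \<Sum>v\<in>UNIV. ?a u v * (x $ u * (x $ u - x $ v)))"
    unfolding inner_vec_def laplacian_mult_vec[OF assms]
    by (simp add: sum_distrib_left mult_ac del: sum_of_bool_mult_eq sum_mult_of_bool_eq)
  also have "\<dots> = (\<Sum>v\<in>UNIV. \<Sum>u\<in>UNIV. ?a u v * (x $ u * (x $ u - x $ v)))" by (rule sum.swap)
  finally have 2: "x \<bullet> (laplacian E *v x) = (\<Sum>u\<in>UNIV. \<Sum>v\<in>UNIV. ?a u v * (x $ v * (x $ v - x $ u)))"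
    by (simp add: insert_commute del: sum_of_bool_mult_eq sum_mult_of_bool_eq)
  have "2 * (x \<bullet> (laplacian E *v x)) = (\<Sum>u\<in>UNIV. \<Sum>v\<in>UNIV. ?a u v * (x $ u - x $ v)\<^sup>2)"
  proof -
    have "2 * (x \<bullet> (laplacian E *v x)) = (\<Sum>u\<in>UNIV. \<Sum>v\<in>UNIV.
        ?a u v * (x $ u * (x $ u - x $ v)) + ?a u v * (x $ v * (x $ v - x $ u)))"
      unfolding sum.distrib using 1 2 by linarith
    also have "\<dots> = (\<Sum>u\<in>UNIV. \<Sum>v\<in>UNIV. ?a u v * (x $ u - x $ v)\<^sup>2)"
      by (intro sum.cong refl) (simp add: power2_eq_square algebra_simps)
    finally show ?thesis .
  qed
  also have "\<dots> \<ge> 0" by (intro sum_nonneg) auto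
  finally show ?thesis by simp
qed

lemma cycle_two_neighbours:
  fixes E :: "'v::finite set set"
  assumes cyc: "is_cycle E vs" and u: "u \<in> set vs"
  shows "2 \<le> card {v \<in> set vs. {u, v} \<in> E}"
proof -
  define n where "n = length vs"
  have n: "3 \<le> n" and dist: "distinct vs"
    and edges: "\<And>i. i < n \<Longrightarrow> {vs ! i, vs ! (Suc i mod n)} \<in> E"
    using cyc by (auto simp: is_cycle_def n_def)
  obtain i where i: "i < n" "vs ! i = u" using u by (auto simp: in_set_conv_nth n_def)
  define j where "j = (if i = 0 then n - 1 else i - 1)"
  define k where "k = Suc i mod n"
  have k_alt: "k = (if i = n - 1 then 0 else Suc i)" using i n by (auto simp: k_def)
  have jk: "j < n" "k < n" "j \<noteq> k" and "Suc j mod n = i"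
    using i n by (auto simp: j_def k_alt split: if_splits)
  have "{u, vs ! k} \<in> E" using edges[OF i(1)] i by (simp add: k_def)
  moreover have "{u, vs ! j} \<in> E"
    using edges[OF jk(1)] i \<open>Suc j mod n = i\<close> by (simp add: insert_commute)
  ultimately have "{vs ! j, vs ! k} \<subseteq> {v \<in> set vs. {u, v} \<in> E}" using jk by (auto simp: n_def)
  then have "card {vs ! j, vs ! k} \<le> card {v \<in> set vs. {u, v} \<in> E}" by (intro card_mono) auto
  moreover have "vs ! j \<noteq> vs ! k" using jk dist by (auto simp: n_def nth_eq_iff_index_eq)
  ultimately show ?thesis by simp
qed

text \<open>The test vector is the indicator \<open>c\<close> of the cycle minus its mean. Its
  quadratic form equals that of \<open>c\<close> and counts the edges leaving the cycle: each of the
  \<open>g\<close> vertices has at least two neighbours on the cycle, so at most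
  \<open>d - 2\<close> outside. Its squared norm is \<open>g * (n - g) / n\<close>.\<close>

lemma algebraic_connectivity_le_cycle:
  fixes E :: "'v::finite set set"
  assumes simple: "simple_graph E" and reg: "\<And>v. degree_of E v = d"
    and cyc: "is_cycle E vs" and len: "length vs < CARD('v)"
  shows "algebraic_connectivity E \<le>
    real CARD('v) * (real d - 2) / (real CARD('v) - real (length vs))"
proof -
  define n g where "n = real CARD('v)" and "g = real (length vs)"
  have g: "3 \<le> g" "g < n" and dist: "distinct vs" using cyc len by (auto simp: is_cycle_def n_def g_def)
  define c :: "real^'v" where "c = (\<chi> v. of_bool (v \<in> set vs))"
  define u where "u = c - (g / n) *\<^sub>R 1"
  have card_C: "card (set vs) = length vs" using dist by (rule distinct_card)
  have c1: "c \<bullet> 1 = g" and cc: "c \<bullet> c = g"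
    by (simp_all add: inner_vec_def c_def g_def card_C)
  have one: "(1::real^'v) \<bullet> 1 = n" by (simp add: inner_vec_def n_def)
  have L1: "laplacian E *v 1 = 0" by (simp add: vec_eq_iff laplacian_mult_vec[OF simple])
  have Lu: "laplacian E *v u = laplacian E *v c"
    by (simp add: u_def matrix_vector_mult_diff_distrib matrix_vector_mult_scaleR L1)
  have "1 \<bullet> (laplacian E *v c) = (laplacian E *v 1) \<bullet> c"
    by (metis dot_lmul_matrix transpose_laplacian transpose_matrix_vector)
  then have one_Lc: "1 \<bullet> (laplacian E *v c) = 0" by (simp add: L1)
  have "u \<bullet> (laplacian E *v u) = c \<bullet> (laplacian E *v c)"
    unfolding Lu by (simp add: u_def inner_diff_left one_Lc)
  also have "\<dots> = (\<Sum>v\<in>set vs. (laplacian E *v c) $ v)"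
    by (simp add: inner_vec_def c_def)
  also have "\<dots> \<le> (\<Sum>v\<in>set vs. real d - 2)"
  proof (rule sum_mono)
    fix v assume v: "v \<in> set vs"
    have "(laplacian E *v c) $ v = (\<Sum>w\<in>UNIV. of_bool ({v, w} \<in> E)) - (\<Sum>w\<in>UNIV. of_bool ({v, w} \<in> E) * of_bool (w \<in> set vs))"
      unfolding laplacian_mult_vec[OF simple] using v
      by (simp add: c_def right_diff_distrib sum_subtractf del: sum_of_bool_mult_eq sum_mult_of_bool_eq)
    also have "(\<Sum>w\<in>UNIV. of_bool ({v, w} \<in> E)) = real (degree_of E v)"
      by (simp add: degree_of_eq_card_neighbours[OF simple])
    also have "(\<Sum>w\<in>UNIV. of_bool ({v, w} \<in> E) * of_bool (w \<in> set vs)) = real (card {w\<in>set vs. {v, w} \<in> E})"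
      by (simp add: Int_def conj_commute)
    finally show "(laplacian E *v c) $ v \<le> real d - 2"
      using cycle_two_neighbours[OF cyc v] reg by simp
  qed
  also have "\<dots> = g * (real d - 2)" by (simp add: card_C g_def)
  finally have num: "u \<bullet> (laplacian E *v u) \<le> g * (real d - 2)" .
  have uu: "u \<bullet> u = g * (n - g) / n"
    using g by (simp add: u_def inner_diff_left inner_diff_right c1 cc one inner_commute[of 1 c] field_simps)
  have "u \<noteq> 0" using uu g by auto
  moreover have "u \<bullet> 1 = 0" using g by (simp add: u_def inner_diff_left c1 one)
  moreover have "u \<bullet> (laplacian E *v u) \<le> n * (real d - 2) / (n - g) * (u \<bullet> u)"
    using num g by (simp add: uu mult.commute)
  ultimately show ?thesis
    unfolding algebraic_connectivity_def n_def[symmetric] g_def[symmetric]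
    by (intro second_eigenvalue_le transpose_laplacian laplacian_psd simple L1)
qed

section \<open>Complexes over the field of two elements\<close>

text \<open>These rules would turn ring operations on \<open>bit\<close> into bitwise ones and
  indicator sums into sums over intersections; the calculations below keep the ring form and apply
  the latter rules by hand.\<close>

declare add_bit_eq_xor [simp del] mult_bit_eq_and [simp del]
  sum_mult_of_bool_eq [simp del] sum_of_bool_mult_eq [simp del] sum_of_bool_eq [simp del]

lemma bit_add_self [simp]: "(x::bit) + x = 0"
  by (cases x) simp_all

lemma bit_add_self_left [simp]: "(x::bit) + (x + y) = y"
  by (simp add: add.assoc[symmetric])

lemma bit_add_eq_0_iff [simp]: "(x::bit) + y = 0 \<longleftrightarrow> x = y"
  by (cases x; cases y) simp_all

lemma of_nat_bit_eq_0_iff: "(of_nat n :: bit) = 0 \<longleftrightarrow> even n"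
  by (induction n) auto

lemma bit_sum_symdiff:
  fixes h :: "'a \<Rightarrow> bit"
  assumes "finite z" "finite w"
  shows "sum h ((z - w) \<union> (w - z)) = sum h z + sum h w"
proof -
  have "sum h z = sum h (z - w) + sum h (z \<inter> w)"
    using assms by (metis add.commute sum.Int_Diff)
  moreover have "sum h w = sum h (w - z) + sum h (z \<inter> w)"
    using assms by (metis add.commute sum.Int_Diff inf_commute)
  moreover have "sum h ((z - w) \<union> (w - z)) = sum h (z - w) + sum h (w - z)"
    using assms by (intro sum.union_disjoint) auto
  ultimately show ?thesis by (simp add: ac_simps)
qed

text \<open>A vector outside a span is detected by a functional that kills the span. This is the
  only duality needed to turn knowledge of cocycles into knowledge of boundaries, without dimensions
  or quotients.\<close>

lemma bit_span_or_separated: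
  fixes b :: "'f \<Rightarrow> 'y \<Rightarrow> bit" and z :: "'y \<Rightarrow> bit"
  assumes "finite F" "finite Y"
  shows "(\<exists>\<Phi>. \<forall>y\<in>Y. z y = (\<Sum>f\<in>F. \<Phi> f * b f y)) \<or>
    (\<exists>a. (\<forall>f\<in>F. (\<Sum>y\<in>Y. a y * b f y) = 0) \<and> (\<Sum>y\<in>Y. a y * z y) = 1)"
  using assms(1)
proof (induction F arbitrary: z rule: finite_induct)
  case empty
  show ?case
  proof (cases "\<exists>y\<in>Y. z y = 1")
    case True
    then obtain y where y: "y \<in> Y" "z y = 1" by blast
    then have "Y \<inter> {x. x = y} = {y}" by auto
    then have "(\<Sum>y'\<in>Y. of_bool (y' = y) * z y') = 1"
      using y assms(2) by (simp add: sum_of_bool_mult_eq)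
    then show ?thesis
      by (intro disjI2 exI[of _ "\<lambda>y'. of_bool (y' = y)"]) (simp only: ball_simps simp_thms)
  next
    case False
    then have "\<forall>y\<in>Y. z y = (\<Sum>f\<in>{}. 0 * b f y)" by simp
    then show ?thesis by (intro disjI1 exI[of _ "\<lambda>_. 0"])
  qed
next
  case (insert f F)
  define dot where "dot a u = (\<Sum>y\<in>Y. a y * u y)" for a u :: "'y \<Rightarrow> bit"
  have dotl: "dot (\<lambda>y. a y + a' y) u = dot a u + dot a' u" for a a' u
    by (simp add: dot_def distrib_right sum.distrib)
  have dotr: "dot a (\<lambda>y. u y + u' y) = dot a u + dot a u'" for a u u'
    by (simp add: dot_def distrib_left sum.distrib)
  show ?case
  proof (cases "\<exists>\<Phi>. \<forall>y\<in>Y. z y = (\<Sum>f\<in>F. \<Phi> f * b f y)")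
    case True
    then obtain \<Phi> where \<Phi>: "\<forall>y\<in>Y. z y = (\<Sum>f\<in>F. \<Phi> f * b f y)" by blast
    have "(\<Sum>f'\<in>insert f F. (\<Phi>(f := 0)) f' * b f' y) = (\<Sum>f\<in>F. \<Phi> f * b f y)" for y
    proof -
      have "(\<Sum>f'\<in>F. (\<Phi>(f := 0)) f' * b f' y) = (\<Sum>f\<in>F. \<Phi> f * b f y)"
        using insert.hyps by (intro sum.cong) auto
      then show ?thesis using insert.hyps by simp
    qed
    then have "\<forall>y\<in>Y. z y = (\<Sum>f'\<in>insert f F. (\<Phi>(f := 0)) f' * b f' y)" using \<Phi> by simp
    then show ?thesis by (intro disjI1 exI[of _ "\<Phi>(f := 0)"])
  next
    case False
    then obtain a1 where a1: "\<forall>f\<in>F. dot a1 (b f) = 0" "dot a1 z = 1"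
      using insert.IH[of z] unfolding dot_def by blast
    show ?thesis
    proof (cases "\<exists>\<Phi>. \<forall>y\<in>Y. z y + b f y = (\<Sum>f\<in>F. \<Phi> f * b f y)")
      case True
      then obtain \<Phi> where \<Phi>: "\<forall>y\<in>Y. z y + b f y = (\<Sum>f\<in>F. \<Phi> f * b f y)" by blast
      have "z y = (\<Sum>f'\<in>insert f F. (\<Phi>(f := 1)) f' * b f' y)" if "y \<in> Y" for y
      proof -
        have "(\<Sum>f'\<in>insert f F. (\<Phi>(f := 1)) f' * b f' y) = b f y + (\<Sum>f'\<in>F. (\<Phi>(f := 1)) f' * b f' y)"
          using insert.hyps by simp
        also have "(\<Sum>f'\<in>F. (\<Phi>(f := 1)) f' * b f' y) = (\<Sum>f'\<in>F. \<Phi> f' * b f' y)"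
          using insert.hyps by (intro sum.cong) auto
        also have "\<dots> = z y + b f y" using \<Phi> that by simp
        finally show ?thesis by (simp add: ac_simps)
      qed
      then show ?thesis by (intro disjI1 exI[of _ "\<Phi>(f := 1)"] ballI)
    next
      case False
      then obtain a2 where a2: "\<forall>f\<in>F. dot a2 (b f) = 0" "dot a2 (\<lambda>y. z y + b f y) = 1"
        using insert.IH[of "\<lambda>y. z y + b f y"] unfolding dot_def by blast
      consider "dot a1 (b f) = 0" | "dot a2 (b f) = 0" | "dot a1 (b f) = 1" "dot a2 (b f) = 1"
        by (metis bit_not_one_iff)
      then have "\<exists>a. (\<forall>f\<in>insert f F. dot a (b f) = 0) \<and> dot a z = 1"
      proof cases
        case 1 then show ?thesis using a1 by auto
      next
        case 2 then show ?thesis using a2 by (auto simp: dotr)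
      next
        \<comment> \<open>Here \<open>a2\<close> is 1 on both \<open>z + b f\<close> and
          \<open>b f\<close>, hence 0 on \<open>z\<close>. So the sum of the two functionals still
          takes the value 1 on \<open>z\<close>, and it now kills \<open>b f\<close>.\<close>
        case 3
        then have "(\<forall>g\<in>insert f F. dot (\<lambda>y. a1 y + a2 y) (b g) = 0) \<and> dot (\<lambda>y. a1 y + a2 y) z = 1"
          using a1 a2 by (auto simp: dotl dotr)
        then show ?thesis by blast
      qed
      then show ?thesis unfolding dot_def by blast
    qed
  qed
qed

text \<open>Each functional at most halves the space: symmetric difference with one element of value
  1 embeds the elements of value 1 into those of value 0.\<close>

lemma card_bit_kernel:
  fixes \<Lambda> :: "'i \<Rightarrow> 'e \<Rightarrow> bit"
  assumes "finite E" "finite I"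
  shows "2 ^ card E \<le> card {z. z \<subseteq> E \<and> (\<forall>i\<in>I. sum (\<Lambda> i) z = 0)} * 2 ^ card I"
  using assms(2)
proof (induction I rule: finite_induct)
  case empty
  then show ?case using assms(1) by (simp add: card_Pow flip: Pow_def)
next
  case (insert i I)
  define K where "K = {z. z \<subseteq> E \<and> (\<forall>i\<in>I. sum (\<Lambda> i) z = 0)}"
  define K0 where "K0 = {z\<in>K. sum (\<Lambda> i) z = 0}"
  define K1 where "K1 = {z\<in>K. sum (\<Lambda> i) z = 1}"
  have fin: "finite K" using assms(1) by (auto simp: K_def)
  have fz: "finite z" if "z \<in> K" for z using that assms(1) by (auto simp: K_def intro: finite_subset)
  have "K = K0 \<union> K1" by (auto simp: K0_def K1_def)
  then have "card K \<le> card K0 + card K1" by (metis card_Un_le)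
  moreover have "card K1 \<le> card K0"
  proof (cases "K1 = {}")
    case False
    then obtain z0 where z0: "z0 \<in> K1" by blast
    let ?h = "\<lambda>z. (z - z0) \<union> (z0 - z)"
    have "inj ?h" by (rule injI) blast
    moreover have "?h ` K1 \<subseteq> K0"
      using z0 fz by (auto simp: K1_def K0_def K_def bit_sum_symdiff)
    ultimately show ?thesis
      using fin by (intro card_inj_on_le[of ?h] inj_on_subset[OF \<open>inj ?h\<close>]) (simp_all add: K0_def)
  qed simp
  ultimately have K: "card K \<le> 2 * card K0" by simp
  have "2 ^ card E \<le> card K * 2 ^ card I" using insert.IH by (simp add: K_def)
  also have "\<dots> \<le> (2 * card K0) * 2 ^ card I" using K by (rule mult_right_mono) simp
  also have "\<dots> = card K0 * 2 ^ card (insert i I)" using insert.hyps by simp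
  also have "K0 = {z. z \<subseteq> E \<and> (\<forall>i\<in>insert i I. sum (\<Lambda> i) z = 0)}"
    by (auto simp: K0_def K_def)
  finally show ?case .
qed

text \<open>A finite 2-complex over the field of two elements: \<open>Y\<close> is the set of edges, \<open>s\<close> and \<open>t\<close>
  give the end points of an edge and \<open>L\<close> and \<open>R\<close> the faces on its two sides. The last assumption
  bounds the dimension of the first cohomology by \<open>r\<close>.\<close>

locale bit_complex =
  fixes X :: "'t set" and Y :: "'y set" and s t :: "'y \<Rightarrow> 't" and L R :: "'y \<Rightarrow> 'f"
    and r :: nat and D :: "nat \<Rightarrow> 'y set"
  assumes finite_X: "finite X" and finite_Y: "finite Y"
    and ends: "y \<in> Y \<Longrightarrow> s y \<in> X \<and> t y \<in> X"
    and boundary_boundary: "x \<in> X \<Longrightarrow>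
      (\<Sum>y\<in>Y. (of_bool (s y = x) + of_bool (t y = x)) * (of_bool (L y = f) + of_bool (R y = f))) = (0::bit)"
    and cohomology: "(\<And>f. (\<Sum>y\<in>Y. a y * (of_bool (L y = f) + of_bool (R y = f))) = (0::bit)) \<Longrightarrow>
      \<exists>\<phi> \<alpha>. \<forall>y\<in>Y. a y = \<phi> (s y) + \<phi> (t y) + (\<Sum>j<r. \<alpha> j * of_bool (y \<in> D j))"
begin

lemma sum_incidence:
  fixes h :: "'x \<Rightarrow> bit"
  assumes "finite S" "p \<in> S" "q \<in> S"
  shows "(\<Sum>x\<in>S. h x * (of_bool (p = x) + of_bool (q = x))) = h p + h q"
proof -
  have "S \<inter> {x. p = x} = {p}" "S \<inter> {x. q = x} = {q}" using assms by auto
  then show ?thesis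
    using assms(1) by (simp add: distrib_left sum.distrib sum_mult_of_bool_eq)
qed

text \<open>Otherwise some \<open>a\<close> vanishes on all boundaries but not on \<open>z\<close>.
  Then \<open>a\<close> is a cocycle, so \<open>cohomology\<close> writes it as a coboundary plus a
  combination of the \<open>D j\<close>, and both summands vanish on \<open>z\<close>.\<close>

lemma cycle_is_boundary:
  fixes z :: "'y \<Rightarrow> bit"
  assumes z: "\<And>x. x \<in> X \<Longrightarrow> (\<Sum>y\<in>Y. z y * (of_bool (s y = x) + of_bool (t y = x))) = 0"
    and D: "\<And>j. j < r \<Longrightarrow> (\<Sum>y\<in>Y. z y * of_bool (y \<in> D j)) = 0"
  shows "\<exists>\<Phi>. \<forall>y\<in>Y. z y = \<Phi> (L y) + \<Phi> (R y)"
proof -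
  define F where "F = L ` Y \<union> R ` Y"
  have finF: "finite F" using finite_Y by (simp add: F_def)
  let ?b = "\<lambda>f y. of_bool (L y = f) + of_bool (R y = f) :: bit"
  from bit_span_or_separated[OF finF finite_Y, of z ?b]
  show ?thesis
  proof
    assume "\<exists>\<Phi>. \<forall>y\<in>Y. z y = (\<Sum>f\<in>F. \<Phi> f * ?b f y)"
    then obtain \<Phi> where "\<forall>y\<in>Y. z y = (\<Sum>f\<in>F. \<Phi> f * ?b f y)" by blast
    then have "\<forall>y\<in>Y. z y = \<Phi> (L y) + \<Phi> (R y)"
      using sum_incidence[OF finF] by (simp add: F_def)
    then show ?thesis by blast
  next
    assume "\<exists>a. (\<forall>f\<in>F. (\<Sum>y\<in>Y. a y * ?b f y) = 0) \<and> (\<Sum>y\<in>Y. a y * z y) = 1"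
    then obtain a where a: "\<forall>f\<in>F. (\<Sum>y\<in>Y. a y * ?b f y) = 0" and az: "(\<Sum>y\<in>Y. a y * z y) = 1" by blast
    have "(\<Sum>y\<in>Y. a y * ?b f y) = 0" for f
    proof (cases "f \<in> F")
      case False
      then show ?thesis by (intro sum.neutral) (auto simp: F_def)
    qed (use a in auto)
    from cohomology[OF this] obtain \<phi> \<alpha> where
      pot: "\<forall>y\<in>Y. a y = \<phi> (s y) + \<phi> (t y) + (\<Sum>j<r. \<alpha> j * of_bool (y \<in> D j))" by blast
    have "(\<Sum>y\<in>Y. a y * z y) = (\<Sum>y\<in>Y. z y * (\<phi> (s y) + \<phi> (t y)))
        + (\<Sum>y\<in>Y. \<Sum>j<r. \<alpha> j * (z y * of_bool (y \<in> D j)))"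
      unfolding sum.distrib[symmetric]
      by (intro sum.cong refl) (simp add: pot distrib_left sum_distrib_left mult_ac)
    also have "(\<Sum>y\<in>Y. \<Sum>j<r. \<alpha> j * (z y * of_bool (y \<in> D j))) = 0"
      by (subst sum.swap) (use D in \<open>simp flip: sum_distrib_left\<close>)
    also have "(\<Sum>y\<in>Y. z y * (\<phi> (s y) + \<phi> (t y)))
        = (\<Sum>y\<in>Y. z y * (\<Sum>x\<in>X. \<phi> x * (of_bool (s y = x) + of_bool (t y = x))))"
      using ends by (intro sum.cong refl) (simp add: sum_incidence[OF finite_X])
    also have "\<dots> = (\<Sum>x\<in>X. \<phi> x * (\<Sum>y\<in>Y. z y * (of_bool (s y = x) + of_bool (t y = x))))"
      unfolding sum_distrib_left by (subst sum.swap) (simp add: mult_ac)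
    also have "\<dots> = 0" using z by simp
    finally show ?thesis using az by simp
  qed
qed

definition adj :: "'t set \<Rightarrow> 't rel" where
  "adj S = {(x, x'). x \<in> S \<and> x' \<in> S \<and> (\<exists>y\<in>Y. {s y, t y} = {x, x'})}"

text \<open>Add up the edges of the path modulo 2; every intermediate vertex is counted twice and
  cancels.\<close>

lemma path_chain:
  assumes "(x, x') \<in> (adj S)\<^sup>*"
  shows "\<exists>p::'y \<Rightarrow> bit. (\<forall>y. p y \<noteq> 0 \<longrightarrow> y \<in> Y \<and> s y \<in> S \<and> t y \<in> S) \<and>
     (\<forall>w. (\<Sum>y\<in>Y. p y * (of_bool (s y = w) + of_bool (t y = w))) = of_bool (x = w) + of_bool (x' = w))"
  using assms
proof (induction rule: rtrancl_induct)
  case base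
  show ?case by (rule exI[of _ "\<lambda>_. 0"]) simp
next
  case (step x1 x2)
  then obtain p :: "'y \<Rightarrow> bit" where p: "\<And>y. p y \<noteq> 0 \<Longrightarrow> y \<in> Y \<and> s y \<in> S \<and> t y \<in> S"
    "\<And>w. (\<Sum>y\<in>Y. p y * (of_bool (s y = w) + of_bool (t y = w))) = of_bool (x = w) + of_bool (x1 = w)"
    by blast
  obtain y0 where y0: "y0 \<in> Y" "{s y0, t y0} = {x1, x2}" "x1 \<in> S" "x2 \<in> S"
    using step.hyps by (auto simp: adj_def)
  let ?p = "\<lambda>y. p y + of_bool (y = y0)"
  have one: "(\<Sum>y\<in>Y. of_bool (y = y0) * u y) = u y0" for u :: "'y \<Rightarrow> bit"
  proof -
    have "Y \<inter> {y. y = y0} = {y0}" using y0 by auto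
    then show ?thesis using finite_Y by (simp add: sum_of_bool_mult_eq)
  qed
  have "(\<Sum>y\<in>Y. ?p y * (of_bool (s y = w) + of_bool (t y = w))) = of_bool (x = w) + of_bool (x2 = w)" for w
  proof -
    have "(\<Sum>y\<in>Y. ?p y * (of_bool (s y = w) + of_bool (t y = w)))
        = (of_bool (x = w) + of_bool (x1 = w)) + (of_bool (s y0 = w) + of_bool (t y0 = w))"
      by (simp only: distrib_right[of "p _"] sum.distrib one p(2))
    moreover have "of_bool (s y0 = w) + of_bool (t y0 = w) = (of_bool (x1 = w) + of_bool (x2 = w) :: bit)"
      using y0(2) by (auto simp: doubleton_eq_iff add.commute)
    ultimately show ?thesis by (simp add: ac_simps)
  qed
  moreover have "y \<in> Y \<and> s y \<in> S \<and> t y \<in> S" if "?p y \<noteq> 0" for y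
  proof (cases "y = y0")
    case True
    then show ?thesis using y0 by (metis insert_iff singletonD)
  next
    case False
    then show ?thesis using p(1)[of y] that by simp
  qed
  ultimately show ?case by (intro exI[of _ ?p], intro conjI[OF allI allI] impI)
qed

text \<open>A graph that is a minor of the 1-skeleton: \<open>B v\<close> is the branch set of the vertex \<open>v\<close>.
  Edges that are neither inside a branch set nor of the form \<open>ye e\<close> are not used by the minor, so
  the faces on their two sides lie in the same region of the complement.\<close>

lemma minor_euler_bound:
  fixes E :: "'v::finite set set" and B :: "'v \<Rightarrow> 't set" and ye :: "'v set \<Rightarrow> 'y"
  assumes simple: "simple_graph E"
    and BX: "\<And>v. B v \<subseteq> X" and Bne: "\<And>v. B v \<noteq> {}"
    and Bdisj: "\<And>u v. u \<noteq> v \<Longrightarrow> B u \<inter> B v = {}"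
    and Bconn: "\<And>v x x'. x \<in> B v \<Longrightarrow> x' \<in> B v \<Longrightarrow> (x, x') \<in> (adj (B v))\<^sup>*"
    and ye: "\<And>e. e \<in> E \<Longrightarrow> ye e \<in> Y \<and> (\<exists>u v. e = {u, v} \<and> s (ye e) \<in> B u \<and> t (ye e) \<in> B v)"
    and girth: "\<And>z. z \<subseteq> E \<Longrightarrow> z \<noteq> {} \<Longrightarrow> (\<And>v. even (card {e\<in>z. v \<in> e})) \<Longrightarrow> g \<le> card z"
  shows "\<exists>f. card E \<le> (CARD('v) - 1) + r + (f - 1) \<and> f * g \<le> 2 * card E"
proof -
  let ?\<delta> = "\<lambda>y w. of_bool (s y = w) + of_bool (t y = w) :: bit"
  have finE: "finite E" by simp
  define inner where "inner y \<longleftrightarrow> (\<exists>v. s y \<in> B v \<and> t y \<in> B v)" for y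
  have Beq: "u = v" if "x \<in> B u" "x \<in> B v" for u v x using Bdisj that by blast
  have not_inner: "\<not> inner (ye e)" if e: "e \<in> E" for e
  proof
    assume "inner (ye e)"
    obtain u v where uv: "e = {u, v}" "s (ye e) \<in> B u" "t (ye e) \<in> B v" using ye[OF e] by blast
    then have "u = v" using \<open>inner (ye e)\<close> Beq unfolding inner_def by blast
    then show False using uv simple e by (auto simp: simple_graph_def)
  qed
  have ye_inj: "e = e'" if e: "e \<in> E" "e' \<in> E" and eq: "ye e = ye e'" for e e'
  proof -
    obtain u v where uv: "e = {u, v}" "s (ye e) \<in> B u" "t (ye e) \<in> B v" using ye[OF e(1)] by blast
    obtain u' v' where uv': "e' = {u', v'}" "s (ye e') \<in> B u'" "t (ye e') \<in> B v'" using ye[OF e(2)] by blast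
    have "u = u'" "v = v'" using uv uv' eq Beq by metis+
    then show ?thesis using uv uv' by simp
  qed

  \<comment> \<open>Lifting the edges of the graph to chains of the complex\<close>
  define xr where "xr v = (SOME x. x \<in> B v)" for v
  have xr: "xr v \<in> B v" for v using Bne[of v] unfolding xr_def by (simp add: some_in_eq)
  \<comment> \<open>A lift of an edge runs from the representative of one end through its branch
    set, crosses \<open>ye e\<close>, and continues to the representative of the other end. Apart
    from \<open>ye e\<close> it stays inside branch sets, so a sum of lifts reveals its set of edges
    through its values on \<open>ye\<close>.\<close>
  define lift where "lift e c \<longleftrightarrow> (\<forall>e'\<in>E. c (ye e') = of_bool (e = e')) \<and>
      (\<forall>y. c y \<noteq> 0 \<longrightarrow> y \<in> Y \<and> (inner y \<or> y = ye e)) \<and>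
      (\<forall>w. (\<Sum>y\<in>Y. c y * ?\<delta> y w) = (\<Sum>v\<in>e. of_bool (xr v = w)))" for e c
  have "\<exists>c. lift e c" if e: "e \<in> E" for e
  proof -
    obtain u v where uv: "e = {u, v}" "s (ye e) \<in> B u" "t (ye e) \<in> B v" and yY: "ye e \<in> Y"
      using ye[OF e] by blast
    have "u \<noteq> v" using uv simple e by (auto simp: simple_graph_def)
    obtain p :: "'y \<Rightarrow> bit" where p: "\<And>y. p y \<noteq> 0 \<Longrightarrow> y \<in> Y \<and> s y \<in> B u \<and> t y \<in> B u"
      "\<And>w. (\<Sum>y\<in>Y. p y * ?\<delta> y w) = of_bool (xr u = w) + of_bool (s (ye e) = w)"
      using path_chain[OF Bconn[OF xr uv(2)]] by blast
    obtain q :: "'y \<Rightarrow> bit" where q: "\<And>y. q y \<noteq> 0 \<Longrightarrow> y \<in> Y \<and> s y \<in> B v \<and> t y \<in> B v"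
      "\<And>w. (\<Sum>y\<in>Y. q y * ?\<delta> y w) = of_bool (xr v = w) + of_bool (t (ye e) = w)"
      using path_chain[OF Bconn[OF xr uv(3)]] by blast
    have pz: "p (ye e') = 0" if "e' \<in> E" for e'
      using p(1)[of "ye e'"] not_inner[OF that] unfolding inner_def by blast
    have qz: "q (ye e') = 0" if "e' \<in> E" for e'
      using q(1)[of "ye e'"] not_inner[OF that] unfolding inner_def by blast
    let ?c = "\<lambda>y. p y + (q y + of_bool (y = ye e))"
    have "?c (ye e') = of_bool (e = e')" if "e' \<in> E" for e'
      using pz[OF that] qz[OF that] ye_inj[OF e that] by auto
    moreover have "y \<in> Y \<and> (inner y \<or> y = ye e)" if c: "?c y \<noteq> 0" for y
    proof (cases "y = ye e")
      case False
      then have "p y \<noteq> 0 \<or> q y \<noteq> 0" using c by auto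
      then show ?thesis using p(1)[of y] q(1)[of y] unfolding inner_def by blast
    qed (use yY in simp)
    moreover have "(\<Sum>y\<in>Y. ?c y * ?\<delta> y w) = (\<Sum>v\<in>e. of_bool (xr v = w))" for w
    proof -
      have "Y \<inter> {y. y = ye e} = {ye e}" using yY by auto
      then have "(\<Sum>y\<in>Y. of_bool (y = ye e) * ?\<delta> y w) = ?\<delta> (ye e) w"
        using finite_Y by (simp add: sum_of_bool_mult_eq)
      then have "(\<Sum>y\<in>Y. ?c y * ?\<delta> y w) = (of_bool (xr u = w) + of_bool (s (ye e) = w))
          + ((of_bool (xr v = w) + of_bool (t (ye e) = w)) + ?\<delta> (ye e) w)"
        by (simp only: distrib_right[of "p _"] distrib_right[of "q _"] sum.distrib p(2) q(2))
      also have "\<dots> = of_bool (xr u = w) + of_bool (xr v = w)"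
        by (cases "s (ye e) = w"; cases "t (ye e) = w"; cases "xr u = w"; cases "xr v = w"; simp)
      also have "\<dots> = (\<Sum>v\<in>e. of_bool (xr v = w))" using uv \<open>u \<noteq> v\<close> by simp
      finally show ?thesis .
    qed
    ultimately show ?thesis unfolding lift_def
      by (intro exI[of _ ?c], intro conjI[OF ballI conjI[OF allI allI]] impI)
  qed
  then have "\<forall>e\<in>E. \<exists>c. lift e c" by blast
  from bchoice[OF this] obtain c where c: "\<And>e. e \<in> E \<Longrightarrow> lift e (c e)" by blast
  have c_ye: "\<And>e e'. e \<in> E \<Longrightarrow> e' \<in> E \<Longrightarrow> c e (ye e') = of_bool (e = e')"
    and c_supp: "\<And>e y. e \<in> E \<Longrightarrow> c e y \<noteq> 0 \<Longrightarrow> y \<in> Y \<and> (inner y \<or> y = ye e)"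
    and c_bd: "\<And>e w. e \<in> E \<Longrightarrow> (\<Sum>y\<in>Y. c e y * ?\<delta> y w) = (\<Sum>v\<in>e. of_bool (xr v = w))"
    using c unfolding lift_def by blast+

  \<comment> \<open>Even edge sets whose lifts are boundaries\<close>
  define v0 :: 'v where "v0 = undefined"
  \<comment> \<open>Every edge has two ends, so evenness at all vertices but \<open>v0\<close>
    implies evenness at \<open>v0\<close>. Leaving out this one condition is what gives
    \<open>CARD('v) - 1\<close>.\<close>
  define I :: "('v + nat) set" where "I = Inl ` (UNIV - {v0}) \<union> Inr ` {..<r}"
  define \<Lambda> where "\<Lambda> i e = (case i of Inl v \<Rightarrow> of_bool (v \<in> e)
      | Inr j \<Rightarrow> (\<Sum>y\<in>Y. c e y * of_bool (y \<in> D j)))" for i :: "'v + nat" and e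
  define Z0 where "Z0 = {z. z \<subseteq> E \<and> (\<forall>i\<in>I. sum (\<Lambda> i) z = 0)}"
  have cardI: "card I = (CARD('v) - 1) + r"
    unfolding I_def by (subst card_Un_disjoint) (auto simp: card_image card_Diff_singleton)
  have "finite I" by (simp add: I_def)
  then have Z0_lower: "2 ^ card E \<le> card Z0 * 2 ^ ((CARD('v) - 1) + r)"
    using card_bit_kernel[OF finE, of I \<Lambda>] by (simp add: Z0_def cardI)

  \<comment> \<open>Regions of the complement and their boundaries\<close>
  define q where "q = {(L y, R y) | y. y \<in> Y \<and> \<not> inner y \<and> y \<notin> ye ` E}"
  define eqv where "eqv = (q \<union> q\<inverse>)\<^sup>*"
  define cls where "cls f = eqv `` {f}" for f
  have sym: "sym eqv" unfolding eqv_def by (rule sym_rtrancl) (auto simp: sym_def)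
  have cls_eq: "cls f = cls f'" if "(f, f') \<in> eqv" for f f'
  proof -
    have "(f', f) \<in> eqv" using sym that by (meson symD)
    then show ?thesis using that unfolding cls_def eqv_def by (auto intro: rtrancl_trans)
  qed
  have cls_LR: "cls (L y) = cls (R y)" if "y \<in> Y" "\<not> inner y" "y \<notin> ye ` E" for y
    by (rule cls_eq) (use that in \<open>auto simp: eqv_def q_def\<close>)
  let ?l = "\<lambda>e. cls (L (ye e))" and ?r = "\<lambda>e. cls (R (ye e))"
  define F where "F = L ` Y \<union> R ` Y"
  have finF: "finite F" using finite_Y by (simp add: F_def)
  define supp where "supp Q = {e\<in>E. (?l e = Q) \<noteq> (?r e = Q)}" for Q
  \<comment> \<open>Only regions with non-empty boundary are subject to the girth bound, so only
    these are counted.\<close>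
  define \<Q> where "\<Q> = {Q \<in> cls ` F. supp Q \<noteq> {}}"
  have fin\<Q>: "finite \<Q>" using finF by (simp add: \<Q>_def)
  have supp_even: "even (card {e\<in>supp Q. v \<in> e})" for Q v
  proof -
    let ?Z = "\<lambda>y. of_bool (cls (L y) = Q) + of_bool (cls (R y) = Q) :: bit"
    define FQ where "FQ = {f\<in>F. cls f = Q}"
    have FQ: "(\<Sum>f\<in>FQ. of_bool (L y = f) + of_bool (R y = f)) = ?Z y" if "y \<in> Y" for y
    proof -
      have "(\<Sum>f\<in>FQ. of_bool (L y = f) + of_bool (R y = f))
          = (\<Sum>f\<in>F. of_bool (cls f = Q) * (of_bool (L y = f) + of_bool (R y = f)) :: bit)"
        unfolding FQ_def using finF by (simp add: sum_of_bool_mult_eq Int_def)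
      also have "\<dots> = ?Z y" using that by (intro sum_incidence finF) (auto simp: F_def)
      finally show ?thesis .
    qed
    have Bv: "(\<Sum>x\<in>B v. ?\<delta> y x) = of_bool (s y \<in> B v) + of_bool (t y \<in> B v)" if "y \<in> Y" for y
    proof -
      have "(\<Sum>x\<in>B v. ?\<delta> y x) = (\<Sum>x\<in>X. of_bool (x \<in> B v) * ?\<delta> y x)"
        using finite_X BX[of v] by (simp add: sum_of_bool_mult_eq Int_absorb1)
      also have "\<dots> = of_bool (s y \<in> B v) + of_bool (t y \<in> B v)"
        using ends that by (intro sum_incidence finite_X) auto
      finally show ?thesis .
    qed
    \<comment> \<open>Sum \<open>boundary_boundary\<close> over \<open>B v\<close> and over the
      faces of the region. An edge inside a branch set has both or neither of its ends in
      \<open>B v\<close>, and an edge outside the minor has the same region on both sides; only the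
      edges \<open>ye e\<close> survive.\<close>
    have "0 = (\<Sum>x\<in>B v. \<Sum>f\<in>FQ. \<Sum>y\<in>Y. ?\<delta> y x * (of_bool (L y = f) + of_bool (R y = f)))"
      using boundary_boundary BX[of v] by (simp add: subset_iff)
    also have "\<dots> = (\<Sum>x\<in>B v. \<Sum>y\<in>Y. \<Sum>f\<in>FQ. ?\<delta> y x * (of_bool (L y = f) + of_bool (R y = f)))"
      by (intro sum.cong refl sum.swap)
    also have "\<dots> = (\<Sum>y\<in>Y. \<Sum>x\<in>B v. \<Sum>f\<in>FQ. ?\<delta> y x * (of_bool (L y = f) + of_bool (R y = f)))"
      by (rule sum.swap)
    also have "\<dots> = (\<Sum>y\<in>Y. (of_bool (s y \<in> B v) + of_bool (t y \<in> B v)) * ?Z y)"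
      by (intro sum.cong refl) (simp add: FQ Bv flip: sum_product)
    also have "\<dots> = (\<Sum>y\<in>ye ` E. (of_bool (s y \<in> B v) + of_bool (t y \<in> B v)) * ?Z y)"
    proof (rule sum.mono_neutral_right[OF finite_Y])
      show "ye ` E \<subseteq> Y" using ye by blast
      show "\<forall>y\<in>Y - ye ` E. (of_bool (s y \<in> B v) + of_bool (t y \<in> B v)) * ?Z y = 0"
      proof
        fix y assume y: "y \<in> Y - ye ` E"
        show "(of_bool (s y \<in> B v) + of_bool (t y \<in> B v)) * ?Z y = 0"
        proof (cases "inner y")
          case True
          then have "s y \<in> B v \<longleftrightarrow> t y \<in> B v" unfolding inner_def using Beq by blast
          then show ?thesis by simp
        next
          case False
          then show ?thesis using cls_LR[of y] y by simp
        qed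
      qed
    qed
    also have "\<dots> = (\<Sum>e\<in>E. (of_bool (s (ye e) \<in> B v) + of_bool (t (ye e) \<in> B v)) * ?Z (ye e))"
      by (rule sum.reindex_cong[of ye]) (use ye_inj in \<open>auto simp: inj_on_def\<close>)
    also have "\<dots> = (\<Sum>e\<in>E. of_bool (e \<in> {e\<in>supp Q. v \<in> e}))"
    proof (intro sum.cong refl)
      fix e assume e: "e \<in> E"
      obtain u w where uw: "e = {u, w}" "s (ye e) \<in> B u" "t (ye e) \<in> B w" using ye[OF e] by blast
      have "u \<noteq> w" using uw simple e by (auto simp: simple_graph_def)
      have "s (ye e) \<in> B v \<longleftrightarrow> v = u" "t (ye e) \<in> B v \<longleftrightarrow> v = w" using uw Beq by blast+
      then have "(of_bool (s (ye e) \<in> B v) + of_bool (t (ye e) \<in> B v) :: bit) = of_bool (v \<in> e)"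
        using uw \<open>u \<noteq> w\<close> by auto
      moreover have "?Z (ye e) = of_bool (e \<in> supp Q)" using e by (auto simp: supp_def)
      ultimately show "(of_bool (s (ye e) \<in> B v) + of_bool (t (ye e) \<in> B v)) * ?Z (ye e)
          = of_bool (e \<in> {e\<in>supp Q. v \<in> e})" by auto
    qed
    also have "\<dots> = of_nat (card {e\<in>supp Q. v \<in> e})"
    proof -
      have "E \<inter> {e\<in>supp Q. v \<in> e} = {e\<in>supp Q. v \<in> e}" by (auto simp: supp_def)
      then show ?thesis using finE by (simp add: sum.If_cases of_bool_def)
    qed
    finally show ?thesis using of_nat_bit_eq_0_iff by metis
  qed

  \<comment> \<open>Recovering an even edge set from a set of regions\<close>
  define Q0 where "Q0 = (SOME Q. Q \<in> \<Q>)"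
  \<comment> \<open>Complementary sets of regions have the same boundary. Keeping \<open>Q0\<close>
    outside normalises the choice and saves one in the exponent.\<close>
  define rec where "rec \<psi> = {e\<in>E. ?l e \<noteq> ?r e \<and> (?l e \<in> \<psi>) \<noteq> (?r e \<in> \<psi>)}" for \<psi>
  have Z0_rec: "Z0 \<subseteq> rec ` Pow (\<Q> - {Q0})"
  proof
    fix z assume z: "z \<in> Z0"
    then have zE: "z \<subseteq> E" by (simp add: Z0_def)
    have z_vert: "(\<Sum>e\<in>z. of_bool (v \<in> e)) = (0::bit)" for v
    proof -
      have ne: "(\<Sum>e\<in>z. of_bool (v \<in> e)) = (0::bit)" if "v \<noteq> v0" for v
      proof -
        have "sum (\<Lambda> (Inl v)) z = 0" using z that unfolding Z0_def I_def by blast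
        then show ?thesis unfolding \<Lambda>_def[abs_def] by simp
      qed
      have "(\<Sum>v\<in>UNIV. \<Sum>e\<in>z. of_bool (v \<in> e)) = (\<Sum>e\<in>z. \<Sum>v\<in>UNIV. of_bool (v \<in> e) :: bit)"
        by (rule sum.swap)
      also have "\<dots> = (\<Sum>e\<in>z. 0)"
      proof (intro sum.cong refl)
        fix e assume "e \<in> z"
        then have "card e = 2" using zE simple by (auto simp: simple_graph_def)
        then show "(\<Sum>v\<in>UNIV. of_bool (v \<in> e)) = (0::bit)"
          by (simp add: sum.If_cases of_bool_def)
      qed
      finally have "(\<Sum>v\<in>UNIV. \<Sum>e\<in>z. of_bool (v \<in> e)) = (0::bit)" by simp
      moreover have "(\<Sum>v\<in>UNIV. \<Sum>e\<in>z. of_bool (v \<in> e)) = (\<Sum>e\<in>z. of_bool (v0 \<in> e) :: bit)"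
        by (subst sum.remove[of _ v0]) (use ne in auto)
      ultimately show ?thesis using ne by (cases "v = v0") auto
    qed
    define Lz where "Lz y = (\<Sum>e\<in>z. c e y)" for y
    have "\<exists>\<Phi>. \<forall>y\<in>Y. Lz y = \<Phi> (L y) + \<Phi> (R y)"
    proof (rule cycle_is_boundary)
      fix w assume "w \<in> X"
      have "(\<Sum>y\<in>Y. Lz y * ?\<delta> y w) = (\<Sum>e\<in>z. \<Sum>y\<in>Y. c e y * ?\<delta> y w)"
        unfolding Lz_def sum_distrib_right by (rule sum.swap)
      also have "\<dots> = (\<Sum>e\<in>z. \<Sum>v\<in>UNIV. of_bool (v \<in> e) * of_bool (xr v = w))"
        using zE by (intro sum.cong refl) (auto simp: c_bd sum_of_bool_mult_eq)
      also have "\<dots> = (\<Sum>v\<in>UNIV. (\<Sum>e\<in>z. of_bool (v \<in> e)) * of_bool (xr v = w))"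
        unfolding sum_distrib_right by (rule sum.swap)
      finally show "(\<Sum>y\<in>Y. Lz y * ?\<delta> y w) = 0" by (simp add: z_vert)
    next
      fix j assume "j < r"
      have "(\<Sum>y\<in>Y. Lz y * of_bool (y \<in> D j)) = (\<Sum>e\<in>z. \<Sum>y\<in>Y. c e y * of_bool (y \<in> D j))"
        unfolding Lz_def sum_distrib_right by (rule sum.swap)
      also have "\<dots> = sum (\<Lambda> (Inr j)) z" by (simp add: \<Lambda>_def)
      also have "\<dots> = 0" using z \<open>j < r\<close> by (auto simp: Z0_def I_def)
      finally show "(\<Sum>y\<in>Y. Lz y * of_bool (y \<in> D j)) = 0" .
    qed
    then obtain \<Phi> where \<Phi>: "\<And>y. y \<in> Y \<Longrightarrow> Lz y = \<Phi> (L y) + \<Phi> (R y)" by blast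
    have Lz0: "Lz y = 0" if "\<not> inner y" "y \<notin> ye ` E" for y
      unfolding Lz_def using c_supp zE that by (intro sum.neutral) (metis imageI subsetD)
    \<comment> \<open>The lift of \<open>z\<close> vanishes on edges outside the minor, so
      \<open>\<Phi>\<close> does not change across them and depends on the region only.\<close>
    have const: "\<Phi> f = \<Phi> f'" if "(f, f') \<in> eqv" for f f'
      using that unfolding eqv_def
    proof (induction rule: rtrancl_induct)
      case (step f1 f2)
      then have "\<Phi> f1 = \<Phi> f2" using \<Phi> Lz0 by (fastforce simp: q_def)
      then show ?case using step by simp
    qed simp
    define \<Psi> where "\<Psi> Q = \<Phi> (SOME f. f \<in> Q)" for Q
    have \<Psi>: "\<Phi> f = \<Psi> (cls f)" for f
    proof -
      have "f \<in> cls f" by (simp add: cls_def eqv_def)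
      then have "(SOME f'. f' \<in> cls f) \<in> cls f" by (rule someI)
      then show ?thesis using const by (simp add: \<Psi>_def cls_def)
    qed
    have ez: "e \<in> z \<longleftrightarrow> \<Psi> (?l e) \<noteq> \<Psi> (?r e)" if e: "e \<in> E" for e
    proof -
      have "Lz (ye e) = (\<Sum>e'\<in>z. of_bool (e' = e))"
        unfolding Lz_def using zE e c_ye by (intro sum.cong refl) auto
      also have "\<dots> = of_bool (e \<in> z)"
        using finite_subset[OF zE finE] by (simp add: of_bool_def)
      finally have "of_bool (e \<in> z) = \<Psi> (?l e) + \<Psi> (?r e)"
        using \<Phi> ye[OF e] \<Psi> by simp
      then show ?thesis by (cases "e \<in> z") (auto simp: eq_commute[of 0])
    qed
    define \<psi> where "\<psi> = {Q\<in>\<Q>. \<Psi> Q \<noteq> \<Psi> Q0}"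
    have "\<psi> \<subseteq> \<Q> - {Q0}" by (auto simp: \<psi>_def)
    moreover have "z = rec \<psi>"
    proof -
      have "e \<in> z \<longleftrightarrow> ?l e \<noteq> ?r e \<and> (?l e \<in> \<psi>) \<noteq> (?r e \<in> \<psi>)" if e: "e \<in> E" for e
      proof (cases "?l e = ?r e")
        case False
        then have "?l e \<in> \<Q>" "?r e \<in> \<Q>"
          using e ye[OF e] by (auto simp: \<Q>_def supp_def F_def)
        then show ?thesis using ez[OF e] False by (auto simp: \<psi>_def) (metis bit_not_one_iff)+
      qed (use ez[OF e] in simp)
      then show ?thesis using zE by (auto simp: rec_def)
    qed
    ultimately show "z \<in> rec ` Pow (\<Q> - {Q0})" by blast
  qed

  \<comment> \<open>Counting regions and boundary edges\<close>
  have "card Z0 \<le> 2 ^ (card \<Q> - 1)"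
  proof -
    have "card Z0 \<le> card (rec ` Pow (\<Q> - {Q0}))"
      using fin\<Q> by (intro card_mono[OF _ Z0_rec]) simp
    also have "\<dots> \<le> card (Pow (\<Q> - {Q0}))" using fin\<Q> by (intro card_image_le) simp
    also have "\<dots> = 2 ^ card (\<Q> - {Q0})" using fin\<Q> by (simp add: card_Pow)
    also have "card (\<Q> - {Q0}) = card \<Q> - 1"
    proof (cases "\<Q> = {}")
      case False
      then have "Q0 \<in> \<Q>" unfolding Q0_def by (simp add: some_in_eq)
      then show ?thesis by simp
    qed simp
    finally show ?thesis .
  qed
  then have "2 ^ card E \<le> (2::nat) ^ (card \<Q> - 1) * 2 ^ ((CARD('v) - 1) + r)"
    using Z0_lower by (meson le_trans mult_right_mono zero_le)
  then have "(2::nat) ^ card E \<le> 2 ^ ((card \<Q> - 1) + ((CARD('v) - 1) + r))"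
    by (simp only: power_add)
  then have 1: "card E \<le> (CARD('v) - 1) + r + (card \<Q> - 1)"
    by (subst (asm) power_increasing_iff) auto
  have "card \<Q> * g = (\<Sum>Q\<in>\<Q>. g)" by simp
  also have "\<dots> \<le> (\<Sum>Q\<in>\<Q>. card (supp Q))"
    by (intro sum_mono girth supp_even) (auto simp: \<Q>_def supp_def)
  also have "\<dots> = (\<Sum>Q\<in>\<Q>. \<Sum>e\<in>E. of_bool (e \<in> supp Q))"
  proof (intro sum.cong refl)
    fix Q
    have "E \<inter> supp Q = supp Q" by (auto simp: supp_def)
    then show "card (supp Q) = (\<Sum>e\<in>E. of_bool (e \<in> supp Q))"
      using finE by (simp add: sum.If_cases of_bool_def)
  qed
  also have "\<dots> = (\<Sum>e\<in>E. \<Sum>Q\<in>\<Q>. of_bool (e \<in> supp Q))" by (rule sum.swap)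
  also have "\<dots> \<le> (\<Sum>e\<in>E. 2)"
  proof (rule sum_mono)
    fix e
    have "(\<Sum>Q\<in>\<Q>. of_bool (e \<in> supp Q)) = card (\<Q> \<inter> {Q. e \<in> supp Q})"
      using fin\<Q> by (simp add: sum.If_cases of_bool_def)
    also have "\<dots> \<le> card {?l e, ?r e}" by (intro card_mono) (auto simp: supp_def)
    also have "\<dots> \<le> 2" by (simp add: card_insert_if)
    finally show "(\<Sum>Q\<in>\<Q>. of_bool (e \<in> supp Q)) \<le> (2::nat)" .
  qed
  finally have "card \<Q> * g \<le> 2 * card E" by simp
  with 1 show ?thesis by blast
qed

end

section \<open>The glued grid\<close>

text \<open>A dual edge crosses a side of a tile. For the tile \<open>(\<sigma>, i, k)\<close>,
  \<open>VE\<close> stands for its left side and \<open>HE\<close> for its bottom side;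
  \<open>GE i\<close> is the bottom side of the upper tile \<open>(True, i, 0)\<close>, glued to a
  lower tile. Dual faces are corners of tiles.\<close>

datatype grid_edge = VE bool int nat | HE bool int nat | GE int

datatype grid_face = Inner bool int nat | Bottom int | Outer

text \<open>Two rectangular grids of tiles, the upper (\<open>True\<close>) and the lower (\<open>False\<close>) one. Their
  outer sides are collapsed to a point and the bottom side of the upper grid is glued to the one of
  the lower grid, column \<open>i\<close> to column \<open>\<tau> i\<close>. Bottom corners \<open>p\<close> are identified as prescribed by
  \<open>\<kappa>\<close>; on the upper grid, this identifies \<open>A j\<close> and \<open>B j\<close> only.\<close>

locale glued_grid =
  fixes lo hi :: int and K :: nat and \<tau> :: "int \<Rightarrow> int" and \<kappa> :: "bool \<Rightarrow> int \<Rightarrow> int"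
    and r :: nat and A B :: "nat \<Rightarrow> int"
  assumes lo_le_hi: "lo \<le> hi"
    and bij_tau: "bij_betw \<tau> {lo..hi} {lo..hi}"
    and kappa_A: "j < r \<Longrightarrow> \<kappa> True (A j) = A j" and kappa_B: "j < r \<Longrightarrow> \<kappa> True (B j) = A j"
    and kappa_other: "p \<notin> A ` {..<r} \<Longrightarrow> p \<notin> B ` {..<r} \<Longrightarrow> \<kappa> True p = p"
    and A_less_B: "j < r \<Longrightarrow> lo < A j \<and> A j < B j \<and> B j \<le> hi"
    and inj_A: "inj_on A {..<r}" and inj_B: "inj_on B {..<r}"
    and A_neq_B: "j < r \<Longrightarrow> j' < r \<Longrightarrow> A j \<noteq> B j'"
    and tau_corners: "lo \<le> i \<Longrightarrow> i \<le> hi \<Longrightarrow>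
      (let c = \<lambda>\<sigma> p. if p \<le> lo \<or> hi < p then None else Some (\<kappa> \<sigma> p)
       in {c False (\<tau> i), c False (\<tau> i + 1)} = {c True i, c True (i + 1)})"
begin

text \<open>The lower left corner in the orientation of the grid, where row 0 touches the glued
  line. \<open>Outer\<close> also absorbs indices out of range, so that formulas for boundaries need
  no exception at the border.\<close>

definition corner :: "bool \<Rightarrow> int \<Rightarrow> nat \<Rightarrow> grid_face" where
  "corner \<sigma> i k = (if i \<le> lo \<or> hi < i \<or> K < k then Outer
     else if k = 0 then Bottom (\<kappa> \<sigma> i) else Inner \<sigma> i k)"

definition X :: "(bool \<times> int \<times> nat) set" where
  "X = UNIV \<times> {lo..hi} \<times> {..K}"

definition Y :: "grid_edge set" where
  "Y = (\<lambda>(\<sigma>, i, k). VE \<sigma> i k) ` (UNIV \<times> {lo<..hi} \<times> {..K})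
     \<union> (\<lambda>(\<sigma>, i, k). HE \<sigma> i k) ` (UNIV \<times> {lo..hi} \<times> {0<..K}) \<union> GE ` {lo..hi}"

fun s :: "grid_edge \<Rightarrow> bool \<times> int \<times> nat" where
  "s (VE \<sigma> i k) = (\<sigma>, i - 1, k)"
| "s (HE \<sigma> i k) = (\<sigma>, i, k - 1)"
| "s (GE i) = (True, i, 0)"

fun t :: "grid_edge \<Rightarrow> bool \<times> int \<times> nat" where
  "t (VE \<sigma> i k) = (\<sigma>, i, k)"
| "t (HE \<sigma> i k) = (\<sigma>, i, k)"
| "t (GE i) = (False, \<tau> i, 0)"

fun L :: "grid_edge \<Rightarrow> grid_face" where
  "L (VE \<sigma> i k) = corner \<sigma> i k"
| "L (HE \<sigma> i k) = corner \<sigma> i k"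
| "L (GE i) = corner True i 0"

fun R :: "grid_edge \<Rightarrow> grid_face" where
  "R (VE \<sigma> i k) = corner \<sigma> i (k + 1)"
| "R (HE \<sigma> i k) = corner \<sigma> (i + 1) k"
| "R (GE i) = corner True (i + 1) 0"

text \<open>The corners \<open>A j\<close> and \<open>B j\<close> are identified, so these sides
  form a closed curve in the glued surface, which is a cocycle of the dual complex.\<close>

definition D :: "nat \<Rightarrow> grid_edge set" where
  "D j = GE ` {A j..<B j}"

lemma Y_simps [simp]:
  "VE \<sigma> i k \<in> Y \<longleftrightarrow> lo < i \<and> i \<le> hi \<and> k \<le> K"
  "HE \<sigma> i k \<in> Y \<longleftrightarrow> lo \<le> i \<and> i \<le> hi \<and> 0 < k \<and> k \<le> K"
  "GE i \<in> Y \<longleftrightarrow> lo \<le> i \<and> i \<le> hi"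
  by (auto simp: Y_def image_iff)

lemma finite_X: "finite X" by (simp add: X_def)

lemma finite_Y: "finite Y" by (simp add: Y_def)

lemma corner_eq_Inner:
  "corner \<sigma>' i' k' = Inner \<sigma> i k \<longleftrightarrow> \<sigma>' = \<sigma> \<and> i' = i \<and> k' = k \<and> lo < i \<and> i \<le> hi \<and> 0 < k \<and> k \<le> K"
  by (auto simp: corner_def)

lemma corner_eq_Bottom:
  "corner \<sigma> i k = Bottom p \<longleftrightarrow> k = 0 \<and> lo < i \<and> i \<le> hi \<and> \<kappa> \<sigma> i = p"
  by (auto simp: corner_def)

lemma tau_range: "lo \<le> \<tau> i" "\<tau> i \<le> hi" if "lo \<le> i" "i \<le> hi"
  using bij_betwE[OF bij_tau] that by force+

lemma ends: "y \<in> Y \<Longrightarrow> s y \<in> X \<and> t y \<in> X"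
  using tau_range by (cases y) (auto simp: X_def)

abbreviation dd :: "grid_edge \<Rightarrow> grid_face \<Rightarrow> bit" where
  "dd y f \<equiv> of_bool (L y = f) + of_bool (R y = f)"

text \<open>The additive form of \<open>tau_corners\<close>: a glued side has the same two end
  corners when seen from the lower grid, possibly in the opposite order.\<close>

lemma tau_corner_sum:
  assumes "lo \<le> i" "i \<le> hi"
  shows "of_bool (corner False (\<tau> i) 0 = f) + of_bool (corner False (\<tau> i + 1) 0 = f) = dd (GE i) f"
proof -
  define c where "c \<sigma> p = (if p \<le> lo \<or> hi < p then None else Some (\<kappa> \<sigma> p))" for \<sigma> p
  have "{c False (\<tau> i), c False (\<tau> i + 1)} = {c True i, c True (i + 1)}"
    using tau_corners[OF assms] by (simp add: c_def Let_def)
  then have "c False (\<tau> i) = c True i \<and> c False (\<tau> i + 1) = c True (i + 1) \<or>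
      c False (\<tau> i) = c True (i + 1) \<and> c False (\<tau> i + 1) = c True i"
    unfolding doubleton_eq_iff .
  moreover have "corner \<sigma> p 0 = (case c \<sigma> p of None \<Rightarrow> Outer | Some q \<Rightarrow> Bottom q)" for \<sigma> p
    by (simp add: corner_def c_def)
  ultimately show ?thesis by (elim disjE conjE) (simp_all add: add.commute)
qed

text \<open>The sides of a tile form a closed quadrilateral, so each of its corners is met twice. In
  row 0 the bottom side is a glued one, reached from below through the preimage \<open>j\<close> of
  \<open>i\<close> under \<open>\<tau>\<close>.\<close>

lemma boundary_boundary:
  assumes "x \<in> X"
  shows "(\<Sum>y\<in>Y. (of_bool (s y = x) + of_bool (t y = x)) * dd y f) = 0"
proof -
  obtain \<sigma> i k where x: "x = (\<sigma>, i, k)" and i: "lo \<le> i" "i \<le> hi" and k: "k \<le> K"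
    using assms by (auto simp: X_def)
  let ?c = "\<lambda>i k. of_bool (corner \<sigma> i k = f) :: bit"
  obtain j where j: "lo \<le> j" "j \<le> hi" "\<tau> j = i"
    using bij_tau i by (metis atLeastAtMost_iff bij_betw_iff_bijections)
  have "j' = j" if "lo \<le> j'" "j' \<le> hi" "\<tau> j' = i" for j'
    using bij_tau j that by (metis atLeastAtMost_iff bij_betw_imp_inj_on inj_onD)
  then have jiff: "(lo \<le> j' \<and> j' \<le> hi \<and> \<tau> j' = i) \<longleftrightarrow> j' = j" for j'
    using j by blast
  have src: "Y \<inter> {y. s y = x} = (if i < hi then {VE \<sigma> (i + 1) k} else {})
      \<union> ((if k < K then {HE \<sigma> i (k + 1)} else {}) \<union> (if \<sigma> \<and> k = 0 then {GE i} else {}))"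
  proof (intro set_eqI)
    fix y show "y \<in> Y \<inter> {y. s y = x} \<longleftrightarrow> y \<in> (if i < hi then {VE \<sigma> (i + 1) k} else {})
      \<union> ((if k < K then {HE \<sigma> i (k + 1)} else {}) \<union> (if \<sigma> \<and> k = 0 then {GE i} else {}))"
      using i k x by (cases y) auto
  qed
  have tgt: "Y \<inter> {y. t y = x} = (if lo < i then {VE \<sigma> i k} else {})
      \<union> ((if 0 < k then {HE \<sigma> i k} else {}) \<union> (if \<not> \<sigma> \<and> k = 0 then {GE j} else {}))"
  proof (intro set_eqI)
    fix y show "y \<in> Y \<inter> {y. t y = x} \<longleftrightarrow> y \<in> (if lo < i then {VE \<sigma> i k} else {})
      \<union> ((if 0 < k then {HE \<sigma> i k} else {}) \<union> (if \<not> \<sigma> \<and> k = 0 then {GE j} else {}))"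
    proof (cases y)
      case (GE j')
      then show ?thesis using jiff[of j'] x by auto
    qed (use i k x in auto)
  qed
  have disj: "sum h (S1 \<union> (S2 \<union> S3)) = sum h S1 + (sum h S2 + sum h S3)"
    if "finite S1" "finite S2" "finite S3" "S1 \<inter> (S2 \<union> S3) = {}" "S2 \<inter> S3 = {}"
    for h :: "grid_edge \<Rightarrow> bit" and S1 S2 S3
    using that by (simp add: sum.union_disjoint)
  have "(\<Sum>y\<in>Y. (of_bool (s y = x) + of_bool (t y = x)) * dd y f)
      = (\<Sum>y\<in>Y \<inter> {y. s y = x}. dd y f) + (\<Sum>y\<in>Y \<inter> {y. t y = x}. dd y f)"
    using finite_Y by (simp only: distrib_right sum.distrib sum_of_bool_mult_eq)
  also have "(\<Sum>y\<in>Y \<inter> {y. s y = x}. dd y f) = (if i < hi then dd (VE \<sigma> (i + 1) k) f else 0)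
      + ((if k < K then dd (HE \<sigma> i (k + 1)) f else 0) + (if \<sigma> \<and> k = 0 then dd (GE i) f else 0))"
    unfolding src by (subst disj) auto
  also have "(\<Sum>y\<in>Y \<inter> {y. t y = x}. dd y f) = (if lo < i then dd (VE \<sigma> i k) f else 0)
      + ((if 0 < k then dd (HE \<sigma> i k) f else 0) + (if \<not> \<sigma> \<and> k = 0 then dd (GE j) f else 0))"
    unfolding tgt by (subst disj) auto
  \<comment> \<open>A side missing at the border would have both ends at \<open>Outer\<close>,
    contributing zero, so the uniform formula remains valid there.\<close>
  also have "(if i < hi then dd (VE \<sigma> (i + 1) k) f else 0) = ?c (i + 1) k + ?c (i + 1) (k + 1)"
    using i by (auto simp: corner_def)
  also have "(if k < K then dd (HE \<sigma> i (k + 1)) f else 0) = ?c i (k + 1) + ?c (i + 1) (k + 1)"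
    using k by (auto simp: corner_def)
  also have "(if lo < i then dd (VE \<sigma> i k) f else 0) = ?c i k + ?c i (k + 1)"
    using i by (auto simp: corner_def)
  finally have *: "(\<Sum>y\<in>Y. (of_bool (s y = x) + of_bool (t y = x)) * dd y f) =
      ?c (i + 1) k + ?c (i + 1) (k + 1) + (?c i (k + 1) + ?c (i + 1) (k + 1) + (if \<sigma> \<and> k = 0 then dd (GE i) f else 0))
      + (?c i k + ?c i (k + 1) + ((if 0 < k then dd (HE \<sigma> i k) f else 0) + (if \<not> \<sigma> \<and> k = 0 then dd (GE j) f else 0)))" .
  have "(if \<sigma> \<and> k = 0 then dd (GE i) f else 0) + ((if 0 < k then dd (HE \<sigma> i k) f else 0)
      + (if \<not> \<sigma> \<and> k = 0 then dd (GE j) f else 0)) = ?c i k + ?c (i + 1) k"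
    using tau_corner_sum[OF j(1,2), of f] j(3) by (cases \<sigma>; cases "k = 0") auto
  moreover have "a1 + a2 + (a3 + a2 + u) + (a4 + a3 + (v + w)) = 0" if "u + (v + w) = a4 + a1"
    for a1 a2 a3 a4 u v w :: bit
  proof -
    have "a1 + a2 + (a3 + a2 + u) + (a4 + a3 + (v + w)) = a1 + (a4 + (u + (v + w)))"
      by (simp add: ac_simps)
    then show ?thesis using that by (simp add: ac_simps)
  qed
  ultimately show ?thesis unfolding * by blast
qed

text \<open>Exactly four sides meet at an interior corner; the cocycle condition there is solved for
  one of them.\<close>

lemma cocycle_square:
  fixes a :: "grid_edge \<Rightarrow> bit"
  assumes a: "\<And>f. (\<Sum>y\<in>Y. a y * dd y f) = 0"
    and i: "lo < i" "i \<le> hi" and k: "Suc k \<le> K"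
  shows "a (VE \<sigma> i (Suc k)) = a (VE \<sigma> i k) + (a (HE \<sigma> i (Suc k)) + a (HE \<sigma> (i - 1) (Suc k)))"
proof -
  let ?f = "Inner \<sigma> i (Suc k)"
  have l: "Y \<inter> {y. L y = ?f} = {VE \<sigma> i (Suc k), HE \<sigma> i (Suc k)}"
  proof (intro set_eqI)
    fix y show "y \<in> Y \<inter> {y. L y = ?f} \<longleftrightarrow> y \<in> {VE \<sigma> i (Suc k), HE \<sigma> i (Suc k)}"
      using i k by (cases y) (auto simp: corner_eq_Inner)
  qed
  have r: "Y \<inter> {y. R y = ?f} = {VE \<sigma> i k, HE \<sigma> (i - 1) (Suc k)}"
  proof (intro set_eqI)
    fix y show "y \<in> Y \<inter> {y. R y = ?f} \<longleftrightarrow> y \<in> {VE \<sigma> i k, HE \<sigma> (i - 1) (Suc k)}"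
      using i k by (cases y) (auto simp: corner_eq_Inner)
  qed
  have "0 = (\<Sum>y\<in>Y \<inter> {y. L y = ?f}. a y) + (\<Sum>y\<in>Y \<inter> {y. R y = ?f}. a y)"
    using a[of ?f] finite_Y by (simp only: distrib_left sum.distrib sum_mult_of_bool_eq)
  then have "a (VE \<sigma> i (Suc k)) + a (HE \<sigma> i (Suc k)) = a (VE \<sigma> i k) + a (HE \<sigma> (i - 1) (Suc k))"
    unfolding l r by simp
  then show ?thesis by (metis bit_add_self_left add.commute add.left_commute)
qed

lemma sum_ioc_int:
  fixes h :: "int \<Rightarrow> bit"
  assumes "lo < i"
  shows "sum h {lo<..i} = sum h {lo<..i - 1} + h i"
proof -
  have "{lo<..i} = insert i {lo<..i - 1}" using assms by auto
  then show ?thesis by (simp add: add.commute)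
qed

text \<open>A rectangular grid has no holes, so on each of the two grids a cocycle is the coboundary
  of a potential \<open>\<phi>\<close>. What remains is a function \<open>b\<close> on the glued
  sides, subject to the conditions at the bottom corners. Shifting \<open>\<phi>\<close> on the
  lower grid by the constant \<open>C\<close> achieves \<open>b lo = 0\<close>.\<close>

lemma cocycle_reduce:
  fixes a :: "grid_edge \<Rightarrow> bit"
  assumes a: "\<And>f. (\<Sum>y\<in>Y. a y * dd y f) = 0"
  obtains \<phi> b where "b lo = 0"
    and "\<And>y. y \<in> Y \<Longrightarrow> a y = \<phi> (s y) + \<phi> (t y) + (case y of GE i \<Rightarrow> b i | _ \<Rightarrow> 0)"
    and "\<And>q. (\<Sum>p\<in>{lo<..hi} \<inter> {p. \<kappa> True p = q}. b (p - 1) + b p) = 0"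
proof -
  \<comment> \<open>Integration of \<open>a\<close> along the path that follows row 0 from column
    \<open>lo\<close> and then climbs column \<open>i\<close>.\<close>
  define P where "P \<sigma> i k = (\<Sum>i'\<in>{lo<..i}. a (VE \<sigma> i' 0)) + (\<Sum>k'\<in>{0<..k}. a (HE \<sigma> i k'))" for \<sigma> i and k :: nat
  define C where "C = a (GE lo) + (P True lo 0 + P False (\<tau> lo) 0)"
  define \<phi> where "\<phi> = (\<lambda>(\<sigma>, i, k). P \<sigma> i k + (if \<sigma> then 0 else C))"
  define b where "b i = a (GE i) + (\<phi> (True, i, 0) + \<phi> (False, \<tau> i, 0))" for i
  define \<beta> where "\<beta> y = (case y of GE i \<Rightarrow> b i | _ \<Rightarrow> 0)" for y
  have PS: "P \<sigma> i (Suc k) = P \<sigma> i k + a (HE \<sigma> i (Suc k))" for \<sigma> i k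
  proof -
    have "{0<..Suc k} = insert (Suc k) {0<..k}" by auto
    then show ?thesis by (simp add: P_def ac_simps)
  qed
  have VE: "a (VE \<sigma> i k) = P \<sigma> (i - 1) k + P \<sigma> i k" if i: "lo < i" "i \<le> hi" and k: "k \<le> K" for \<sigma> i k
    using k
  proof (induction k)
    case 0
    show ?case using sum_ioc_int[OF i(1), of "\<lambda>i'. a (VE \<sigma> i' 0)"] by (simp add: P_def)
  next
    case (Suc k)
    then have IH: "a (VE \<sigma> i k) = P \<sigma> (i - 1) k + P \<sigma> i k" by simp
    have "a (VE \<sigma> i (Suc k)) = (P \<sigma> (i - 1) k + P \<sigma> i k) + (a (HE \<sigma> i (Suc k)) + a (HE \<sigma> (i - 1) (Suc k)))"
      using cocycle_square[OF a i Suc.prems, of \<sigma>] IH by simp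
    then show ?case by (simp add: PS ac_simps)
  qed
  have pot: "a y = \<phi> (s y) + \<phi> (t y) + \<beta> y" if yY: "y \<in> Y" for y
  proof (cases y)
    case y: (VE \<sigma> i k)
    then show ?thesis using VE[of i k \<sigma>] yY by (simp add: \<phi>_def \<beta>_def ac_simps)
  next
    case y: (HE \<sigma> i k)
    then obtain k' where "k = Suc k'" using yY by (cases k) auto
    then show ?thesis using y PS[of \<sigma> i k'] by (simp add: \<phi>_def \<beta>_def ac_simps)
  next
    case (GE i)
    then show ?thesis by (simp add: \<beta>_def b_def ac_simps)
  qed
  have "b lo = 0" by (simp add: b_def \<phi>_def C_def ac_simps)
  moreover have "(\<Sum>p\<in>{lo<..hi} \<inter> {p. \<kappa> True p = q}. b (p - 1) + b p) = 0" for q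
  proof -
    let ?f = "Bottom q"
    \<comment> \<open>By \<open>boundary_boundary\<close> a coboundary contributes nothing at any
      corner, so the condition on \<open>a\<close> passes to the remainder
      \<open>\<beta>\<close>.\<close>
    have "(\<Sum>y\<in>Y. (\<phi> (s y) + \<phi> (t y)) * dd y ?f)
        = (\<Sum>y\<in>Y. (\<Sum>x\<in>X. \<phi> x * (of_bool (s y = x) + of_bool (t y = x))) * dd y ?f)"
    proof (intro sum.cong refl)
      fix y assume "y \<in> Y"
      then have "X \<inter> {x. s y = x} = {s y}" "X \<inter> {x. t y = x} = {t y}" using ends by auto
      then show "(\<phi> (s y) + \<phi> (t y)) * dd y ?f = (\<Sum>x\<in>X. \<phi> x * (of_bool (s y = x) + of_bool (t y = x))) * dd y ?f"
        using finite_X by (simp add: distrib_left sum.distrib sum_mult_of_bool_eq)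
    qed
    also have "\<dots> = (\<Sum>x\<in>X. \<phi> x * (\<Sum>y\<in>Y. (of_bool (s y = x) + of_bool (t y = x)) * dd y ?f))"
      unfolding sum_distrib_right sum_distrib_left by (subst sum.swap) (simp only: mult.assoc)
    also have "\<dots> = 0" using boundary_boundary by simp
    finally have exact: "(\<Sum>y\<in>Y. (\<phi> (s y) + \<phi> (t y)) * dd y ?f) = 0" .
    have "0 = (\<Sum>y\<in>Y. a y * dd y ?f)" using a by simp
    also have "\<dots> = (\<Sum>y\<in>Y. (\<phi> (s y) + \<phi> (t y) + \<beta> y) * dd y ?f)"
      by (intro sum.cong refl) (simp only: pot)
    also have "\<dots> = (\<Sum>y\<in>Y. \<beta> y * dd y ?f)"
      by (simp only: distrib_right[of "_ + _" "\<beta> _"] sum.distrib exact add_0)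
    also have "\<dots> = (\<Sum>y\<in>GE ` {lo..hi}. \<beta> y * dd y ?f)"
      by (rule sum.mono_neutral_right[OF finite_Y]) (auto simp: Y_def \<beta>_def)
    also have "\<dots> = (\<Sum>i\<in>{lo..hi}. b i * of_bool (corner True i 0 = ?f)) + (\<Sum>i\<in>{lo..hi}. b i * of_bool (corner True (i + 1) 0 = ?f))"
      by (subst sum.reindex) (simp_all add: \<beta>_def inj_on_def distrib_left sum.distrib)
    also have "(\<Sum>i\<in>{lo..hi}. b i * of_bool (corner True i 0 = ?f)) = (\<Sum>p\<in>{lo<..hi} \<inter> {p. \<kappa> True p = q}. b p)"
      by (subst sum_mult_of_bool_eq) (auto intro!: sum.cong simp: corner_eq_Bottom)
    also have "(\<Sum>i\<in>{lo..hi}. b i * of_bool (corner True (i + 1) 0 = ?f)) = (\<Sum>p\<in>{lo<..hi} \<inter> {p. \<kappa> True p = q}. b (p - 1))"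
      by (subst sum_mult_of_bool_eq, simp,
          rule sum.reindex_bij_witness[of _ "\<lambda>p. p - 1" "\<lambda>p. p + 1"]) (auto simp: corner_eq_Bottom)
    finally show ?thesis by (simp add: sum.distrib add.commute)
  qed
  ultimately show ?thesis using that pot unfolding \<beta>_def by blast
qed

text \<open>View \<open>b\<close> as a step function along the upper bottom line, with jumps
  \<open>J\<close>. A corner that is identified with no other has jump zero, and the jumps at
  \<open>A j\<close> and \<open>B j\<close> agree. Starting from \<open>b lo = 0\<close>, this makes
  \<open>b\<close> a combination of the indicators of \<open>{A j..<B j}\<close>.\<close>

lemma cohomology:
  fixes a :: "grid_edge \<Rightarrow> bit"
  assumes a: "\<And>f. (\<Sum>y\<in>Y. a y * dd y f) = 0"
  shows "\<exists>\<phi> \<alpha>. \<forall>y\<in>Y. a y = \<phi> (s y) + \<phi> (t y) + (\<Sum>j<r. \<alpha> j * of_bool (y \<in> D j))"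
proof -
  obtain \<phi> b where b0: "b lo = 0"
    and pot: "\<And>y. y \<in> Y \<Longrightarrow> a y = \<phi> (s y) + \<phi> (t y) + (case y of GE i \<Rightarrow> b i | _ \<Rightarrow> 0)"
    and cls: "\<And>q. (\<Sum>p\<in>{lo<..hi} \<inter> {p. \<kappa> True p = q}. b (p - 1) + b p) = 0"
    by (rule cocycle_reduce[OF a]) (rule that)
  define J where "J p = b (p - 1) + b p" for p
  have J0: "J p = 0" if "lo < p" "p \<le> hi" "p \<notin> A ` {..<r}" "p \<notin> B ` {..<r}" for p
  proof -
    have "p' = p" if p': "\<kappa> True p' = p" for p'
    proof (cases "p' \<in> A ` {..<r} \<or> p' \<in> B ` {..<r}")
      case True
      then have "\<kappa> True p' \<in> A ` {..<r}" using kappa_A kappa_B by auto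
      then show ?thesis using p' \<open>p \<notin> A ` {..<r}\<close> by simp
    qed (use p' kappa_other in simp)
    moreover have "\<kappa> True p = p" using that kappa_other by simp
    ultimately have "{lo<..hi} \<inter> {p'. \<kappa> True p' = p} = {p}" using that by auto
    then show ?thesis using cls[of p] by (simp add: J_def)
  qed
  have JAB: "J (A j) = J (B j)" if j: "j < r" for j
  proof -
    have "p = A j \<or> p = B j" if p: "\<kappa> True p = A j" for p
    proof -
      consider i where "i < r" "p = A i" | i where "i < r" "p = B i" | "p \<notin> A ` {..<r}" "p \<notin> B ` {..<r}"
        by auto
      then show ?thesis
      proof cases
        case 1
        then show ?thesis using p kappa_A by simp
      next
        case 2
        then have "A i = A j" using p kappa_B by simp
        then show ?thesis using 2 j inj_A by (auto dest: inj_onD)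
      next
        case 3
        then show ?thesis using p kappa_other by simp
      qed
    qed
    then have "{lo<..hi} \<inter> {p'. \<kappa> True p' = A j} = {A j, B j}"
      using kappa_A[OF j] kappa_B[OF j] A_less_B[OF j] by auto
    moreover have "A j \<noteq> B j" using j A_neq_B by blast
    ultimately show ?thesis using cls[of "A j"] by (simp add: J_def)
  qed
  have b_sum: "b i = (\<Sum>p\<in>{lo<..i}. J p)" if "lo \<le> i" for i
    using that
  proof (induction i rule: int_ge_induct)
    case (step i)
    then show ?case using sum_ioc_int[of "i + 1" J] by (simp add: J_def ac_simps)
  qed (simp add: b0)
  have b_eq: "b i = (\<Sum>j<r. J (A j) * of_bool (A j \<le> i \<and> i < B j))" if i: "lo \<le> i" "i \<le> hi" for i
  proof -
    let ?AB = "A ` {..<r} \<union> B ` {..<r}"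
    have "b i = (\<Sum>p\<in>?AB. J p * of_bool (p \<le> i))"
      unfolding b_sum[OF i(1)]
    proof (rule sum.mono_neutral_cong)
      show "J p * of_bool (p \<le> i) = 0" if "p \<in> ?AB - {lo<..i}" for p
        using that A_less_B by force
      show "J p = 0" if "p \<in> {lo<..i} - ?AB" for p
        using that i by (intro J0) auto
    qed auto
    also have "\<dots> = (\<Sum>p\<in>A ` {..<r}. J p * of_bool (p \<le> i)) + (\<Sum>p\<in>B ` {..<r}. J p * of_bool (p \<le> i))"
      using A_neq_B by (intro sum.union_disjoint) auto
    also have "\<dots> = (\<Sum>j<r. J (A j) * of_bool (A j \<le> i)) + (\<Sum>j<r. J (B j) * of_bool (B j \<le> i))"
      by (simp add: sum.reindex inj_A inj_B)
    also have "\<dots> = (\<Sum>j<r. J (A j) * of_bool (A j \<le> i \<and> i < B j))"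
      unfolding sum.distrib[symmetric]
    proof (intro sum.cong refl)
      fix j assume "j \<in> {..<r}"
      then show "J (A j) * of_bool (A j \<le> i) + J (B j) * of_bool (B j \<le> i) = J (A j) * of_bool (A j \<le> i \<and> i < B j)"
        using JAB[of j] A_less_B[of j] by auto
    qed
    finally show ?thesis .
  qed
  have "a y = \<phi> (s y) + \<phi> (t y) + (\<Sum>j<r. J (A j) * of_bool (y \<in> D j))" if y: "y \<in> Y" for y
  proof -
    have "(case y of GE i \<Rightarrow> b i | _ \<Rightarrow> 0) = (\<Sum>j<r. J (A j) * of_bool (y \<in> D j))"
    proof (cases y)
      case (GE i)
      then have "(y \<in> D j) = (A j \<le> i \<and> i < B j)" for j by (auto simp: D_def)
      then show ?thesis using b_eq[of i] y GE by simp
    qed (auto simp: D_def image_iff)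
    then show ?thesis using pot[OF y] by simp
  qed
  then show ?thesis by (intro exI[of _ \<phi>] exI[of _ "\<lambda>j. J (A j)"] ballI)
qed

sublocale bit_complex X Y s t L R r D
  using finite_X finite_Y ends boundary_boundary cohomology by unfold_locales auto

end

section \<open>Embedded graphs as minors of tilings\<close>

context bit_complex
begin

lemma adj_mono: "S \<subseteq> S' \<Longrightarrow> adj S \<subseteq> adj S'"
  by (auto simp: adj_def)

lemma rtrancl_adj_mono: "S \<subseteq> S' \<Longrightarrow> (x, y) \<in> (adj S)\<^sup>* \<Longrightarrow> (x, y) \<in> (adj S')\<^sup>*"
  using rtrancl_mono[OF adj_mono] by blast

lemma sym_rtrancl_adj: "(x, y) \<in> (adj S)\<^sup>* \<Longrightarrow> (y, x) \<in> (adj S)\<^sup>*"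
proof -
  have "sym (adj S)" by (auto simp: sym_def adj_def insert_commute)
  then show "(x, y) \<in> (adj S)\<^sup>* \<Longrightarrow> (y, x) \<in> (adj S)\<^sup>*" by (meson sym_rtrancl symD)
qed

lemma rtrancl_adj_reachable:
  assumes "(x, y) \<in> (adj S)\<^sup>*"
  shows "(x, y) \<in> (adj ((adj S)\<^sup>* `` {x}))\<^sup>*"
  using assms
proof (induction rule: rtrancl_induct)
  case (step y z)
  then have "(y, z) \<in> adj ((adj S)\<^sup>* `` {x})"
    by (auto simp: adj_def intro: rtrancl_into_rtrancl)
  then show ?case using step.IH by (rule rtrancl_into_rtrancl[rotated])
qed simp

text \<open>The path is cut at its first entry into \<open>W\<close>.\<close>

lemma rtrancl_adj_exit:
  assumes "(x, y) \<in> (adj S)\<^sup>*" "x \<in> S" "x \<notin> W" "y \<in> W"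
  shows "\<exists>x1 x2. (x, x1) \<in> (adj (S - W))\<^sup>* \<and> x2 \<in> W \<and> (x1, x2) \<in> adj S"
proof -
  have "(x, y) \<in> (adj (S - W))\<^sup>* \<and> y \<notin> W \<or> (\<exists>x1 x2. (x, x1) \<in> (adj (S - W))\<^sup>* \<and> x2 \<in> W \<and> (x1, x2) \<in> adj S)"
    using assms(1)
  proof (induction rule: rtrancl_induct)
    case base
    then show ?case using assms by simp
  next
    case (step y z)
    show ?case
    proof (cases "(x, y) \<in> (adj (S - W))\<^sup>* \<and> y \<notin> W")
      case True
      show ?thesis
      proof (cases "z \<in> W")
        case True
        then show ?thesis using \<open>(x, y) \<in> _ \<and> _\<close> step.hyps by blast
      next
        case False
        then have "(y, z) \<in> adj (S - W)" using True step.hyps by (auto simp: adj_def)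
        then show ?thesis using True False by (meson rtrancl_into_rtrancl)
      qed
    qed (use step.IH in blast)
  qed
  then show ?thesis using assms(4) by blast
qed

definition meeting :: "('t \<Rightarrow> 'p set) \<Rightarrow> 'p set \<Rightarrow> 't set" where
  "meeting tile Z = {x\<in>X. tile x \<inter> Z \<noteq> {}}"

text \<open>Otherwise the tiles reachable from \<open>x\<close> and the remaining ones, finitely
  many closed sets, split \<open>Z\<close> into two non-empty relatively closed parts. The parts are
  disjoint because all tiles through one point are connected with each other by
  \<open>point\<close>.\<close>

lemma meeting_connected:
  assumes closed: "\<And>x. x \<in> X \<Longrightarrow> closedin S (tile x)"
    and cover: "topspace S \<subseteq> (\<Union>x\<in>X. tile x)"
    and point: "\<And>z x x'. z \<in> topspace S \<Longrightarrow> x \<in> meeting tile {z} \<Longrightarrow> x' \<in> meeting tile {z} \<Longrightarrow>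
       (x, x') \<in> (adj (meeting tile {z}))\<^sup>*"
    and Z: "connectedin S Z" and x: "x \<in> meeting tile Z" "x' \<in> meeting tile Z"
  shows "(x, x') \<in> (adj (meeting tile Z))\<^sup>*"
proof (rule ccontr)
  assume no: "(x, x') \<notin> (adj (meeting tile Z))\<^sup>*"
  define C where "C = {y\<in>meeting tile Z. (x, y) \<in> (adj (meeting tile Z))\<^sup>*}"
  define U where "U = \<Union>(tile ` C)"
  define W where "W = \<Union>(tile ` (meeting tile Z - C))"
  have fin: "finite (meeting tile Z)" using finite_X by (simp add: meeting_def)
  have finC: "finite C" by (rule finite_subset[OF _ fin]) (auto simp: C_def)
  have C_X: "C \<subseteq> X" "meeting tile Z \<subseteq> X" by (auto simp: C_def meeting_def)
  have ZS: "Z \<subseteq> topspace S" using Z by (rule connectedin_subset_topspace)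
  have "closedin S U" unfolding U_def
    by (rule closedin_Union) (use finC closed C_X in auto)
  moreover have "closedin S W" unfolding W_def
    by (rule closedin_Union) (use fin closed C_X in auto)
  moreover have "Z \<subseteq> U \<union> W"
  proof
    fix z assume z: "z \<in> Z"
    then obtain y where "y \<in> X" "z \<in> tile y" using cover ZS by blast
    then show "z \<in> U \<union> W" using z by (auto simp: U_def W_def meeting_def)
  qed
  moreover have "U \<inter> W \<inter> Z = {}"
  proof (rule ccontr)
    assume "U \<inter> W \<inter> Z \<noteq> {}"
    then obtain z y y' where z: "z \<in> Z" "z \<in> tile y" "z \<in> tile y'" "y \<in> C" "y' \<in> meeting tile Z - C"
      by (auto simp: U_def W_def)
    have "meeting tile {z} \<subseteq> meeting tile Z" using z by (auto simp: meeting_def)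
    moreover have "(y, y') \<in> (adj (meeting tile {z}))\<^sup>*"
      using z ZS by (intro point) (auto simp: meeting_def C_def)
    ultimately have "(y, y') \<in> (adj (meeting tile Z))\<^sup>*" by (rule rtrancl_adj_mono)
    then have "y' \<in> C" using z(4,5) by (auto simp: C_def intro: rtrancl_trans)
    then show False using z(5) by blast
  qed
  moreover have "U \<inter> Z \<noteq> {}" using x by (auto simp: U_def C_def meeting_def)
  moreover have "W \<inter> Z \<noteq> {}"
  proof -
    have "x' \<in> meeting tile Z - C" using x no by (simp add: C_def)
    moreover obtain z where "z \<in> tile x'" "z \<in> Z" using x(2) by (auto simp: meeting_def)
    ultimately have "z \<in> W \<inter> Z" by (auto simp: W_def)
    then show ?thesis by blast
  qed
  ultimately show False using Z unfolding connectedin_closedin by blast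
qed

text \<open>The tiles along the middle of an edge overlap those of the stars at both of its ends.
  The edge is therefore directed, and a part of its middle is added to the star where it
  starts.\<close>

lemma tiled_euler_bound:
  fixes E :: "'v::finite set set" and St :: "'v \<Rightarrow> 'p set" and Md :: "'v set \<Rightarrow> 'p set"
  assumes closed: "\<And>x. x \<in> X \<Longrightarrow> closedin S (tile x)"
    and cover: "topspace S \<subseteq> (\<Union>x\<in>X. tile x)"
    and point: "\<And>z x x'. z \<in> topspace S \<Longrightarrow> x \<in> meeting tile {z} \<Longrightarrow> x' \<in> meeting tile {z} \<Longrightarrow>
       (x, x') \<in> (adj (meeting tile {z}))\<^sup>*"
    and simple: "simple_graph E"
    and St: "\<And>v. connectedin S (St v)" "\<And>v. St v \<noteq> {}"
    and Md: "\<And>e. e \<in> E \<Longrightarrow> connectedin S (Md e)"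
    and inc: "\<And>e v. e \<in> E \<Longrightarrow> v \<in> e \<Longrightarrow> Md e \<inter> St v \<noteq> {}"
    and sep_St: "\<And>u v. u \<noteq> v \<Longrightarrow> meeting tile (St u) \<inter> meeting tile (St v) = {}"
    and sep_Md: "\<And>e e'. e \<in> E \<Longrightarrow> e' \<in> E \<Longrightarrow> e \<noteq> e' \<Longrightarrow> meeting tile (Md e) \<inter> meeting tile (Md e') = {}"
    and sep_Md_St: "\<And>e v. e \<in> E \<Longrightarrow> v \<notin> e \<Longrightarrow> meeting tile (Md e) \<inter> meeting tile (St v) = {}"
    and girth: "\<And>z. z \<subseteq> E \<Longrightarrow> z \<noteq> {} \<Longrightarrow> (\<And>v. even (card {e\<in>z. v \<in> e})) \<Longrightarrow> g \<le> card z"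
  shows "\<exists>f. card E \<le> (CARD('v) - 1) + r + (f - 1) \<and> f * g \<le> 2 * card E"
proof -
  let ?T = "meeting tile"
  note conn = meeting_connected[OF closed cover point]
  have nonempty: "?T Z \<noteq> {}" if "Z \<subseteq> topspace S" "Z \<noteq> {}" for Z
    using that cover by (fastforce simp: meeting_def)
  \<comment> \<open>The path starts at a tile \<open>x0\<close> shared with the star of
    \<open>u\<close> and follows the middle of \<open>e\<close> up to \<open>x1\<close>, just before
    the first tile \<open>x2\<close> that meets the star of \<open>w\<close>. The side between
    \<open>x1\<close> and \<open>x2\<close> will represent \<open>e\<close>.\<close>
  define good where "good e q \<longleftrightarrow> (case q of (u, w, x0, x1, x2) \<Rightarrow>
      e = {u, w} \<and> u \<noteq> w \<and> x0 \<in> ?T (Md e) \<inter> ?T (St u) \<and>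
      (x0, x1) \<in> (adj (?T (Md e) - ?T (St w)))\<^sup>* \<and> x2 \<in> ?T (St w) \<and> (x1, x2) \<in> adj (?T (Md e)))" for e q
  have "\<exists>q. good e q" if e: "e \<in> E" for e
  proof -
    obtain u w where uw: "e = {u, w}" "u \<noteq> w"
      using simple e by (auto simp: simple_graph_def card_2_iff)
    have tiles: "\<exists>x. x \<in> ?T (Md e) \<inter> ?T (St v)" if v: "v \<in> e" for v
    proof -
      obtain z where z: "z \<in> Md e" "z \<in> St v" using inc[OF e v] by blast
      then have "z \<in> topspace S" using St(1) connectedin_subset_topspace by blast
      then show ?thesis using z cover by (fastforce simp: meeting_def)
    qed
    obtain x0 where x0: "x0 \<in> ?T (Md e) \<inter> ?T (St u)" using tiles[of u] uw by auto
    obtain x3 where x3: "x3 \<in> ?T (Md e) \<inter> ?T (St w)" using tiles[of w] uw by auto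
    have "(x0, x3) \<in> (adj (?T (Md e)))\<^sup>*" using x0 x3 by (intro conn Md e) auto
    moreover have "x0 \<notin> ?T (St w)" using sep_St[OF uw(2)] x0 by blast
    ultimately obtain x1 x2 where "(x0, x1) \<in> (adj (?T (Md e) - ?T (St w)))\<^sup>*" "x2 \<in> ?T (St w)"
        "(x1, x2) \<in> adj (?T (Md e))"
      using rtrancl_adj_exit[of x0 x3 "?T (Md e)" "?T (St w)"] x0 x3 by blast
    then have "good e (u, w, x0, x1, x2)" using uw x0 by (simp add: good_def)
    then show ?thesis by blast
  qed
  then have "\<forall>e\<in>E. \<exists>q. good e q" by blast
  from bchoice[OF this] obtain q where q: "\<And>e. e \<in> E \<Longrightarrow> good e (q e)" by blast
  define us ws x0 x1 x2 where "us e = fst (q e)" and "ws e = fst (snd (q e))"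
    and "x0 e = fst (snd (snd (q e)))" and "x1 e = fst (snd (snd (snd (q e))))"
    and "x2 e = snd (snd (snd (snd (q e))))" for e
  have good: "good e (us e, ws e, x0 e, x1 e, x2 e)" if "e \<in> E" for e
    using q[OF that] by (simp add: us_def ws_def x0_def x1_def x2_def)
  have e_eq: "\<And>e. e \<in> E \<Longrightarrow> e = {us e, ws e}" and uw: "\<And>e. e \<in> E \<Longrightarrow> us e \<noteq> ws e"
    and x0: "\<And>e. e \<in> E \<Longrightarrow> x0 e \<in> ?T (Md e) \<inter> ?T (St (us e))"
    and x1: "\<And>e. e \<in> E \<Longrightarrow> (x0 e, x1 e) \<in> (adj (?T (Md e) - ?T (St (ws e))))\<^sup>*"
    and x2: "\<And>e. e \<in> E \<Longrightarrow> x2 e \<in> ?T (St (ws e))"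
    and x12: "\<And>e. e \<in> E \<Longrightarrow> (x1 e, x2 e) \<in> adj (?T (Md e))"
    using good unfolding good_def prod.case by blast+
  \<comment> \<open>Everything reachable is taken instead of a single path, so that connectedness to
    \<open>x0 e\<close> holds by construction.\<close>
  define Pre where "Pre e = (adj (?T (Md e) - ?T (St (ws e))))\<^sup>* `` {x0 e}" for e
  have x0_notin: "x0 e \<notin> ?T (St (ws e))" if "e \<in> E" for e
    using sep_St[OF uw[OF that]] x0[OF that] by blast
  have Pre_sub: "Pre e \<subseteq> ?T (Md e) - ?T (St (ws e))" if e: "e \<in> E" for e
  proof
    fix x assume "x \<in> Pre e"
    then have "(x0 e, x) \<in> (adj (?T (Md e) - ?T (St (ws e))))\<^sup>*" by (simp add: Pre_def)
    then show "x \<in> ?T (Md e) - ?T (St (ws e))"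
      by (cases rule: rtranclE) (use x0[OF e] x0_notin[OF e] in \<open>auto simp: adj_def\<close>)
  qed
  define B where "B v = ?T (St v) \<union> \<Union>(Pre ` {e\<in>E. us e = v})" for v
  have B_cases: "x \<in> ?T (St v) \<or> (\<exists>e\<in>E. us e = v \<and> x \<in> Pre e)" if "x \<in> B v" for x v
    using that by (auto simp: B_def)
  have Pre_St: "Pre e \<inter> ?T (St v) = {}" if e: "e \<in> E" and v: "us e \<noteq> v" for e v
  proof (cases "v \<in> e")
    case True
    then have "v \<in> {us e, ws e}" by (subst e_eq[OF e, symmetric])
    then have "v = ws e" using v by auto
    then show ?thesis using Pre_sub[OF e] by blast
  next
    case False
    then show ?thesis using Pre_sub[OF e] sep_Md_St[OF e] by blast
  qed
  have Pre_Pre: "Pre e \<inter> Pre e' = {}" if "e \<in> E" "e' \<in> E" "e \<noteq> e'" for e e'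
    using Pre_sub sep_Md that by blast
  have to_St: "\<exists>y\<in>?T (St v). (y, x) \<in> (adj (B v))\<^sup>*" if "x \<in> B v" for x v
  proof -
    consider "x \<in> ?T (St v)" | e where "e \<in> E" "us e = v" "x \<in> Pre e" using B_cases[OF \<open>x \<in> B v\<close>] by blast
    then show ?thesis
    proof cases
      case 2
      then have "(x0 e, x) \<in> (adj (Pre e))\<^sup>*"
        unfolding Pre_def using rtrancl_adj_reachable by fastforce
      moreover have "Pre e \<subseteq> B v" using 2 by (auto simp: B_def)
      ultimately have "(x0 e, x) \<in> (adj (B v))\<^sup>*" by (meson rtrancl_adj_mono)
      then show ?thesis using x0[of e] 2 by blast
    qed auto
  qed
  have ye: "\<exists>y. y \<in> Y \<and> (\<exists>u v. e = {u, v} \<and> s y \<in> B u \<and> t y \<in> B v)" if e: "e \<in> E" for e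
  proof -
    obtain y where y: "y \<in> Y" "{s y, t y} = {x1 e, x2 e}" using x12[OF e] by (auto simp: adj_def)
    have "x1 e \<in> B (us e)" using x1[OF e] e by (auto simp: B_def Pre_def)
    moreover have "x2 e \<in> B (ws e)" using x2[OF e] by (auto simp: B_def)
    ultimately have "s y \<in> B (us e) \<and> t y \<in> B (ws e) \<or> s y \<in> B (ws e) \<and> t y \<in> B (us e)"
      using y(2) by (auto simp: doubleton_eq_iff)
    then show ?thesis using y(1) e_eq[OF e] by (metis insert_commute)
  qed
  define yf where "yf e = (SOME y. y \<in> Y \<and> (\<exists>u v. e = {u, v} \<and> s y \<in> B u \<and> t y \<in> B v))" for e
  show ?thesis
  proof (rule minor_euler_bound[OF simple, of B yf])
    show "B v \<subseteq> X" for v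
      using Pre_sub by (fastforce simp: B_def meeting_def)
    show "B v \<noteq> {}" for v
      using nonempty[OF connectedin_subset_topspace[OF St(1)] St(2)] by (auto simp: B_def)
    show "B u \<inter> B v = {}" if "u \<noteq> v" for u v
    proof (rule ccontr)
      assume "B u \<inter> B v \<noteq> {}"
      then obtain x where x: "x \<in> B u" "x \<in> B v" by blast
      show False
      proof (cases "x \<in> ?T (St u)")
        case True
        then have "x \<notin> ?T (St v)" using sep_St[OF that] by blast
        then obtain e where "e \<in> E" "us e = v" "x \<in> Pre e" using B_cases[OF x(2)] by blast
        then show False using True Pre_St[of e u] that by blast
      next
        case False
        then obtain e where e: "e \<in> E" "us e = u" "x \<in> Pre e" using B_cases[OF x(1)] by blast
        then have "x \<notin> ?T (St v)" using Pre_St[of e v] that by blast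
        then obtain e' where "e' \<in> E" "us e' = v" "x \<in> Pre e'" using B_cases[OF x(2)] by blast
        then show False using e Pre_Pre[of e e'] that by blast
      qed
    qed
    show "(x, x') \<in> (adj (B v))\<^sup>*" if x: "x \<in> B v" "x' \<in> B v" for v x x'
    proof -
      obtain y where y: "y \<in> ?T (St v)" "(y, x) \<in> (adj (B v))\<^sup>*"
        using to_St[OF x(1)] by blast
      obtain y' where y': "y' \<in> ?T (St v)" "(y', x') \<in> (adj (B v))\<^sup>*"
        using to_St[OF x(2)] by blast
      have "(y, y') \<in> (adj (?T (St v)))\<^sup>*" using y y' by (intro conn St)
      then have "(y, y') \<in> (adj (B v))\<^sup>*" by (rule rtrancl_adj_mono[rotated]) (auto simp: B_def)
      with sym_rtrancl_adj[OF y(2)] have "(x, y') \<in> (adj (B v))\<^sup>*" by (rule rtrancl_trans)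
      then show ?thesis using y'(2) by (rule rtrancl_trans)
    qed
    show "yf e \<in> Y \<and> (\<exists>u v. e = {u, v} \<and> s (yf e) \<in> B u \<and> t (yf e) \<in> B v)" if "e \<in> E" for e
      unfolding yf_def by (rule someI_ex[OF ye[OF that]])
  qed (rule girth)
qed

end

text \<open>A segment of an arc is compact, hence closed in a Hausdorff space. The middle thirds lie
  in the interiors of the arcs and so avoid each other and all vertices; stars of adjacent vertices
  are kept apart by the middle third between them.\<close>

lemma embedding_stars:
  fixes E :: "'v::finite set set"
  assumes simple: "simple_graph E" and Haus: "Hausdorff_space S" and emb: "embeds_in E S"
  obtains St :: "'v \<Rightarrow> 'p set" and Md :: "'v set \<Rightarrow> 'p set" where
    "\<And>v. connectedin S (St v)" "\<And>v. closedin S (St v)" "\<And>v. St v \<noteq> {}"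
    "\<And>e. e \<in> E \<Longrightarrow> connectedin S (Md e)" "\<And>e. e \<in> E \<Longrightarrow> closedin S (Md e)"
    "\<And>e v. e \<in> E \<Longrightarrow> v \<in> e \<Longrightarrow> Md e \<inter> St v \<noteq> {}"
    "\<And>u v. u \<noteq> v \<Longrightarrow> St u \<inter> St v = {}"
    "\<And>e e'. e \<in> E \<Longrightarrow> e' \<in> E \<Longrightarrow> e \<noteq> e' \<Longrightarrow> Md e \<inter> Md e' = {}"
    "\<And>e v. e \<in> E \<Longrightarrow> v \<notin> e \<Longrightarrow> Md e \<inter> St v = {}"
proof -
  from emb[unfolded embeds_in_def] obtain p :: "'v \<Rightarrow> 'p" and \<gamma> :: "'v set \<Rightarrow> real \<Rightarrow> 'p" where
    emb': "inj p \<and> range p \<subseteq> topspace S \<and>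
        (\<forall>e\<in>E. embedding_map (top_of_set {0..1}) S (\<gamma> e) \<and> {\<gamma> e 0, \<gamma> e 1} = p ` e \<and>
               \<gamma> e ` {0<..<1} \<inter> range p = {}) \<and>
        (\<forall>e\<in>E. \<forall>e'\<in>E. e \<noteq> e' \<longrightarrow> \<gamma> e ` {0<..<1} \<inter> \<gamma> e' ` {0<..<1} = {})"
    by (elim exE)
  have p: "inj p" "range p \<subseteq> topspace S"
    and \<gamma>: "\<And>e. e \<in> E \<Longrightarrow> embedding_map (top_of_set {0..1}) S (\<gamma> e)"
    and ends: "\<And>e. e \<in> E \<Longrightarrow> {\<gamma> e 0, \<gamma> e 1} = p ` e"
    and int_p: "\<And>e. e \<in> E \<Longrightarrow> \<gamma> e ` {0<..<1} \<inter> range p = {}"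
    and int_int: "\<And>e e'. e \<in> E \<Longrightarrow> e' \<in> E \<Longrightarrow> e \<noteq> e' \<Longrightarrow> \<gamma> e ` {0<..<1} \<inter> \<gamma> e' ` {0<..<1} = {}"
    using emb' by simp_all
  have cont: "continuous_map (top_of_set {0..1}) S (\<gamma> e)" if "e \<in> E" for e
    using \<gamma>[OF that] unfolding embedding_map_def
    by (meson continuous_map_in_subtopology homeomorphic_imp_continuous_map)
  have inj: "inj_on (\<gamma> e) {0..1}" if "e \<in> E" for e
    using homeomorphic_imp_injective_map[OF \<gamma>[OF that, unfolded embedding_map_def]] by simp
  have arc_conn: "connectedin S (\<gamma> e ` {a..b})" and arc_closed: "closedin S (\<gamma> e ` {a..b})"
    if "e \<in> E" "0 \<le> a" "b \<le> 1" for e a b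
  proof -
    have sub: "{a..b} \<subseteq> {0..1}" using that by auto
    have "connectedin (top_of_set {0..1}) {a..b}"
      using sub by (simp add: connectedin_subtopology connected_Icc)
    then show "connectedin S (\<gamma> e ` {a..b})" by (rule connectedin_continuous_map_image[OF cont[OF that(1)]])
    have "compactin (top_of_set {0..1}) {a..b}"
      using sub by (simp add: compactin_subtopology)
    then have "compactin S (\<gamma> e ` {a..b})" by (rule image_compactin[OF _ cont[OF that(1)]])
    then show "closedin S (\<gamma> e ` {a..b})" using Haus by (simp add: compactin_imp_closedin)
  qed
  \<comment> \<open>Which outer third belongs to \<open>v\<close> depends on the direction in which
    \<open>\<gamma> e\<close> runs; the value is used only for \<open>v \<in> e\<close>.\<close>
  define I where "I e v = (if \<gamma> e 0 = p v then {0..1/3} else {2/3..1::real})" for e v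
  define St where "St v = insert (p v) (\<Union>e\<in>{e\<in>E. v \<in> e}. \<gamma> e ` I e v)" for v
  define Md where "Md e = \<gamma> e ` {1/3..2/3}" for e
  have I01: "I e v \<subseteq> {0..1}" for e v by (auto simp: I_def)
  have end_cases: "\<gamma> e 0 = p v \<or> \<gamma> e 1 = p v" if "e \<in> E" "v \<in> e" for e v
  proof -
    have "p v \<in> {\<gamma> e 0, \<gamma> e 1}" unfolding ends[OF that(1)] using that(2) by (rule imageI)
    then show ?thesis by auto
  qed
  have pv_in: "p v \<in> \<gamma> e ` I e v" if e: "e \<in> E" "v \<in> e" for e v
  proof (cases "\<gamma> e 0 = p v")
    case True
    then show ?thesis by (auto simp: I_def intro!: image_eqI[of _ _ 0])
  next
    case False
    then have "\<gamma> e 1 = p v" using end_cases[OF e] by blast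
    then show ?thesis using False by (auto simp: I_def intro!: image_eqI[of _ _ 1])
  qed
  have seg: "z = p v \<or> z \<in> \<gamma> e ` ({0<..<1} \<inter> I e v)" if e: "e \<in> E" "v \<in> e" and z: "z \<in> \<gamma> e ` I e v" for e v z
  proof -
    obtain t where t: "t \<in> I e v" "z = \<gamma> e t" using z by blast
    consider "t = 0" | "t = 1" | "0 < t" "t < 1" using t(1) I01[of e v] by fastforce
    then show ?thesis
    proof cases
      case 1
      then show ?thesis using t by (auto simp: I_def split: if_splits)
    next
      case 2
      then have "\<gamma> e 0 \<noteq> p v" using t by (auto simp: I_def split: if_splits)
      then have "\<gamma> e 1 = p v" using end_cases[OF e] by blast
      then show ?thesis using 2 t by simp
    next
      case 3
      then show ?thesis using t by auto
    qed
  qed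
  have St_cases: "z = p v \<or> (\<exists>e\<in>E. v \<in> e \<and> z \<in> \<gamma> e ` ({0<..<1} \<inter> I e v))" if "z \<in> St v" for z v
    using that seg unfolding St_def by blast
  have I_disj: "I e u \<inter> I e v = {}" if e: "e \<in> E" "u \<in> e" "v \<in> e" and "u \<noteq> v" for e u v
  proof -
    have "card e = 2" using simple e by (simp add: simple_graph_def)
    then have "e = {u, v}" using e \<open>u \<noteq> v\<close> by (auto simp: card_2_iff)
    then have "\<gamma> e 0 = p u \<or> \<gamma> e 0 = p v" using ends[OF e(1)] by auto
    moreover have "p u \<noteq> p v" using p(1) \<open>u \<noteq> v\<close> by (auto dest: injD)
    ultimately show ?thesis by (auto simp: I_def)
  qed
  have Md_int: "Md e \<subseteq> \<gamma> e ` {0<..<1}" for e by (auto simp: Md_def)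
  show thesis
  proof (rule that[of St Md])
    show "connectedin S (St v)" for v
    proof -
      have eq: "St v = \<Union>(insert {p v} ((\<lambda>e. \<gamma> e ` I e v) ` {e\<in>E. v \<in> e}))" by (auto simp: St_def)
      show ?thesis unfolding eq
      proof (rule connectedin_Union)
        fix T assume "T \<in> insert {p v} ((\<lambda>e. \<gamma> e ` I e v) ` {e\<in>E. v \<in> e})"
        then show "connectedin S T"
          using p(2) by (auto simp: I_def image_subset_iff intro!: arc_conn)
      next
        show "\<Inter>(insert {p v} ((\<lambda>e. \<gamma> e ` I e v) ` {e\<in>E. v \<in> e})) \<noteq> {}"
          using pv_in by blast
      qed
    qed
    show "closedin S (St v)" for v
    proof -
      have "St v = {p v} \<union> (\<Union>e\<in>{e\<in>E. v \<in> e}. \<gamma> e ` I e v)" by (auto simp: St_def)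
      moreover have "closedin S {p v}" using Haus p(2) by (simp add: closedin_Hausdorff_singleton image_subset_iff)
      moreover have "closedin S (\<Union>e\<in>{e\<in>E. v \<in> e}. \<gamma> e ` I e v)"
        by (rule closedin_Union) (auto simp: I_def intro!: arc_closed)
      ultimately show ?thesis by (metis closedin_Un)
    qed
    show "St v \<noteq> {}" for v by (simp add: St_def)
    show "connectedin S (Md e)" "closedin S (Md e)" if "e \<in> E" for e
      using arc_conn[OF that] arc_closed[OF that] by (auto simp: Md_def)
    show "Md e \<inter> St v \<noteq> {}" if e: "e \<in> E" "v \<in> e" for e v
    proof -
      define t :: real where "t = (if \<gamma> e 0 = p v then 1/3 else 2/3)"
      have "\<gamma> e t \<in> Md e" by (auto simp: Md_def t_def)
      moreover have "t \<in> I e v" by (auto simp: I_def t_def)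
      then have "\<gamma> e t \<in> St v" using e by (auto simp: St_def)
      ultimately show ?thesis by blast
    qed
    show "St u \<inter> St v = {}" if "u \<noteq> v" for u v
    proof (rule ccontr)
      assume "St u \<inter> St v \<noteq> {}"
      then obtain z where z: "z \<in> St u" "z \<in> St v" by blast
      have np: "z \<noteq> p w" if "e \<in> E" "z \<in> \<gamma> e ` ({0<..<1} \<inter> J)" for e w J
        using int_p[OF that(1)] that(2) by blast
      have "p u \<noteq> p v" using p(1) that by (auto dest: injD)
      then obtain e e' where e: "e \<in> E" "u \<in> e" "z \<in> \<gamma> e ` ({0<..<1} \<inter> I e u)"
        and e': "e' \<in> E" "v \<in> e'" "z \<in> \<gamma> e' ` ({0<..<1} \<inter> I e' v)"
        using St_cases[OF z(1)] St_cases[OF z(2)] np by metis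
      have "e = e'" using int_int[OF e(1) e'(1)] e(3) e'(3) by blast
      then obtain t t' where t: "t \<in> I e u" "t' \<in> I e v" "\<gamma> e t = \<gamma> e t'" using e(3) e'(3) by blast
      then have "t = t'" using inj[OF e(1)] I01 by (meson inj_onD subsetD)
      then show False using t I_disj[OF e(1,2)] e'(2) \<open>e = e'\<close> that by blast
    qed
    show "Md e \<inter> Md e' = {}" if "e \<in> E" "e' \<in> E" "e \<noteq> e'" for e e'
      using int_int[OF that] Md_int[of e] Md_int[of e'] by blast
    show "Md e \<inter> St v = {}" if e: "e \<in> E" "v \<notin> e" for e v
    proof (rule ccontr)
      assume "Md e \<inter> St v \<noteq> {}"
      then obtain z where z: "z \<in> Md e" "z \<in> St v" by blast
      have zi: "z \<in> \<gamma> e ` {0<..<1}" using z Md_int[of e] by blast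
      then have "z \<noteq> p v" using int_p[OF e(1)] by blast
      then obtain e' where e': "e' \<in> E" "v \<in> e'" "z \<in> \<gamma> e' ` {0<..<1}" using St_cases[OF z(2)] by blast
      then have "e = e'" using int_int[OF e(1) e'(1)] zi by blast
      then show False using e e' by blast
    qed
  qed
qed

section \<open>Gluing along circles\<close>

lemma glue_class_involution:
  assumes rel: "rel \<union> rel\<inverse> = {(w, \<iota> w) |w. w \<in> C}"
    and inv: "\<And>w. w \<in> C \<Longrightarrow> \<iota> w \<in> C \<and> \<iota> (\<iota> w) = w"
  shows "(rel \<union> rel\<inverse>)\<^sup>* `` {x} = (if x \<in> C then {x, \<iota> x} else {x})"
proof -
  have "y = x \<or> (x \<in> C \<and> y = \<iota> x)" if "(x, y) \<in> (rel \<union> rel\<inverse>)\<^sup>*" for y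
    using that
  proof (induction rule: rtrancl_induct)
    case (step y z)
    then have "y \<in> C" "z = \<iota> y" using rel by auto
    then show ?case using step.IH inv by auto
  qed simp
  moreover have "(x, \<iota> x) \<in> (rel \<union> rel\<inverse>)\<^sup>*" if "x \<in> C"
    using that rel by blast
  ultimately show ?thesis by auto
qed

lemma glue_involution:
  fixes T :: "'a topology"
  assumes rel: "rel \<union> rel\<inverse> = {(w, \<iota> w) |w. w \<in> C}"
    and inv: "\<And>w. w \<in> C \<Longrightarrow> \<iota> w \<in> C \<and> \<iota> (\<iota> w) = w"
    and CT: "C \<subseteq> topspace T"
    and cl: "\<And>K. closedin T K \<Longrightarrow> closedin T (\<iota> ` (K \<inter> C))"
  defines "q \<equiv> \<lambda>x. (rel \<union> rel\<inverse>)\<^sup>* `` {x}"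
  shows "topspace (glue T rel) = q ` topspace T"
    and "continuous_map T (glue T rel) q"
    and "closed_map T (glue T rel) q"
    and "\<And>x y. q x = q y \<longleftrightarrow> x = y \<or> (x \<in> C \<and> y = \<iota> x)"
proof -
  show top: "topspace (glue T rel) = q ` topspace T"
    by (simp add: glue_def q_def topspace_quotient_topology)
  have qm: "quotient_map T (glue T rel) q"
    unfolding glue_def q_def by (rule quotient_map_quotient_topology)
  then show "continuous_map T (glue T rel) q" by (rule quotient_imp_continuous_map)
  have q: "q x = (if x \<in> C then {x, \<iota> x} else {x})" for x
    unfolding q_def by (rule glue_class_involution[OF rel inv])
  show q_eq: "q x = q y \<longleftrightarrow> x = y \<or> (x \<in> C \<and> y = \<iota> x)" for x y
    using inv[of x] inv[of y] by (auto simp: q doubleton_eq_iff split: if_splits)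
  show "closed_map T (glue T rel) q"
    unfolding closed_map_def
  proof (intro allI impI)
    fix K assume K: "closedin T K"
    then have KT: "K \<subseteq> topspace T" by (rule closedin_subset)
    \<comment> \<open>The saturation of \<open>K\<close> adds only its image under
      \<open>\<iota>\<close>, which is closed by \<open>cl\<close>.\<close>
    have "{x \<in> topspace T. q x \<in> q ` K} = K \<union> \<iota> ` (K \<inter> C)"
    proof (intro set_eqI iffI)
      fix x assume "x \<in> {x \<in> topspace T. q x \<in> q ` K}"
      then obtain y where "y \<in> K" "q y = q x" by auto
      then show "x \<in> K \<union> \<iota> ` (K \<inter> C)" by (auto simp: q_eq)
    next
      fix x assume "x \<in> K \<union> \<iota> ` (K \<inter> C)"
      then obtain y where "y \<in> K" "x = y \<or> (y \<in> C \<and> x = \<iota> y)" by auto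
      then have "y \<in> K" "q y = q x" "x \<in> topspace T" using q_eq[of y x] KT CT inv by auto
      then show "x \<in> {x \<in> topspace T. q x \<in> q ` K}" by (auto intro: image_eqI[of _ _ y])
    qed
    moreover have "closedin T (K \<union> \<iota> ` (K \<inter> C))" using K cl by (simp add: closedin_Un)
    moreover have "q ` K \<subseteq> topspace (glue T rel)" using KT top by auto
    ultimately show "closedin (glue T rel) (q ` K)"
      using qm[unfolded quotient_map_closedin] by metis
  qed
qed

text \<open>A closed continuous image of a normal space is Hausdorff once its points are
  closed.\<close>

lemma glue_involution_Hausdorff:
  fixes T :: "'a topology"
  assumes "compact_space T" "Hausdorff_space T"
    and "rel \<union> rel\<inverse> = {(w, \<iota> w) |w. w \<in> C}"
    and "\<And>w. w \<in> C \<Longrightarrow> \<iota> w \<in> C \<and> \<iota> (\<iota> w) = w"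
    and "C \<subseteq> topspace T"
    and "\<And>K. closedin T K \<Longrightarrow> closedin T (\<iota> ` (K \<inter> C))"
  shows "Hausdorff_space (glue T rel)"
proof (rule Hausdorff_normal_space_closed_continuous_map_image)
  note glue = glue_involution[OF assms(3-6)]
  show "normal_space T" using assms(1,2) by (simp add: compact_Hausdorff_or_regular_imp_normal_space)
  show "continuous_map T (glue T rel) (\<lambda>x. (rel \<union> rel\<inverse>)\<^sup>* `` {x})" by (rule glue(2))
  show cl: "closed_map T (glue T rel) (\<lambda>x. (rel \<union> rel\<inverse>)\<^sup>* `` {x})" by (rule glue(3))
  show top: "(\<lambda>x. (rel \<union> rel\<inverse>)\<^sup>* `` {x}) ` topspace T = topspace (glue T rel)" using glue(1) by simp
  show "t1_space (glue T rel)"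
    using t1_space_closed_map_image[OF cl top] assms(2) by (simp add: Hausdorff_imp_t1_space)
qed

section \<open>Closed subsets of the holed sphere\<close>

lemma closedin_holed_sphere_None:
  assumes "closed Z" "\<And>z j. z \<in> Z \<Longrightarrow> j < m \<Longrightarrow> 1 \<le> cmod (z - hole_centre j)"
  shows "closedin (holed_sphere m) (insert None (Some ` Z))"
proof -
  have "insert None (Some ` Z) = topspace (Alexandroff_compactification euclidean) - Some ` (- Z)" by auto
  moreover have "openin euclidean (- Z)" using assms(1) by (simp add: open_Compl)
  ultimately have "closedin (Alexandroff_compactification euclidean) (insert None (Some ` Z))"
    by (auto simp: closedin_Alexandroff_compactification)
  moreover have "insert None (Some ` Z) \<subseteq> - Some ` (\<Union>j<m. ball (hole_centre j) 1)"
    using assms(2) by (force simp: dist_norm norm_minus_commute)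
  ultimately show ?thesis
    unfolding holed_sphere_def by (simp add: closedin_subset_topspace)
qed

lemma closedin_holed_sphere_Some:
  assumes "compact Z" "\<And>z j. z \<in> Z \<Longrightarrow> j < m \<Longrightarrow> 1 \<le> cmod (z - hole_centre j)"
  shows "closedin (holed_sphere m) (Some ` Z)"
proof -
  have "closedin (Alexandroff_compactification euclidean) (Some ` Z)"
    using assms(1) by (simp add: compact_imp_closed)
  moreover have "Some ` Z \<subseteq> - Some ` (\<Union>j<m. ball (hole_centre j) 1)"
    using assms(2) by (force simp: dist_norm norm_minus_commute)
  ultimately show ?thesis
    unfolding holed_sphere_def by (simp add: closedin_subset_topspace)
qed

lemma topspace_holed_sphere:
  "topspace (holed_sphere m) = insert None (Some ` {z. \<forall>j<m. 1 \<le> cmod (z - hole_centre j)})"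
  unfolding holed_sphere_def by (force simp: dist_norm norm_minus_commute)

lemma open_holes: "openin (Alexandroff_compactification euclidean) (Some ` (\<Union>j<m. ball (hole_centre j) 1))"
  by (simp add: open_openin[symmetric] open_UN)

lemma closedin_Alexandroff_holed_sphere:
  assumes "closedin (holed_sphere m) K"
  shows "closedin (Alexandroff_compactification euclidean) K"
proof -
  let ?A = "Alexandroff_compactification (euclidean :: complex topology)"
  let ?H = "Some ` (\<Union>j<m. ball (hole_centre j) 1)"
  have "closedin ?A (topspace ?A - ?H)" using open_holes by (rule closedin_diff[OF closedin_topspace])
  moreover have "topspace ?A - ?H = - ?H" by (auto simp: UNIV_option_conv)
  ultimately have "closedin ?A (- ?H)" by simp
  then show ?thesis using assms unfolding holed_sphere_def by (metis closedin_closed_subtopology)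
qed

lemma closed_Some_preimage:
  assumes "closedin (holed_sphere m) K"
  shows "closed {z. Some z \<in> K}"
    and "None \<notin> K \<Longrightarrow> compact {z. Some z \<in> K}"
proof -
  have A: "closedin (Alexandroff_compactification euclidean) K"
    using assms by (rule closedin_Alexandroff_holed_sphere)
  have "closedin euclidean {z \<in> topspace euclidean. Some z \<in> K}"
    using closedin_continuous_map_preimage[OF continuous_map_Some A] .
  then show "closed {z. Some z \<in> K}" by simp
  assume N: "None \<notin> K"
  then have "K = Some ` {z. Some z \<in> K}" by (auto simp: image_iff) (metis not_None_eq)
  then have "closedin (Alexandroff_compactification euclidean) (Some ` {z. Some z \<in> K})" using A by simp
  then show "compact {z. Some z \<in> K}" by simp
qed

lemma compact_Hausdorff_holed_sphere: "compact_space (holed_sphere m)" "Hausdorff_space (holed_sphere m)"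
proof -
  let ?A = "Alexandroff_compactification (euclidean :: complex topology)"
  let ?H = "Some ` (\<Union>j<m. ball (hole_centre j) 1)"
  have "locally_compact_space (euclidean :: complex topology)" by (simp add: locally_compact_space_euclidean)
  then have "Hausdorff_space ?A" by (simp add: Hausdorff_space_Alexandroff_compactification)
  then show "Hausdorff_space (holed_sphere m)" unfolding holed_sphere_def by (rule Hausdorff_space_subtopology)
  have "closedin ?A (topspace ?A - ?H)" using open_holes by (rule closedin_diff[OF closedin_topspace])
  moreover have "topspace ?A - ?H = - ?H" by (auto simp: UNIV_option_conv)
  ultimately have "compactin ?A (- ?H)" using closedin_compact_space compact_space_Alexandroff_compactification by metis
  then show "compact_space (holed_sphere m)" unfolding holed_sphere_def by (rule compact_space_subtopology)
qed

text \<open>The common pattern of both families of surfaces: the boundary circle of hole \<open>j\<close> is glued to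
  that of hole \<open>\<eta> j\<close> by \<open>u \<mapsto> \<epsilon> Re u - \<i> Im u\<close>, so that \<open>\<epsilon> = 1\<close> gives \<open>cnj\<close> and \<open>\<epsilon> = - 1\<close> the
  antipodal map. The real points of the circles are identified in pairs \<open>A i\<close>, \<open>B i\<close>.\<close>

locale surface_pattern =
  fixes m :: nat and \<eta> :: "nat \<Rightarrow> nat" and \<epsilon> :: int and r :: nat and A B :: "nat \<Rightarrow> int"
  assumes eta: "j < m \<Longrightarrow> \<eta> j < m" "j < m \<Longrightarrow> \<eta> (\<eta> j) = j"
    and eps: "\<epsilon> = 1 \<or> \<epsilon> = - 1"
    and pattern_A_less_B: "j < r \<Longrightarrow> A j < B j"
    and pattern_inj_A: "inj_on A {..<r}" and pattern_inj_B: "inj_on B {..<r}"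
    and pattern_A_neq_B: "j < r \<Longrightarrow> j' < r \<Longrightarrow> A j \<noteq> B j'"
    and ident: "j < m \<Longrightarrow> d = 1 \<or> d = - 1 \<Longrightarrow> 3 * int j + d = 3 * int (\<eta> j) + \<epsilon> * d \<or>
      (\<exists>i<r. {3 * int j + d, 3 * int (\<eta> j) + \<epsilon> * d} = {A i, B i})"
begin

text \<open>The partner of a point \<open>z\<close> of circle \<open>j\<close>. As \<open>Im\<close>
  is negated for both values of \<open>\<epsilon>\<close>, the upper half of a circle is glued to
  the lower half of its partner.\<close>

definition flip :: "nat \<Rightarrow> complex \<Rightarrow> complex" where
  "flip j z = Complex (3 * real (\<eta> j) + \<epsilon> * (Re z - 3 * real j)) (- Im z)"

definition hole :: "complex \<Rightarrow> nat" where
  "hole z = (SOME j. j < m \<and> cmod (z - hole_centre j) = 1)"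

definition circles :: "complex option set" where
  "circles = Some ` {z. \<exists>j<m. cmod (z - hole_centre j) = 1}"

definition \<iota> :: "complex option \<Rightarrow> complex option" where
  "\<iota> w = Some (flip (hole (the w)) (the w))"

definition rel :: "complex option rel" where
  "rel = {(Some (hole_centre j + u), Some (hole_centre (\<eta> j) + Complex (\<epsilon> * Re u) (- Im u))) |j u.
     j < m \<and> cmod u = 1}"

abbreviation surface :: "complex option set topology" where
  "surface \<equiv> glue (holed_sphere m) rel"

definition q :: "complex option \<Rightarrow> complex option set" where
  "q x = (rel \<union> rel\<inverse>)\<^sup>* `` {x}"

lemma Re_Im_hole_centre [simp]: "Re (hole_centre j) = 3 * real j" "Im (hole_centre j) = 0"
  by (simp_all add: hole_centre_def)

lemma cmod_hole_eq: "cmod (z - hole_centre j) = sqrt ((Re z - 3 * real j)\<^sup>2 + (Im z)\<^sup>2)"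
  by (simp add: cmod_def)

lemma abs_Re_hole: "cmod (z - hole_centre j) = 1 \<Longrightarrow> \<bar>Re z - 3 * real j\<bar> \<le> 1"
  using abs_Re_le_cmod[of "z - hole_centre j"] by simp

lemma hole_unique:
  assumes "\<bar>x - 3 * real j\<bar> \<le> 1" "\<bar>x - 3 * real j'\<bar> \<le> 1"
  shows "j = j'"
proof -
  have "\<bar>3 * real j - 3 * real j'\<bar> \<le> 2" using assms by linarith
  then have "\<bar>real_of_int (int j - int j')\<bar> < 1" by simp
  then have "\<bar>int j - int j'\<bar> < 1" by linarith
  then show ?thesis by simp
qed

lemma hole_eq: "j < m \<Longrightarrow> cmod (z - hole_centre j) = 1 \<Longrightarrow> hole z = j"
  unfolding hole_def by (rule some_equality) (auto dest!: abs_Re_hole intro: hole_unique)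

lemma eps_square: "real_of_int \<epsilon> * real_of_int \<epsilon> = 1"
  using eps by auto

lemma flip_circle:
  assumes "cmod (z - hole_centre j) = 1"
  shows "cmod (flip j z - hole_centre (\<eta> j)) = 1"
proof -
  have "(real_of_int \<epsilon> * (Re z - 3 * real j))\<^sup>2 = (Re z - 3 * real j)\<^sup>2"
    by (simp add: power_mult_distrib power2_eq_square[of "real_of_int \<epsilon>"] eps_square)
  then show ?thesis using assms by (simp add: cmod_hole_eq flip_def)
qed

lemma flip_flip: "j < m \<Longrightarrow> flip (\<eta> j) (flip j z) = z"
  using eps_square by (simp add: flip_def eta complex_eq_iff mult.assoc[symmetric])

lemma iota_Some: "j < m \<Longrightarrow> cmod (z - hole_centre j) = 1 \<Longrightarrow> \<iota> (Some z) = Some (flip j z)"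
  by (simp add: \<iota>_def hole_eq)

lemma iota_involution: "w \<in> circles \<Longrightarrow> \<iota> w \<in> circles \<and> \<iota> (\<iota> w) = w"
proof -
  assume "w \<in> circles"
  then obtain z j where w: "w = Some z" "j < m" "cmod (z - hole_centre j) = 1" by (auto simp: circles_def)
  then have "\<iota> w = Some (flip j z)" by (simp add: iota_Some)
  moreover have "\<iota> (Some (flip j z)) = Some (flip (\<eta> j) (flip j z))"
    using w eta flip_circle by (intro iota_Some) auto
  ultimately show ?thesis using w flip_circle[OF w(3)] eta flip_flip by (auto simp: circles_def)
qed

lemma rel_eq: "rel = {(w, \<iota> w) |w. w \<in> circles}"
proof -
  have flip: "hole_centre (\<eta> j) + Complex (\<epsilon> * Re u) (- Im u) = flip j (hole_centre j + u)" for j u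
    by (simp add: flip_def complex_eq_iff)
  show ?thesis
  proof (intro set_eqI iffI)
    fix x assume "x \<in> rel"
    then obtain j u where x: "x = (Some (hole_centre j + u), Some (flip j (hole_centre j + u)))" "j < m" "cmod u = 1"
      by (auto simp: rel_def flip)
    then have "\<iota> (Some (hole_centre j + u)) = Some (flip j (hole_centre j + u))" by (intro iota_Some) auto
    moreover have "Some (hole_centre j + u) \<in> circles"
      unfolding circles_def using x by (intro imageI CollectI exI[of _ j]) simp
    ultimately show "x \<in> {(w, \<iota> w) |w. w \<in> circles}" using x(1) by auto
  next
    fix x assume "x \<in> {(w, \<iota> w) |w. w \<in> circles}"
    then obtain z j where z: "x = (Some z, \<iota> (Some z))" "j < m" "cmod (z - hole_centre j) = 1"
      by (auto simp: circles_def)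
    then have "x = (Some (hole_centre j + (z - hole_centre j)), Some (flip j (hole_centre j + (z - hole_centre j))))"
      by (simp add: iota_Some)
    then show "x \<in> rel" unfolding rel_def flip using z by blast
  qed
qed

lemma rel_sym: "rel \<union> rel\<inverse> = {(w, \<iota> w) |w. w \<in> circles}"
proof -
  have "rel\<inverse> \<subseteq> rel" using iota_involution unfolding rel_eq by force
  then show ?thesis using rel_eq by blast
qed

lemma circle_outside:
  assumes "j < m" "cmod (z - hole_centre j) = 1" "j' < m"
  shows "1 \<le> cmod (z - hole_centre j')"
proof (rule ccontr)
  assume less: "\<not> 1 \<le> cmod (z - hole_centre j')"
  then have "\<bar>Re z - 3 * real j'\<bar> \<le> 1" using abs_Re_le_cmod[of "z - hole_centre j'"] by simp
  then have "j = j'" using abs_Re_hole[OF assms(2)] hole_unique by blast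
  then show False using assms less by simp
qed

lemma circles_subset: "circles \<subseteq> topspace (holed_sphere m)"
  using circle_outside by (auto simp: circles_def topspace_holed_sphere)

lemma closedin_iota:
  assumes "closedin (holed_sphere m) K"
  shows "closedin (holed_sphere m) (\<iota> ` (K \<inter> circles))"
proof -
  define Z where "Z j = flip j ` {z. Some z \<in> K \<and> cmod (z - hole_centre j) = 1}" for j
  have "\<iota> ` (K \<inter> circles) = (\<Union>j<m. Some ` Z j)"
  proof (intro set_eqI iffI)
    fix w assume "w \<in> \<iota> ` (K \<inter> circles)"
    then obtain z j where z: "Some z \<in> K" "w = \<iota> (Some z)" "j < m" "cmod (z - hole_centre j) = 1"
      by (auto simp: circles_def)
    then have "w = Some (flip j z)" by (simp add: iota_Some)
    moreover have "flip j z \<in> Z j" unfolding Z_def using z by blast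
    ultimately show "w \<in> (\<Union>j<m. Some ` Z j)" using z(3) by blast
  next
    fix w assume "w \<in> (\<Union>j<m. Some ` Z j)"
    then obtain z j where z: "w = Some (flip j z)" "Some z \<in> K" "j < m" "cmod (z - hole_centre j) = 1"
      by (auto simp: Z_def)
    then have "w = \<iota> (Some z)" by (simp add: iota_Some)
    moreover have "Some z \<in> circles" using z by (auto simp: circles_def)
    ultimately show "w \<in> \<iota> ` (K \<inter> circles)" using z by blast
  qed
  moreover have "closedin (holed_sphere m) (\<Union>j<m. Some ` Z j)"
  proof (rule closedin_Union)
    fix T assume "T \<in> (\<lambda>j. Some ` Z j) ` {..<m}"
    then obtain j where j: "j < m" "T = Some ` Z j" by auto
    have "continuous_on UNIV (flip j)"
      unfolding flip_def Complex_eq by (intro continuous_intros)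
    moreover have "{z. Some z \<in> K \<and> cmod (z - hole_centre j) = 1} = {z. Some z \<in> K} \<inter> sphere (hole_centre j) 1"
      by (auto simp: dist_norm norm_minus_commute)
    ultimately have "compact (Z j)" unfolding Z_def
      using closed_Some_preimage(1)[OF assms]
      by (metis closed_Int_compact compact_continuous_image compact_sphere continuous_on_subset subset_UNIV)
    moreover have "1 \<le> cmod (z - hole_centre j')" if "z \<in> Z j" "j' < m" for z j'
    proof -
      obtain z' where "z = flip j z'" "cmod (z' - hole_centre j) = 1"
        using \<open>z \<in> Z j\<close> by (auto simp: Z_def)
      then show ?thesis using flip_circle eta(1)[OF j(1)] \<open>j' < m\<close> circle_outside by blast
    qed
    ultimately show "closedin (holed_sphere m) T" unfolding j(2) by (rule closedin_holed_sphere_Some)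
  qed simp
  ultimately show ?thesis by simp
qed

lemmas glue_facts = glue_involution[OF rel_sym iota_involution circles_subset closedin_iota, folded q_def]

lemma q_eq_iff: "q x = q y \<longleftrightarrow> x = y \<or> (x \<in> circles \<and> y = \<iota> x)"
  using glue_facts(4)[of x y] by (simp add: q_def)

lemma topspace_surface: "topspace surface = q ` topspace (holed_sphere m)"
  using glue_facts(1) by (simp add: q_def)

lemma closedin_q_image: "closedin (holed_sphere m) K \<Longrightarrow> closedin surface (q ` K)"
  using glue_facts(3) by (simp add: closed_map_def q_def)

lemma closedin_q_preimage:
  "closedin surface K \<Longrightarrow> closedin (holed_sphere m) {w \<in> topspace (holed_sphere m). q w \<in> K}"
  using glue_facts(2) by (auto simp: q_def dest: closedin_continuous_map_preimage)

lemma Hausdorff_surface: "Hausdorff_space surface"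
  by (rule glue_involution_Hausdorff[OF compact_Hausdorff_holed_sphere rel_sym iota_involution circles_subset closedin_iota])

end

section \<open>Tilings of surfaces\<close>

context surface_pattern
begin

text \<open>The height of the holes over the point \<open>x\<close> of the real axis. The discs lie
  over disjoint intervals, so at most one summand is nonzero.\<close>

definition profile :: "real \<Rightarrow> real" where
  "profile x = (\<Sum>j<m. sqrt (max 0 (1 - (x - 3 * real j)\<^sup>2)))"

lemma profile_nonneg: "0 \<le> profile x"
  unfolding profile_def by (intro sum_nonneg) auto

lemma profile_le: "profile x \<le> real m"
proof -
  have "sqrt (max 0 (1 - (x - 3 * real j)\<^sup>2)) \<le> 1" for j by simp
  then have "profile x \<le> (\<Sum>j<m. 1)" unfolding profile_def by (intro sum_mono) auto
  then show ?thesis by simp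
qed

lemma continuous_profile: "continuous_on S profile"
  unfolding profile_def by (intro continuous_intros)

lemma profile_arc:
  assumes "j < m" "\<bar>x - 3 * real j\<bar> \<le> 1"
  shows "profile x = sqrt (1 - (x - 3 * real j)\<^sup>2)"
proof -
  have "(x - 3 * real j)\<^sup>2 \<le> 1" using assms(2) abs_le_square_iff[of "x - 3 * real j" 1] by simp
  moreover have "sqrt (max 0 (1 - (x - 3 * real j')\<^sup>2)) = 0" if "j' \<noteq> j" for j'
  proof -
    have "\<not> \<bar>x - 3 * real j'\<bar> \<le> 1" using hole_unique[OF assms(2)] that by blast
    then have "1 \<le> (x - 3 * real j')\<^sup>2" using abs_le_square_iff[of 1 "x - 3 * real j'"] by simp
    then show ?thesis by simp
  qed
  ultimately show ?thesis
    unfolding profile_def using assms(1) by (subst sum.remove[of _ j]) (auto simp: max_def)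
qed

lemma profile_flat:
  assumes "\<And>j. j < m \<Longrightarrow> 1 \<le> \<bar>x - 3 * real j\<bar>"
  shows "profile x = 0"
proof -
  have "1 \<le> (x - 3 * real j)\<^sup>2" if "j < m" for j
    using assms[OF that] abs_le_square_iff[of 1 "x - 3 * real j"] by simp
  then show ?thesis unfolding profile_def by (intro sum.neutral) auto
qed

lemma profile_zero: "profile x = 0 \<Longrightarrow> j < m \<Longrightarrow> 1 \<le> \<bar>x - 3 * real j\<bar>"
proof (rule ccontr)
  assume p: "profile x = 0" and j: "j < m" and "\<not> 1 \<le> \<bar>x - 3 * real j\<bar>"
  then have less: "\<bar>x - 3 * real j\<bar> < 1" by simp
  then have "sqrt (1 - (x - 3 * real j)\<^sup>2) = 0" using profile_arc[OF j, of x] p by simp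
  then have "(x - 3 * real j)\<^sup>2 = 1" by simp
  then show False using less by (simp add: abs_square_eq_1)
qed

text \<open>Over a disc the bound is the equation of its circle, elsewhere it is trivial. This makes
  \<open>\<bar>Im z\<bar> - profile (Re z)\<close> a non-negative vertical coordinate on the holed
  plane, zero exactly on the circles and on the real axis outside the holes.\<close>

lemma outside_iff: "(\<forall>j<m. 1 \<le> cmod (z - hole_centre j)) \<longleftrightarrow> profile (Re z) \<le> \<bar>Im z\<bar>"
proof -
  have *: "1 \<le> cmod (z - hole_centre j) \<longleftrightarrow> 1 - (Re z - 3 * real j)\<^sup>2 \<le> \<bar>Im z\<bar>\<^sup>2" for j
    unfolding cmod_hole_eq by (auto simp: algebra_simps)
  show ?thesis
  proof
    assume out: "\<forall>j<m. 1 \<le> cmod (z - hole_centre j)"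
    show "profile (Re z) \<le> \<bar>Im z\<bar>"
    proof (cases "\<exists>j<m. \<bar>Re z - 3 * real j\<bar> \<le> 1")
      case True
      then obtain j where j: "j < m" "\<bar>Re z - 3 * real j\<bar> \<le> 1" by blast
      then show ?thesis using out * profile_arc[OF j] by (auto intro: real_le_lsqrt)
    next
      case False
      then have "profile (Re z) = 0" by (intro profile_flat) force
      then show ?thesis by simp
    qed
  next
    assume p: "profile (Re z) \<le> \<bar>Im z\<bar>"
    show "\<forall>j<m. 1 \<le> cmod (z - hole_centre j)"
    proof (intro allI impI)
      fix j assume "j < m"
      show "1 \<le> cmod (z - hole_centre j)"
      proof (cases "\<bar>Re z - 3 * real j\<bar> \<le> 1")
        case True
        then have "sqrt (1 - (Re z - 3 * real j)\<^sup>2) \<le> \<bar>Im z\<bar>" using p profile_arc[OF \<open>j < m\<close>] by simp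
        then have "1 - (Re z - 3 * real j)\<^sup>2 \<le> \<bar>Im z\<bar>\<^sup>2" by (rule sqrt_le_D)
        then show ?thesis using * by blast
      next
        case False
        then show ?thesis using abs_Re_le_cmod[of "z - hole_centre j"] by simp
      qed
    qed
  qed
qed

lemma profile_circle:
  assumes "j < m" "cmod (z - hole_centre j) = 1"
  shows "profile (Re z) = \<bar>Im z\<bar>"
proof -
  have "(Re z - 3 * real j)\<^sup>2 + (Im z)\<^sup>2 = 1" using assms(2) unfolding cmod_hole_eq by simp
  then have "1 - (Re z - 3 * real j)\<^sup>2 = (Im z)\<^sup>2" by simp
  then show ?thesis using profile_arc[OF assms(1) abs_Re_hole[OF assms(2)]] by simp
qed

lemma topspace_holed_iff: "Some z \<in> topspace (holed_sphere m) \<longleftrightarrow> profile (Re z) \<le> \<bar>Im z\<bar>"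
  unfolding outside_iff[symmetric] topspace_holed_sphere by auto

end

locale surface_grid = surface_pattern +
  fixes N :: nat
  assumes N_large: "3 * m + 3 \<le> N" and N_AB: "j < r \<Longrightarrow> \<bar>A j\<bar> < int N \<and> \<bar>B j\<bar> < int N"
begin

text \<open>The index \<open>i\<close> names the left end \<open>i / N\<close> of a column. Column
  \<open>lo\<close> is unbounded and ends at \<open>(lo + 1) / N = - N\<close>, column
  \<open>hi\<close> begins at \<open>N\<close>; this is why the range is not symmetric.\<close>

definition lo :: int where "lo = - (int N * int N) - 1"

definition hi :: int where "hi = int N * int N"

definition K :: nat where "K = N * N"

text \<open>Grid points within the horizontal extent of hole \<open>j\<close>, ends included.
  Centres and radii are integers, so the ends of an arc are grid points for every
  \<open>N\<close>.\<close>

definition on_arc :: "nat \<Rightarrow> int \<Rightarrow> bool" where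
  "on_arc j p \<longleftrightarrow> j < m \<and> (3 * int j - 1) * int N \<le> p \<and> p \<le> (3 * int j + 1) * int N"

text \<open>The real part of \<open>flip\<close> in grid units: the lower corner \<open>p\<close> is
  glued to the upper corner \<open>\<rho> p\<close>.\<close>

definition \<rho> :: "int \<Rightarrow> int" where
  "\<rho> p = (if \<exists>j. on_arc j p then (let j = SOME j. on_arc j p in 3 * int (\<eta> j) * int N + \<epsilon> * (p - 3 * int j * int N)) else p)"

text \<open>Every corner is named after an upper one: lower corners are first carried up by
  \<open>\<rho>\<close>, then \<open>A j\<close> represents the pair of \<open>A j\<close> and
  \<open>B j\<close>.\<close>

definition \<kappa> :: "bool \<Rightarrow> int \<Rightarrow> int" where
  "\<kappa> \<sigma> p = (let p' = if \<sigma> then p else \<rho> p in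
     if \<exists>j<r. p' = B j * int N then A (SOME j. j < r \<and> p' = B j * int N) * int N else p')"

text \<open>The same gluing on columns. For \<open>\<epsilon> = - 1\<close> an interval is reversed,
  and its new left end comes from \<open>i + 1\<close>; hence the \<open>- 1\<close>.\<close>

definition \<tau> :: "int \<Rightarrow> int" where
  "\<tau> i = (if \<exists>j. on_arc j i \<and> on_arc j (i + 1) then (let j = SOME j. on_arc j i \<and> on_arc j (i + 1) in
      3 * int (\<eta> j) * int N + (if \<epsilon> = 1 then i - 3 * int j * int N else 3 * int j * int N - i - 1)) else i)"

lemma N_pos: "0 < N" using N_large by simp

lemma on_arc_unique: "on_arc j p \<Longrightarrow> on_arc j' p \<Longrightarrow> j = j'"
proof (rule ccontr)
  assume a: "on_arc j p" "on_arc j' p" "j \<noteq> j'"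
  have "False" if "on_arc j p" "on_arc j' p" "j < j'" for j j'
  proof -
    have "3 * int j + 1 < 3 * int j' - 1" using that(3) by simp
    then have "(3 * int j + 1) * int N < (3 * int j' - 1) * int N" using N_pos by simp
    then show False using that by (auto simp: on_arc_def)
  qed
  then show False using a by (metis linorder_neqE_nat)
qed

lemma rho_arc: "on_arc j p \<Longrightarrow> \<rho> p = 3 * int (\<eta> j) * int N + \<epsilon> * (p - 3 * int j * int N)"
proof -
  assume a: "on_arc j p"
  then have "(SOME j. on_arc j p) = j" using on_arc_unique by (intro some_equality) auto
  then show ?thesis using a by (auto simp: \<rho>_def Let_def)
qed

lemma rho_flat: "\<nexists>j. on_arc j p \<Longrightarrow> \<rho> p = p"
  by (simp add: \<rho>_def)

lemma tau_arc: "on_arc j i \<Longrightarrow> on_arc j (i + 1) \<Longrightarrow>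
    \<tau> i = 3 * int (\<eta> j) * int N + (if \<epsilon> = 1 then i - 3 * int j * int N else 3 * int j * int N - i - 1)"
proof -
  assume a: "on_arc j i" "on_arc j (i + 1)"
  then have "(SOME j. on_arc j i \<and> on_arc j (i + 1)) = j" using on_arc_unique by (intro some_equality) auto
  then show ?thesis using a by (auto simp: \<tau>_def Let_def)
qed

lemma tau_flat: "\<nexists>j. on_arc j i \<and> on_arc j (i + 1) \<Longrightarrow> \<tau> i = i"
  by (simp only: \<tau>_def if_False)

lemma tau_arc_on_arc:
  assumes "on_arc j i" "on_arc j (i + 1)"
  shows "on_arc (\<eta> j) (\<tau> i)" "on_arc (\<eta> j) (\<tau> i + 1)"
  using assms eta(1)[of j] unfolding tau_arc[OF assms] on_arc_def by (auto simp: algebra_simps)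

lemma tau_tau: "\<tau> (\<tau> i) = i"
proof (cases "\<exists>j. on_arc j i \<and> on_arc j (i + 1)")
  case True
  then obtain j where j: "on_arc j i" "on_arc j (i + 1)" by blast
  then have "j < m" by (simp add: on_arc_def)
  then show ?thesis
    using tau_arc[OF j] tau_arc[OF tau_arc_on_arc[OF j]] eps eta(2)[OF \<open>j < m\<close>] by auto
next
  case False
  then show ?thesis using tau_flat by simp
qed

lemma on_arc_range: "on_arc j p \<Longrightarrow> lo < p \<and> p < hi"
proof -
  assume a: "on_arc j p"
  then have "3 * int j + 1 \<le> 3 * int m" "- 1 \<le> 3 * int j - 1" by (auto simp: on_arc_def)
  then have "3 * int j + 1 < int N" "- int N \<le> 3 * int j - 1" using N_large by auto
  then have "(3 * int j + 1) * int N < int N * int N" "- (int N * int N) \<le> (3 * int j - 1) * int N"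
    using N_pos mult_right_mono[of "- int N" "3 * int j - 1" "int N"] by auto
  then show ?thesis using a by (auto simp: on_arc_def lo_def hi_def)
qed

lemma tau_in_range: "lo \<le> i \<Longrightarrow> i \<le> hi \<Longrightarrow> lo \<le> \<tau> i \<and> \<tau> i \<le> hi"
  using tau_flat[of i] tau_arc_on_arc(1)[of _ i] on_arc_range by (metis less_imp_le)

lemma kappa_True_B: "j < r \<Longrightarrow> \<kappa> True (B j * int N) = A j * int N"
proof -
  assume j: "j < r"
  have some: "(SOME j'. j' < r \<and> B j * int N = B j' * int N) = j"
    using j N_pos pattern_inj_B by (intro some_equality) (auto dest: inj_onD)
  show ?thesis unfolding \<kappa>_def Let_def if_True some using j by auto
qed

lemma kappa_True_other: "p \<notin> (\<lambda>j. B j * int N) ` {..<r} \<Longrightarrow> \<kappa> True p = p"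
  by (auto simp: \<kappa>_def)

lemma kappa_True_A: "j < r \<Longrightarrow> \<kappa> True (A j * int N) = A j * int N"
  using pattern_A_neq_B N_pos by (intro kappa_True_other) auto

lemma kappa_False: "\<kappa> False p = \<kappa> True (\<rho> p)"
  by (simp add: \<kappa>_def)

text \<open>At a real point of a circle the upper and the lower arc meet, so the lower corner there
  is both the upper corner \<open>p\<close> and glued to the upper corner \<open>\<rho> p\<close>.
  By \<open>ident\<close> the two are equal or form a pair, and \<open>\<kappa>\<close> merges
  pairs.\<close>

lemma kappa_endpoint:
  assumes "j < m" "d = 1 \<or> d = - 1"
  shows "\<kappa> True (\<rho> ((3 * int j + d) * int N)) = \<kappa> True ((3 * int j + d) * int N)"
proof -
  have "on_arc j ((3 * int j + d) * int N)"
    using assms N_pos by (auto simp: on_arc_def algebra_simps)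
  then have rho: "\<rho> ((3 * int j + d) * int N) = (3 * int (\<eta> j) + \<epsilon> * d) * int N"
    by (simp add: rho_arc algebra_simps)
  have AB: "\<kappa> True (A i * int N) = \<kappa> True (B i * int N)" if "i < r" for i
    using kappa_True_A[OF that] kappa_True_B[OF that] by simp
  from ident[OF assms] show ?thesis
  proof
    assume "3 * int j + d = 3 * int (\<eta> j) + \<epsilon> * d"
    then show ?thesis unfolding rho by simp
  next
    assume "\<exists>i<r. {3 * int j + d, 3 * int (\<eta> j) + \<epsilon> * d} = {A i, B i}"
    then obtain i where "i < r" "{3 * int j + d, 3 * int (\<eta> j) + \<epsilon> * d} = {A i, B i}" by blast
    then show ?thesis unfolding rho using AB[of i] by (auto simp: doubleton_eq_iff)
  qed
qed

text \<open>An end of a flat column is either on no arc, where \<open>\<rho>\<close> is the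
  identity, or an end point of an arc, where \<open>kappa_endpoint\<close> applies.\<close>

lemma kappa_flat_corner:
  assumes flat: "\<nexists>j. on_arc j i \<and> on_arc j (i + 1)" and p: "p = i \<or> p = i + 1"
  shows "\<kappa> False p = \<kappa> True p"
proof (cases "\<exists>j. on_arc j p")
  case True
  then obtain j where j: "on_arc j p" by blast
  then have "j < m" by (simp add: on_arc_def)
  have "p = (3 * int j + 1) * int N \<or> p = (3 * int j + - 1) * int N"
  proof -
    have "\<not> (on_arc j i \<and> on_arc j (i + 1))" using flat by blast
    then show ?thesis using j p by (auto simp: on_arc_def)
  qed
  then show ?thesis using kappa_endpoint[OF \<open>j < m\<close>] by (metis kappa_False)
qed (simp add: kappa_False rho_flat)

lemma rho_tau:
  assumes "on_arc j i" "on_arc j (i + 1)"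
  shows "{\<rho> (\<tau> i), \<rho> (\<tau> i + 1)} = {i, i + 1}"
proof -
  have "j < m" using assms by (simp add: on_arc_def)
  note arc = tau_arc_on_arc[OF assms]
  have "\<rho> (\<tau> i) = i \<and> \<rho> (\<tau> i + 1) = i + 1 \<or> \<rho> (\<tau> i) = i + 1 \<and> \<rho> (\<tau> i + 1) = i"
    using rho_arc[OF arc(1)] rho_arc[OF arc(2)] eta(2)[OF \<open>j < m\<close>] tau_arc[OF assms] eps by auto
  then show ?thesis by (auto simp: insert_commute)
qed

sublocale glued_grid lo hi K \<tau> \<kappa> r "\<lambda>j. A j * int N" "\<lambda>j. B j * int N"
proof
  have "0 \<le> int N * int N" by simp
  then show "lo \<le> hi" unfolding lo_def hi_def by linarith
  show "bij_betw \<tau> {lo..hi} {lo..hi}"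
    by (rule bij_betw_byWitness[of _ \<tau>]) (use tau_tau tau_in_range in auto)
  show "\<kappa> True (A j * int N) = A j * int N" "\<kappa> True (B j * int N) = A j * int N" if "j < r" for j
    using kappa_True_A[OF that] kappa_True_B[OF that] by auto
  show "\<kappa> True p = p" if "p \<notin> (\<lambda>j. A j * int N) ` {..<r}" "p \<notin> (\<lambda>j. B j * int N) ` {..<r}" for p
    using kappa_True_other that by blast
  show "lo < A j * int N \<and> A j * int N < B j * int N \<and> B j * int N \<le> hi" if "j < r" for j
  proof -
    have "- int N \<le> A j" "B j \<le> int N" using N_AB[OF that] by auto
    then have "- (int N * int N) \<le> A j * int N" "B j * int N \<le> int N * int N"
      using mult_right_mono[of "- int N" "A j" "int N"] mult_right_mono[of "B j" "int N" "int N"] by auto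
    moreover have "A j * int N < B j * int N" using pattern_A_less_B[OF that] N_pos by simp
    ultimately show ?thesis unfolding lo_def hi_def by linarith
  qed
  show "inj_on (\<lambda>j. A j * int N) {..<r}" "inj_on (\<lambda>j. B j * int N) {..<r}"
    using pattern_inj_A pattern_inj_B N_pos by (auto simp: inj_on_def)
  show "A j * int N \<noteq> B j' * int N" if "j < r" "j' < r" for j j'
    using pattern_A_neq_B[OF that] N_pos by simp
  show "let c = \<lambda>\<sigma> p. if p \<le> lo \<or> hi < p then None else Some (\<kappa> \<sigma> p)
       in {c False (\<tau> i), c False (\<tau> i + 1)} = {c True i, c True (i + 1)}" if i: "lo \<le> i" "i \<le> hi" for i
  proof (cases "\<exists>j. on_arc j i \<and> on_arc j (i + 1)")
    case True
    then obtain j where j: "on_arc j i" "on_arc j (i + 1)" by blast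
    note arc = tau_arc_on_arc[OF j]
    have in_range: "\<not> (p \<le> lo \<or> hi < p)" if "on_arc j' p" for j' p using on_arc_range[OF that] by auto
    have "{\<kappa> False (\<tau> i), \<kappa> False (\<tau> i + 1)} = \<kappa> True ` {\<rho> (\<tau> i), \<rho> (\<tau> i + 1)}" by (simp add: kappa_False)
    also have "\<dots> = {\<kappa> True i, \<kappa> True (i + 1)}" unfolding rho_tau[OF j] by simp
    finally have "Some ` {\<kappa> False (\<tau> i), \<kappa> False (\<tau> i + 1)} = Some ` {\<kappa> True i, \<kappa> True (i + 1)}" by simp
    then show ?thesis
      unfolding Let_def using in_range[OF arc(1)] in_range[OF arc(2)] in_range[OF j(1)] in_range[OF j(2)]
      by (simp only: if_False image_insert image_empty)
  next
    case False
    then show ?thesis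
      using kappa_flat_corner[OF False, of i] kappa_flat_corner[OF False, of "i + 1"] tau_flat[OF False]
      by (simp add: Let_def)
  qed
qed

section \<open>The tiles as sets of points\<close>

abbreviation sgn_of :: "bool \<Rightarrow> real" where
  "sgn_of \<sigma> \<equiv> (if \<sigma> then 1 else - 1)"

definition column :: "int \<Rightarrow> real \<Rightarrow> bool" where
  "column i x \<longleftrightarrow> (lo < i \<longrightarrow> real_of_int i / N \<le> x) \<and> (i < hi \<longrightarrow> x \<le> (real_of_int i + 1) / N)"

definition row :: "nat \<Rightarrow> real \<Rightarrow> bool" where
  "row k y \<longleftrightarrow> real k / N \<le> y \<and> (k < K \<longrightarrow> y \<le> (real k + 1) / N)"

text \<open>The preimage of a square under the map that straightens one half of the holed plane; at
  the border the square becomes a strip or a quadrant.\<close>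

definition cell :: "bool \<times> int \<times> nat \<Rightarrow> complex set" where
  "cell x = (case x of (\<sigma>, i, k) \<Rightarrow> {z. column i (Re z) \<and> row k (sgn_of \<sigma> * Im z - profile (Re z))})"

definition border :: "bool \<times> int \<times> nat \<Rightarrow> bool" where
  "border x \<longleftrightarrow> (case x of (\<sigma>, i, k) \<Rightarrow> i = lo \<or> i = hi \<or> k = K)"

definition tile0 :: "bool \<times> int \<times> nat \<Rightarrow> complex option set" where
  "tile0 x = Some ` cell x \<union> (if border x then {None} else {})"

definition tile :: "bool \<times> int \<times> nat \<Rightarrow> complex option set set" where
  "tile x = q ` tile0 x"

lemma N_real_pos: "0 < real N" using N_pos by simp

lemma column_ex: "\<exists>i. lo \<le> i \<and> i \<le> hi \<and> column i x"
proof -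
  consider "x \<le> - real N" | "real N \<le> x" | "- real N < x" "x < real N" by linarith
  then show ?thesis
  proof cases
    case 1
    have "(real_of_int lo + 1) / N = - real N" using N_real_pos by (simp add: lo_def field_simps)
    then have "column lo x" using 1 by (simp add: column_def)
    then show ?thesis using lo_le_hi by blast
  next
    case 2
    have "real_of_int hi / N = real N" using N_real_pos by (simp add: hi_def)
    then have "column hi x" using 2 by (simp add: column_def)
    then show ?thesis using lo_le_hi by blast
  next
    case 3
    define i where "i = \<lfloor>x * N\<rfloor>"
    have i: "real_of_int i \<le> x * N" "x * N < real_of_int i + 1" unfolding i_def by linarith+
    then have "column i x" using N_real_pos by (simp add: column_def field_simps)
    moreover have "x * N < real N * N" "- real N * N < x * N"
      using mult_strict_right_mono[OF 3(2) N_real_pos] mult_strict_right_mono[OF 3(1) N_real_pos] .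
    then have "real_of_int i < real_of_int hi" "real_of_int lo < real_of_int i"
      using i unfolding lo_def hi_def by auto
    then have "lo < i" "i < hi" by (simp_all only: of_int_less_iff)
    ultimately show ?thesis by (intro exI[of _ i]) auto
  qed
qed

lemma row_ex: "0 \<le> y \<Longrightarrow> \<exists>k\<le>K. row k y"
proof (cases "y < real N")
  case True
  assume "0 \<le> y"
  define k where "k = nat \<lfloor>y * N\<rfloor>"
  have "0 \<le> y * N" using \<open>0 \<le> y\<close> by simp
  then have k: "real k \<le> y * N" "y * N < real k + 1" unfolding k_def by linarith+
  then have "row k y" using N_real_pos by (simp add: row_def field_simps)
  moreover have "y * N < real N * N" using True N_real_pos by simp
  then have "real k < real K" using k by (simp add: K_def)
  then have "k \<le> K" by (simp only: of_nat_less_iff less_imp_le)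
  ultimately show ?thesis by blast
next
  case False
  then have "row K y" using N_real_pos by (simp add: row_def K_def)
  then show ?thesis by blast
qed

lemma column_next: "column i x \<Longrightarrow> column i' x \<Longrightarrow> lo \<le> i \<Longrightarrow> i' \<le> hi \<Longrightarrow> i < i' \<Longrightarrow> i' = i + 1"
proof -
  assume a: "column i x" "column i' x" "lo \<le> i" "i' \<le> hi" "i < i'"
  then have "real_of_int i' / N \<le> (real_of_int i + 1) / N" by (auto simp: column_def)
  then have "real_of_int i' \<le> real_of_int i + 1" using N_real_pos by (simp add: divide_le_cancel)
  then show ?thesis using a by linarith
qed

lemma row_next: "row k y \<Longrightarrow> row k' y \<Longrightarrow> k' \<le> K \<Longrightarrow> k < k' \<Longrightarrow> k' = k + 1"
proof -
  assume a: "row k y" "row k' y" "k' \<le> K" "k < k'"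
  then have "real k' / N \<le> (real k + 1) / N" by (auto simp: row_def)
  then have "real k' \<le> real k + 1" using N_real_pos by (simp add: divide_le_cancel)
  then show ?thesis using a by linarith
qed

lemma row_nonneg: "row k y \<Longrightarrow> 0 \<le> y"
  using N_real_pos by (meson row_def divide_nonneg_pos of_nat_0_le_iff order_trans)

lemma row_0: "row k 0 \<Longrightarrow> k = 0"
  using N_real_pos by (simp add: row_def divide_le_0_iff)

lemma row_0_0: "row 0 0"
  by (simp add: row_def)

lemma adj_edge: "y \<in> Y \<Longrightarrow> s y \<in> S \<Longrightarrow> t y \<in> S \<Longrightarrow> (s y, t y) \<in> adj S"
  by (auto simp: adj_def)

lemma adj_VE:
  assumes "(\<sigma>, i, k) \<in> S" "(\<sigma>, i + 1, k) \<in> S" "S \<subseteq> X"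
  shows "((\<sigma>, i, k), (\<sigma>, i + 1, k)) \<in> adj S"
proof -
  have "(\<sigma>, i, k) \<in> X" "(\<sigma>, i + 1, k) \<in> X" using assms by blast+
  then show ?thesis using adj_edge[of "VE \<sigma> (i + 1) k" S] assms by (simp add: X_def)
qed

lemma adj_HE:
  assumes "(\<sigma>, i, k) \<in> S" "(\<sigma>, i, k + 1) \<in> S" "S \<subseteq> X"
  shows "((\<sigma>, i, k), (\<sigma>, i, k + 1)) \<in> adj S"
proof -
  have "(\<sigma>, i, k) \<in> X" "(\<sigma>, i, k + 1) \<in> X" using assms by blast+
  then show ?thesis using adj_edge[of "HE \<sigma> i (k + 1)" S] assms by (simp add: X_def)
qed

lemma adj_GE:
  assumes "(True, i, 0) \<in> S" "(False, \<tau> i, 0) \<in> S" "S \<subseteq> X"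
  shows "((True, i, 0), (False, \<tau> i, 0)) \<in> adj S"
proof -
  have "(True, i, 0) \<in> X" using assms by blast
  then show ?thesis using adj_edge[of "GE i" S] assms by (simp add: X_def)
qed

lemma column_move:
  assumes "column i x" "column i' x" "(\<sigma>, i, k) \<in> S" "(\<sigma>, i', k) \<in> S" "S \<subseteq> X"
  shows "((\<sigma>, i, k), (\<sigma>, i', k)) \<in> (adj S)\<^sup>*"
proof -
  have r: "lo \<le> i" "i \<le> hi" "lo \<le> i'" "i' \<le> hi" using assms(3-5) by (auto simp: X_def)
  consider "i = i'" | "i < i'" | "i' < i" by linarith
  then show ?thesis
  proof cases
    case 2
    then have "i' = i + 1" using column_next assms(1,2) r by blast
    then show ?thesis using adj_VE[of \<sigma> i k S] assms by auto
  next
    case 3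
    then have "i = i' + 1" using column_next assms(1,2) r by blast
    then show ?thesis using adj_VE[of \<sigma> i' k S] assms by (auto intro!: sym_rtrancl_adj[of "(\<sigma>, i', k)"])
  qed simp
qed

lemma row_move:
  assumes "row k y" "row k' y" "(\<sigma>, i, k) \<in> S" "(\<sigma>, i, k') \<in> S" "S \<subseteq> X"
  shows "((\<sigma>, i, k), (\<sigma>, i, k')) \<in> (adj S)\<^sup>*"
proof -
  have r: "k \<le> K" "k' \<le> K" using assms(3-5) by (auto simp: X_def)
  consider "k = k'" | "k < k'" | "k' < k" by linarith
  then show ?thesis
  proof cases
    case 2
    then have "k' = k + 1" using row_next assms(1,2) r by blast
    then show ?thesis using adj_HE[of \<sigma> i k S] assms by auto
  next
    case 3
    then have "k = k' + 1" using row_next assms(1,2) r by blast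
    then show ?thesis using adj_HE[of \<sigma> i k' S] assms by (auto intro!: sym_rtrancl_adj[of "(\<sigma>, i, k')"])
  qed simp
qed

text \<open>Supplies a passage between the halves at a real point outside the open holes. If the
  column found first lies under an arc, the point must be an end of that arc, and the column just
  beyond this end is flat.\<close>

lemma flat_column_ex:
  assumes "profile x = 0"
  shows "\<exists>i. lo \<le> i \<and> i \<le> hi \<and> column i x \<and> \<tau> i = i"
proof -
  obtain i where i: "lo \<le> i" "i \<le> hi" "column i x" using column_ex by blast
  show ?thesis
  proof (cases "\<exists>j. on_arc j i \<and> on_arc j (i + 1)")
    case False
    then show ?thesis using i tau_flat[OF False] by blast
  next
    case True
    then obtain j where j: "on_arc j i" "on_arc j (i + 1)" by blast
    then have jm: "j < m" by (simp add: on_arc_def)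
    have "lo < i" "i + 1 < hi" using on_arc_range[OF j(1)] on_arc_range[OF j(2)] by auto
    then have x: "real_of_int i / N \<le> x" "x \<le> (real_of_int i + 1) / N" using i by (auto simp: column_def)
    have "real_of_int ((3 * int j - 1) * int N) \<le> real_of_int i" "real_of_int (i + 1) \<le> real_of_int ((3 * int j + 1) * int N)"
      using j unfolding on_arc_def by (simp_all only: of_int_le_iff)
    then have "3 * real j - 1 \<le> real_of_int i / N" "(real_of_int i + 1) / N \<le> 3 * real j + 1"
      using N_real_pos by (simp_all add: field_simps)
    then have "3 * real j - 1 \<le> x" "x \<le> 3 * real j + 1" using x by linarith+
    moreover have "1 \<le> \<bar>x - 3 * real j\<bar>" by (rule profile_zero[OF assms jm])
    ultimately consider "x = 3 * real j - 1" | "x = 3 * real j + 1" by linarith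
    then show ?thesis
    proof cases
      case 1
      define i' where "i' = (3 * int j - 1) * int N - 1"
      have arc: "on_arc j (i' + 1)" using jm N_pos by (simp add: on_arc_def i'_def algebra_simps)
      have "\<not> on_arc j i'" by (simp add: on_arc_def i'_def)
      then have "\<tau> i' = i'" using arc on_arc_unique by (intro tau_flat) blast
      moreover have "lo \<le> i'" "i' \<le> hi" using on_arc_range[OF arc] by auto
      moreover have "column i' x"
        using N_real_pos unfolding column_def 1 i'_def by (simp add: field_simps)
      ultimately show ?thesis by blast
    next
      case 2
      define i' where "i' = (3 * int j + 1) * int N"
      have arc: "on_arc j i'" using jm N_pos by (simp add: on_arc_def i'_def algebra_simps)
      have "\<not> on_arc j (i' + 1)" by (simp add: on_arc_def i'_def)
      then have "\<tau> i' = i'" using arc on_arc_unique by (intro tau_flat) blast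
      moreover have "lo \<le> i'" "i' \<le> hi" using on_arc_range[OF arc] by auto
      moreover have "column i' x"
        using N_real_pos unfolding column_def 2 i'_def by (simp add: field_simps)
      ultimately show ?thesis by blast
    qed
  qed
qed

section \<open>The tiles around a point, before and after gluing\<close>

definition at_point :: "complex option \<Rightarrow> (bool \<times> int \<times> nat) set" where
  "at_point w = {x\<in>X. w \<in> tile0 x}"

lemma at_point_X: "at_point w \<subseteq> X"
  by (auto simp: at_point_def)

lemma at_point_Some: "(\<sigma>, i, k) \<in> at_point (Some z) \<longleftrightarrow> lo \<le> i \<and> i \<le> hi \<and> k \<le> K \<and>
    column i (Re z) \<and> row k (sgn_of \<sigma> * Im z - profile (Re z))"
  unfolding at_point_def X_def tile0_def cell_def by auto

lemma at_point_None: "(\<sigma>, i, k) \<in> at_point None \<longleftrightarrow> lo \<le> i \<and> i \<le> hi \<and> k \<le> K \<and> (i = lo \<or> i = hi \<or> k = K)"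
  unfolding at_point_def X_def tile0_def border_def by auto

text \<open>In each half the two outer columns and the top row form a connected frame; the frames
  are joined in column \<open>lo\<close>, which is flat.\<close>

lemma at_point_None_connected:
  assumes "x \<in> at_point None"
  shows "((True, lo, 0), x) \<in> (adj (at_point None))\<^sup>*"
proof -
  let ?S = "at_point None"
  obtain \<sigma> i k where x: "x = (\<sigma>, i, k)" by (cases x)
  have r: "lo \<le> i" "i \<le> hi" "k \<le> K" "i = lo \<or> i = hi \<or> k = K" using assms x by (auto simp: at_point_None)
  have up: "((\<sigma>, j, 0), (\<sigma>, j, k)) \<in> (adj ?S)\<^sup>*" if "j = lo \<or> j = hi" "k \<le> K" for j k
    using that(2)
  proof (induction k)
    case (Suc k)
    have "((\<sigma>, j, k), (\<sigma>, j, k + 1)) \<in> adj ?S"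
      using that(1) Suc.prems lo_le_hi by (intro adj_HE at_point_X) (auto simp: at_point_None)
    then show ?case using Suc by (auto intro: rtrancl_into_rtrancl)
  qed simp
  have across: "((\<sigma>, lo, K), (\<sigma>, j, K)) \<in> (adj ?S)\<^sup>*" if "lo \<le> j" "j \<le> hi" for j
    using that
  proof (induction j rule: int_ge_induct)
    case (step j)
    have "((\<sigma>, j, K), (\<sigma>, j + 1, K)) \<in> adj ?S"
      using step by (intro adj_VE at_point_X) (auto simp: at_point_None)
    then show ?case using step by (auto intro: rtrancl_into_rtrancl)
  qed simp
  have "\<tau> lo = lo"
  proof (rule tau_flat, rule notI)
    assume "\<exists>j. on_arc j lo \<and> on_arc j (lo + 1)"
    then show False using on_arc_range by blast
  qed
  then have "((True, lo, 0), (False, lo, 0)) \<in> adj ?S"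
    using adj_GE[of lo ?S] at_point_X lo_le_hi by (auto simp: at_point_None)
  then have base: "((True, lo, 0), (\<sigma>, lo, 0)) \<in> (adj ?S)\<^sup>*" by (cases \<sigma>) auto
  have top: "((\<sigma>, lo, 0), (\<sigma>, j, K)) \<in> (adj ?S)\<^sup>*" if "lo \<le> j" "j \<le> hi" for j
    using up[of lo K] across[OF that] by (auto intro: rtrancl_trans)
  consider "i = lo" | "k = K" | "i = hi" using r(4) by blast
  then have "((\<sigma>, lo, 0), x) \<in> (adj ?S)\<^sup>*"
  proof cases
    case 1
    then show ?thesis using up r x by simp
  next
    case 2
    then show ?thesis using top r x by simp
  next
    case 3
    have "((\<sigma>, hi, K), (\<sigma>, hi, 0)) \<in> (adj ?S)\<^sup>*" by (rule sym_rtrancl_adj[OF up]) simp_all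
    with top[OF lo_le_hi order_refl] have "((\<sigma>, lo, 0), (\<sigma>, hi, 0)) \<in> (adj ?S)\<^sup>*"
      by (rule rtrancl_trans)
    moreover have "((\<sigma>, hi, 0), x) \<in> (adj ?S)\<^sup>*" using up[of hi k] 3 r x by simp
    ultimately show ?thesis by (rule rtrancl_trans)
  qed
  with base show ?thesis by (rule rtrancl_trans)
qed

text \<open>Within one half, column and row can be changed one after the other, since membership
  constrains them separately. A point in tiles of both halves is real with \<open>profile\<close>
  zero, so it lies in row 0 and \<open>flat_column_ex\<close> leads across.\<close>

lemma at_point_Some_connected:
  assumes x: "x \<in> at_point (Some z)" and x': "x' \<in> at_point (Some z)"
  shows "(x, x') \<in> (adj (at_point (Some z)))\<^sup>*"
proof -
  let ?S = "at_point (Some z)"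
  obtain \<sigma> i k where xe: "x = (\<sigma>, i, k)" by (cases x)
  obtain \<sigma>' i' k' where xe': "x' = (\<sigma>', i', k')" by (cases x')
  note X = x[unfolded xe at_point_Some] and X' = x'[unfolded xe' at_point_Some]
  show ?thesis
  proof (cases "\<sigma> = \<sigma>'")
    case True
    have mid: "(\<sigma>, i', k) \<in> ?S" using X X' by (auto simp: at_point_Some)
    have "((\<sigma>, i, k), (\<sigma>, i', k)) \<in> (adj ?S)\<^sup>*"
      using X X' x xe mid by (intro column_move[of i "Re z"] at_point_X) auto
    moreover have "((\<sigma>, i', k), (\<sigma>, i', k')) \<in> (adj ?S)\<^sup>*"
      using X X' x' xe' mid True by (intro row_move[of k "sgn_of \<sigma> * Im z - profile (Re z)"] at_point_X) auto
    ultimately show ?thesis unfolding xe xe' True by (rule rtrancl_trans)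
  next
    case False
    have "0 \<le> sgn_of \<sigma> * Im z - profile (Re z)" "0 \<le> sgn_of \<sigma>' * Im z - profile (Re z)"
      using X X' row_nonneg by blast+
    then have z: "Im z = 0" "profile (Re z) = 0"
      using False profile_nonneg[of "Re z"] by (auto split: if_splits)
    then have k: "k = 0" "k' = 0" using X X' row_0 by auto
    obtain i0 where i0: "lo \<le> i0" "i0 \<le> hi" "column i0 (Re z)" "\<tau> i0 = i0"
      using flat_column_ex[OF z(2)] by blast
    have S0: "(\<sigma>'', i0, 0) \<in> ?S" for \<sigma>''
      using i0 z row_0_0 by (simp add: at_point_Some)
    have "((True, i0, 0), (False, i0, 0)) \<in> adj ?S"
      using adj_GE[of i0 ?S] S0 i0(4) at_point_X by simp
    then have "((True, i0, 0), (False, i0, 0)) \<in> (adj ?S)\<^sup>*" by blast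
    then have "((\<sigma>, i0, 0), (\<sigma>', i0, 0)) \<in> (adj ?S)\<^sup>*"
      using False sym_rtrancl_adj by (cases \<sigma>; cases \<sigma>') auto
    moreover have "((\<sigma>, i, k), (\<sigma>, i0, 0)) \<in> (adj ?S)\<^sup>*"
      unfolding k using x[unfolded xe k] X i0(3) S0 at_point_X by (intro column_move[of i "Re z"]) auto
    moreover have "((\<sigma>', i0, 0), (\<sigma>', i', k')) \<in> (adj ?S)\<^sup>*"
      unfolding k using x'[unfolded xe' k] X' i0(3) S0 at_point_X by (intro column_move[of i0 "Re z"]) auto
    ultimately show ?thesis unfolding xe xe' by (meson rtrancl_trans)
  qed
qed

lemma at_point_connected:
  assumes "x \<in> at_point w" "x' \<in> at_point w"
  shows "(x, x') \<in> (adj (at_point w))\<^sup>*"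
proof (cases w)
  case None
  then show ?thesis
    using assms at_point_None_connected sym_rtrancl_adj by (metis rtrancl_trans)
next
  case (Some z)
  then show ?thesis using assms at_point_Some_connected by simp
qed

lemma arc_column_ex:
  assumes "j < m" "\<bar>x - 3 * real j\<bar> \<le> 1"
  shows "\<exists>i. on_arc j i \<and> on_arc j (i + 1) \<and> real_of_int i / N \<le> x \<and> x \<le> (real_of_int i + 1) / N"
proof -
  have x: "(3 * real j - 1) * N \<le> x * N" "x * N \<le> (3 * real j + 1) * N"
    using assms(2) by (auto intro!: mult_right_mono)
  \<comment> \<open>At the right end of the arc the floor alone would give the column beyond the
    arc.\<close>
  define i where "i = min \<lfloor>x * N\<rfloor> ((3 * int j + 1) * int N - 1)"
  have "(3 * int j - 1) * int N \<le> \<lfloor>x * N\<rfloor>" using x(1) by (simp add: le_floor_iff)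
  moreover have "(3 * int j - 1) * int N \<le> (3 * int j + 1) * int N - 1" using N_pos by (simp add: algebra_simps)
  ultimately have i: "(3 * int j - 1) * int N \<le> i" "i \<le> (3 * int j + 1) * int N - 1" by (auto simp: i_def)
  then have "on_arc j i" "on_arc j (i + 1)" using assms(1) by (auto simp: on_arc_def)
  moreover have "real_of_int i \<le> x * N"
  proof -
    have "real_of_int i \<le> real_of_int \<lfloor>x * N\<rfloor>" by (simp add: i_def)
    then show ?thesis by linarith
  qed
  moreover have "x * N \<le> real_of_int i + 1"
  proof (cases "\<lfloor>x * N\<rfloor> \<le> (3 * int j + 1) * int N - 1")
    case True
    then have "i = \<lfloor>x * N\<rfloor>" by (simp add: i_def)
    then show ?thesis by linarith
  next
    case False
    then have "i = (3 * int j + 1) * int N - 1" by (simp add: i_def)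
    then show ?thesis using x(2) by simp
  qed
  ultimately show ?thesis using N_real_pos by (intro exI[of _ i]) (simp add: field_simps)
qed

lemma column_of_bounds: "real_of_int i / N \<le> x \<Longrightarrow> x \<le> (real_of_int i + 1) / N \<Longrightarrow> column i x"
  by (simp add: column_def)

text \<open>On real parts \<open>flip\<close> maps the interval of column \<open>i\<close> to that
  of column \<open>\<tau> i\<close>, so the two partners lie in the tiles on the two sides of
  \<open>GE i\<close>.\<close>

lemma glued_adjacent_upper:
  assumes j: "j < m" "cmod (z - hole_centre j) = 1" and "0 \<le> Im z"
  shows "\<exists>i. (True, i, 0) \<in> at_point (Some z) \<and> (False, \<tau> i, 0) \<in> at_point (Some (flip j z))"
proof -
  obtain i where i: "on_arc j i" "on_arc j (i + 1)"
    and x: "real_of_int i / N \<le> Re z" "Re z \<le> (real_of_int i + 1) / N"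
    using arc_column_ex[OF j(1) abs_Re_hole[OF j(2)]] by blast
  note arc = tau_arc_on_arc[OF i]
  have "profile (Re z) = Im z" using profile_circle[OF j] \<open>0 \<le> Im z\<close> by simp
  then have "(True, i, 0) \<in> at_point (Some z)"
    using on_arc_range[OF i(1)] column_of_bounds[OF x] row_0_0 by (simp add: at_point_Some)
  moreover have "profile (Re (flip j z)) = Im z"
    using profile_circle[OF eta(1)[OF j(1)] flip_circle[OF j(2)]] \<open>0 \<le> Im z\<close> by (simp add: flip_def)
  moreover have "column (\<tau> i) (Re (flip j z))"
  proof (rule column_of_bounds)
    have t: "real_of_int (\<tau> i) = 3 * real (\<eta> j) * N + (if \<epsilon> = 1 then i - 3 * real j * N else 3 * real j * N - i - 1)"
      by (simp add: tau_arc[OF i])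
    have x': "real_of_int i \<le> Re z * N" "Re z * N \<le> real_of_int i + 1"
      using x N_real_pos by (simp_all add: field_simps)
    have "Re (flip j z) * N = 3 * real (\<eta> j) * N + (if \<epsilon> = 1 then Re z * N - 3 * real j * N else 3 * real j * N - Re z * N)"
      using eps by (auto simp: flip_def algebra_simps)
    then have "real_of_int (\<tau> i) \<le> Re (flip j z) * N" "Re (flip j z) * N \<le> real_of_int (\<tau> i) + 1"
      using t x' by (auto split: if_splits)
    then show "real_of_int (\<tau> i) / N \<le> Re (flip j z)" "Re (flip j z) \<le> (real_of_int (\<tau> i) + 1) / N"
      using N_real_pos by (simp_all add: field_simps)
  qed
  ultimately have "(False, \<tau> i, 0) \<in> at_point (Some (flip j z))"
    using on_arc_range[OF arc(1)] row_0_0 by (simp add: at_point_Some) (simp add: flip_def)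
  then show ?thesis using \<open>(True, i, 0) \<in> _\<close> by blast
qed

lemma glued_adjacent:
  assumes "w \<in> circles"
  shows "\<exists>x\<in>at_point w. \<exists>x'\<in>at_point (\<iota> w). (x, x') \<in> adj {x, x'}"
proof -
  obtain z j where w: "w = Some z" and j: "j < m" "cmod (z - hole_centre j) = 1"
    using assms by (auto simp: circles_def)
  have iw: "\<iota> w = Some (flip j z)" using iota_Some[OF j] w by simp
  show ?thesis
  proof (cases "0 \<le> Im z")
    case True
    then obtain i where i: "(True, i, 0) \<in> at_point (Some z)" "(False, \<tau> i, 0) \<in> at_point (Some (flip j z))"
      using glued_adjacent_upper[OF j] by blast
    then have "((True, i, 0), (False, \<tau> i, 0)) \<in> adj {(True, i, 0), (False, \<tau> i, 0)}"
      using at_point_X by (intro adj_GE) auto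
    then show ?thesis unfolding iw unfolding w using i by blast
  next
    case False
    then have "0 \<le> Im (flip j z)" by (simp add: flip_def)
    from glued_adjacent_upper[OF eta(1)[OF j(1)] flip_circle[OF j(2)] this]
    obtain i where i: "(True, i, 0) \<in> at_point (Some (flip j z))" "(False, \<tau> i, 0) \<in> at_point (Some z)"
      using flip_flip[OF j(1)] by auto
    then have "((True, i, 0), (False, \<tau> i, 0)) \<in> adj {(True, i, 0), (False, \<tau> i, 0)}"
      using at_point_X by (intro adj_GE) auto
    then have "((False, \<tau> i, 0), (True, i, 0)) \<in> adj {(False, \<tau> i, 0), (True, i, 0)}"
      by (auto simp: adj_def insert_commute)
    then show ?thesis unfolding iw unfolding w using i by blast
  qed
qed

lemma tile0_subset: "tile0 x \<subseteq> topspace (holed_sphere m)"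
proof
  fix w assume w: "w \<in> tile0 x"
  show "w \<in> topspace (holed_sphere m)"
  proof (cases w)
    case None
    then show ?thesis by (simp add: topspace_holed_sphere)
  next
    case (Some z)
    obtain \<sigma> i k where x: "x = (\<sigma>, i, k)" by (cases x)
    have "real k / N \<le> sgn_of \<sigma> * Im z - profile (Re z)"
      using w Some unfolding x tile0_def cell_def row_def by (auto split: if_splits)
    moreover have "0 \<le> real k / N" by simp
    ultimately have "profile (Re z) \<le> sgn_of \<sigma> * Im z" by linarith
    then have "profile (Re z) \<le> \<bar>Im z\<bar>" by (auto split: if_splits)
    then show ?thesis unfolding Some topspace_holed_iff .
  qed
qed

lemma meeting_point:
  assumes w: "w \<in> topspace (holed_sphere m)"
  shows "meeting tile {q w} = at_point w \<union> (if w \<in> circles then at_point (\<iota> w) else {})"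
proof -
  have "x \<in> meeting tile {q w} \<longleftrightarrow> x \<in> X \<and> (\<exists>w'\<in>tile0 x. q w' = q w)" for x
    by (auto simp: meeting_def tile_def)
  moreover have "q w' = q w \<longleftrightarrow> w' = w \<or> (w \<in> circles \<and> w' = \<iota> w)" for w'
    using q_eq_iff[of w w'] by auto
  ultimately show ?thesis by (auto simp: at_point_def)
qed

text \<open>After gluing, the tiles at a point on a circle consist of those at \<open>w\<close> and
  those at \<open>\<iota> w\<close>; each group is connected and a glued side links them.\<close>

lemma meeting_point_connected:
  assumes z: "z \<in> topspace surface" and x: "x \<in> meeting tile {z}" "x' \<in> meeting tile {z}"
  shows "(x, x') \<in> (adj (meeting tile {z}))\<^sup>*"
proof -
  obtain w where w: "w \<in> topspace (holed_sphere m)" "z = q w" using z topspace_surface by auto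
  let ?S = "meeting tile {z}"
  note S = meeting_point[OF w(1), folded w(2)]
  have in_w: "(y, y') \<in> (adj ?S)\<^sup>*" if "y \<in> at_point w" "y' \<in> at_point w" for y y'
    by (rule rtrancl_adj_mono[OF _ at_point_connected[OF that]]) (simp add: S)
  show ?thesis
  proof (cases "w \<in> circles")
    case False
    then show ?thesis using x in_w S by simp
  next
    case True
    have in_iw: "(y, y') \<in> (adj ?S)\<^sup>*" if "y \<in> at_point (\<iota> w)" "y' \<in> at_point (\<iota> w)" for y y'
      by (rule rtrancl_adj_mono[OF _ at_point_connected[OF that]]) (simp add: S True)
    obtain a a' where a: "a \<in> at_point w" "a' \<in> at_point (\<iota> w)" "(a, a') \<in> adj {a, a'}"
      using glued_adjacent[OF True] by blast
    have "{a, a'} \<subseteq> ?S" using a True by (simp add: S)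
    then have "(a, a') \<in> adj ?S" using a(3) adj_mono by blast
    then have aa: "(a, a') \<in> (adj ?S)\<^sup>*" by blast
    have to_a: "(a, y) \<in> (adj ?S)\<^sup>*" if "y \<in> ?S" for y
    proof (cases "y \<in> at_point w")
      case True
      then show ?thesis using in_w a by blast
    next
      case False
      then have "y \<in> at_point (\<iota> w)" using that S \<open>w \<in> circles\<close> by simp
      then have "(a', y) \<in> (adj ?S)\<^sup>*" using in_iw a by blast
      with aa show ?thesis by (rule rtrancl_trans)
    qed
    have "(x, a) \<in> (adj ?S)\<^sup>*" using to_a[OF x(1)] by (rule sym_rtrancl_adj)
    then show ?thesis using to_a[OF x(2)] by (rule rtrancl_trans)
  qed
qed

lemma tiles_cover: "topspace surface \<subseteq> (\<Union>x\<in>X. tile x)"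
proof
  fix p assume "p \<in> topspace surface"
  then obtain w where w: "w \<in> topspace (holed_sphere m)" "p = q w" using topspace_surface by auto
  have "\<exists>x\<in>X. w \<in> tile0 x"
  proof (cases w)
    case None
    have "(True, lo, 0) \<in> at_point None" using lo_le_hi by (simp add: at_point_None)
    then show ?thesis unfolding None at_point_def by blast
  next
    case (Some z)
    then have "profile (Re z) \<le> \<bar>Im z\<bar>" using w topspace_holed_iff by simp
    then have "0 \<le> sgn_of (0 \<le> Im z) * Im z - profile (Re z)" by auto
    then obtain k where "k \<le> K" "row k (sgn_of (0 \<le> Im z) * Im z - profile (Re z))" using row_ex by blast
    moreover obtain i where "lo \<le> i" "i \<le> hi" "column i (Re z)" using column_ex by blast
    ultimately have "(0 \<le> Im z, i, k) \<in> at_point (Some z)" by (simp add: at_point_Some)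
    then show ?thesis unfolding Some at_point_def by blast
  qed
  then show "p \<in> (\<Union>x\<in>X. tile x)" using w by (auto simp: tile_def)
qed

lemma closed_cell: "closed (cell x)"
proof -
  obtain \<sigma> i k where x: "x = (\<sigma>, i, k)" by (cases x)
  have p: "continuous_on UNIV (\<lambda>z. profile (Re z))"
    by (rule continuous_on_compose2[OF continuous_profile[of UNIV]]) (auto intro: continuous_intros)
  have "closed {z. column i (Re z)}" unfolding column_def
    by (intro closed_Collect_conj closed_Collect_imp open_Collect_const closed_Collect_le continuous_intros)
  moreover have "closed {z. row k (sgn_of \<sigma> * Im z - profile (Re z))}" unfolding row_def
    by (intro closed_Collect_conj closed_Collect_imp open_Collect_const closed_Collect_le continuous_intros p)
  ultimately show ?thesis unfolding x cell_def prod.case by (rule closed_Collect_conj)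
qed

lemma bounded_cell: "x \<in> X \<Longrightarrow> \<not> border x \<Longrightarrow> bounded (cell x)"
proof -
  assume xX: "x \<in> X" and b: "\<not> border x"
  obtain \<sigma> i k where x: "x = (\<sigma>, i, k)" by (cases x)
  have r: "lo < i" "i < hi" "k < K" using xX b by (auto simp: X_def border_def x)
  let ?C = "\<bar>real_of_int i / N\<bar> + \<bar>(real_of_int i + 1) / N\<bar> + \<bar>(real k + 1) / N\<bar> + real m"
  have "cmod z \<le> ?C" if "z \<in> cell x" for z
  proof -
    have cr: "column i (Re z)" "row k (sgn_of \<sigma> * Im z - profile (Re z))"
      using that by (simp_all add: x cell_def)
    have z: "real_of_int i / N \<le> Re z" "Re z \<le> (real_of_int i + 1) / N"
      "0 \<le> sgn_of \<sigma> * Im z - profile (Re z)" "sgn_of \<sigma> * Im z - profile (Re z) \<le> (real k + 1) / N"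
      using cr r row_nonneg[OF cr(2)] by (simp_all add: column_def row_def)
    have "\<bar>Re z\<bar> \<le> \<bar>real_of_int i / N\<bar> + \<bar>(real_of_int i + 1) / N\<bar>" using z(1,2) by linarith
    moreover have "\<bar>Im z\<bar> \<le> \<bar>(real k + 1) / N\<bar> + real m"
      using z(3,4) profile_le[of "Re z"] profile_nonneg[of "Re z"] by (auto split: if_splits)
    ultimately show ?thesis using cmod_le[of z] by linarith
  qed
  then show ?thesis by (rule boundedI)
qed

lemma closedin_tile: "x \<in> X \<Longrightarrow> closedin surface (tile x)"
proof -
  assume x: "x \<in> X"
  have out: "1 \<le> cmod (z - hole_centre j)" if "z \<in> cell x" "j < m" for z j
  proof -
    have "Some z \<in> topspace (holed_sphere m)" using that tile0_subset[of x] by (auto simp: tile0_def)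
    then show ?thesis using that by (auto simp: topspace_holed_sphere)
  qed
  have "closedin (holed_sphere m) (tile0 x)"
  proof (cases "border x")
    case True
    then have "tile0 x = insert None (Some ` cell x)" by (simp add: tile0_def)
    then show ?thesis using closedin_holed_sphere_None[OF closed_cell out] by simp
  next
    case False
    then have "compact (cell x)" using closed_cell bounded_cell[OF x] by (simp add: compact_eq_bounded_closed)
    then show ?thesis using closedin_holed_sphere_Some[OF _ out] False by (simp add: tile0_def)
  qed
  then show ?thesis unfolding tile_def by (rule closedin_q_image)
qed

end

section \<open>Euler's inequality\<close>

context surface_pattern
begin

definition preimage :: "complex option set set \<Rightarrow> complex option set" where
  "preimage P = {w \<in> topspace (holed_sphere m). q w \<in> P}"

text \<open>A mesh \<open>1 / N\<close> so small that no tile meets both \<open>P\<close> and \<open>Q\<close>, where \<open>Q\<close> avoids infinity.\<close>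

definition separating :: "nat \<Rightarrow> complex option set set \<Rightarrow> complex option set set \<Rightarrow> bool" where
  "separating N P Q \<longleftrightarrow> (\<exists>d \<delta> M. None \<notin> preimage Q \<and> (\<forall>b. Some b \<in> preimage Q \<longrightarrow> cmod b < M) \<and>
     (\<forall>a b. Some a \<in> preimage P \<longrightarrow> Some b \<in> preimage Q \<longrightarrow> d \<le> dist a b) \<and>
     (\<forall>x y. \<bar>x\<bar> \<le> M + 1 \<longrightarrow> \<bar>y\<bar> \<le> M + 1 \<longrightarrow> \<bar>x - y\<bar> < \<delta> \<longrightarrow> \<bar>profile x - profile y\<bar> < d / 3) \<and>
     M \<le> real N \<and> 1 / real N < \<delta> \<and> 1 / real N < d / 3)"

text \<open>Away from infinity \<open>Q\<close> is a compact subset of the plane, hence at a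
  positive distance \<open>d\<close> from \<open>P\<close>. Uniform continuity supplies
  \<open>\<delta>\<close>, since \<open>profile\<close> has vertical tangents at the ends of the
  arcs and admits no Lipschitz bound there.\<close>

lemma eventually_separating:
  assumes P: "closedin surface P" and Q: "closedin surface Q" and disj: "P \<inter> Q = {}"
    and None: "None \<notin> preimage Q"
  shows "eventually (\<lambda>N. separating N P Q) sequentially"
proof -
  define P' Q' where "P' = {z. Some z \<in> preimage P}" and "Q' = {z. Some z \<in> preimage Q}"
  have "closed P'" unfolding P'_def preimage_def
    by (rule closed_Some_preimage(1)[OF closedin_q_preimage[OF P]])
  have "compact Q'" unfolding Q'_def using None unfolding preimage_def
    by (rule closed_Some_preimage(2)[OF closedin_q_preimage[OF Q]])
  have "Q' \<inter> P' = {}" using disj by (auto simp: P'_def Q'_def preimage_def)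
  then obtain d where d: "0 < d" "\<And>b a. b \<in> Q' \<Longrightarrow> a \<in> P' \<Longrightarrow> d \<le> dist b a"
    using separate_compact_closed[OF \<open>compact Q'\<close> \<open>closed P'\<close>] by blast
  obtain M where M: "\<And>b. b \<in> Q' \<Longrightarrow> cmod b < M"
    using \<open>compact Q'\<close> compact_imp_bounded bounded_pos_less by metis
  have "uniformly_continuous_on {- (M + 1)..M + 1} profile"
    by (intro compact_uniformly_continuous continuous_profile) simp
  then obtain \<delta> where \<delta>: "0 < \<delta>" "\<And>x y. x \<in> {- (M + 1)..M + 1} \<Longrightarrow> y \<in> {- (M + 1)..M + 1} \<Longrightarrow>
      dist y x < \<delta> \<Longrightarrow> dist (profile y) (profile x) < d / 3"
    unfolding uniformly_continuous_on_def using d(1) by (metis divide_pos_pos zero_less_numeral)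
  have "eventually (\<lambda>N. M \<le> real N) sequentially"
    using filterlim_real_sequentially by (simp add: filterlim_at_top)
  moreover have "eventually (\<lambda>N. 1 / real N < \<delta>) sequentially"
    using order_tendstoD(2)[OF lim_1_over_n \<delta>(1)] .
  moreover have "eventually (\<lambda>N. 1 / real N < d / 3) sequentially"
    by (rule order_tendstoD(2)[OF lim_1_over_n]) (use d in simp)
  ultimately show ?thesis
  proof eventually_elim
    case (elim N)
    have "\<bar>profile x - profile y\<bar> < d / 3" if "\<bar>x\<bar> \<le> M + 1" "\<bar>y\<bar> \<le> M + 1" "\<bar>x - y\<bar> < \<delta>" for x y
      using \<delta>(2)[of y x] that by (simp add: dist_real_def abs_le_iff)
    moreover have "d \<le> dist a b" if "Some a \<in> preimage P" "Some b \<in> preimage Q" for a b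
      using d(2)[of b a] that by (simp add: P'_def Q'_def dist_commute)
    moreover have "cmod b < M" if "Some b \<in> preimage Q" for b
      using M that by (simp add: Q'_def)
    ultimately show ?case unfolding separating_def using None elim
      by (intro exI[of _ d] exI[of _ \<delta>] exI[of _ M] conjI allI impI)
  qed
qed

text \<open>Of two disjoint sets at least one avoids infinity and can take the role of
  \<open>Q\<close>.\<close>

lemma eventually_separating_either:
  assumes P: "closedin surface P" and Q: "closedin surface Q" and disj: "P \<inter> Q = {}"
  shows "eventually (\<lambda>N. separating N P Q \<or> separating N Q P) sequentially"
proof (cases "None \<in> preimage Q")
  case True
  then have "None \<notin> preimage P" using disj by (auto simp: preimage_def)
  then have "eventually (\<lambda>N. separating N Q P) sequentially" using eventually_separating[OF Q P] disj by blast
  then show ?thesis by (rule eventually_mono) simp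
next
  case False
  then have "eventually (\<lambda>N. separating N P Q) sequentially" using eventually_separating[OF P Q disj] by blast
  then show ?thesis by (rule eventually_mono) simp
qed

end

context surface_grid
begin

lemma meeting_preimage: "x \<in> meeting tile P \<Longrightarrow> x \<in> X \<and> (\<exists>w. w \<in> tile0 x \<and> w \<in> preimage P)"
  using tile0_subset[of x] by (auto simp: meeting_def tile_def preimage_def)

text \<open>A tile that meets \<open>Q\<close> is no border tile, because \<open>Q\<close> lies
  within radius \<open>M \<le> N\<close>. Two points of such a tile differ by at most
  \<open>1 / N\<close> in \<open>Re\<close> and by less than \<open>1 / N + d / 3\<close> in
  \<open>Im\<close>, where \<open>d / 3\<close> accounts for the variation of
  \<open>profile\<close>. With \<open>1 / N < d / 3\<close> this stays below
  \<open>d\<close>.\<close>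

lemma separating_meeting_disjoint:
  assumes "separating N P Q"
  shows "meeting tile P \<inter> meeting tile Q = {}"
proof (rule ccontr)
  assume "meeting tile P \<inter> meeting tile Q \<noteq> {}"
  then obtain x where x: "x \<in> meeting tile P" "x \<in> meeting tile Q" by blast
  from assms obtain d \<delta> M where sep: "None \<notin> preimage Q \<and> (\<forall>b. Some b \<in> preimage Q \<longrightarrow> cmod b < M) \<and>
     (\<forall>a b. Some a \<in> preimage P \<longrightarrow> Some b \<in> preimage Q \<longrightarrow> d \<le> dist a b) \<and>
     (\<forall>x y. \<bar>x\<bar> \<le> M + 1 \<longrightarrow> \<bar>y\<bar> \<le> M + 1 \<longrightarrow> \<bar>x - y\<bar> < \<delta> \<longrightarrow> \<bar>profile x - profile y\<bar> < d / 3) \<and>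
     M \<le> real N \<and> 1 / real N < \<delta> \<and> 1 / real N < d / 3"
    unfolding separating_def by (elim exE)
  have None: "None \<notin> preimage Q" and M: "\<And>b. Some b \<in> preimage Q \<Longrightarrow> cmod b < M"
    and d: "\<And>a b. Some a \<in> preimage P \<Longrightarrow> Some b \<in> preimage Q \<Longrightarrow> d \<le> dist a b"
    and \<delta>: "\<And>x y. \<bar>x\<bar> \<le> M + 1 \<Longrightarrow> \<bar>y\<bar> \<le> M + 1 \<Longrightarrow> \<bar>x - y\<bar> < \<delta> \<Longrightarrow> \<bar>profile x - profile y\<bar> < d / 3"
    and N: "M \<le> real N" "1 / real N < \<delta>" "1 / real N < d / 3"
    using sep by blast+
  obtain w where "w \<in> tile0 x" "w \<in> preimage Q" and xX: "x \<in> X" using meeting_preimage[OF x(2)] by blast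
  then obtain b where b: "b \<in> cell x" "Some b \<in> preimage Q"
    using None by (auto simp: tile0_def split: if_splits)
  obtain w' where w': "w' \<in> tile0 x" "w' \<in> preimage P" using meeting_preimage[OF x(1)] by blast
  obtain \<sigma> i k where xe: "x = (\<sigma>, i, k)" by (cases x)
  have cb: "column i (Re b)" "row k (sgn_of \<sigma> * Im b - profile (Re b))"
    using b(1) by (simp_all add: xe cell_def)
  have bN: "\<bar>Re b\<bar> < M" "\<bar>Im b\<bar> < M"
    using M[OF b(2)] abs_Re_le_cmod[of b] abs_Im_le_cmod[of b] by linarith+
  have r: "lo \<le> i" "i \<le> hi" "k \<le> K" using xX by (auto simp: xe X_def)
  have "0 \<le> int N * int N" by simp
  then have "lo < hi" unfolding lo_def hi_def by linarith
  have "i \<noteq> lo"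
  proof
    assume "i = lo"
    then have "Re b \<le> (real_of_int lo + 1) / N" using cb(1) \<open>lo < hi\<close> by (simp add: column_def)
    also have "\<dots> = - real N" using N_real_pos by (simp add: lo_def field_simps)
    finally show False using bN N(1) by linarith
  qed
  moreover have "i \<noteq> hi"
  proof
    assume "i = hi"
    then have "real_of_int hi / N \<le> Re b" using cb(1) \<open>lo < hi\<close> by (simp add: column_def)
    moreover have "real_of_int hi / N = real N" using N_real_pos by (simp add: hi_def)
    ultimately show False using bN N(1) by linarith
  qed
  moreover have "k \<noteq> K"
  proof
    assume "k = K"
    then have "real K / N \<le> sgn_of \<sigma> * Im b - profile (Re b)" using cb(2) by (simp add: row_def)
    moreover have "real K / N = real N" using N_real_pos by (simp add: K_def)
    ultimately have "real N \<le> \<bar>Im b\<bar>" using profile_nonneg[of "Re b"] by (auto split: if_splits)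
    then show False using bN N(1) by linarith
  qed
  ultimately have "\<not> border x" by (simp add: border_def xe)
  then obtain a where a: "a \<in> cell x" "Some a \<in> preimage P" using w' by (auto simp: tile0_def)
  have ca: "column i (Re a)" "row k (sgn_of \<sigma> * Im a - profile (Re a))"
    using a(1) by (simp_all add: xe cell_def)
  have inner: "lo < i" "i < hi" "k < K"
    using r \<open>i \<noteq> lo\<close> \<open>i \<noteq> hi\<close> \<open>k \<noteq> K\<close> by auto
  have re: "\<bar>Re a - Re b\<bar> \<le> 1 / N"
    using ca(1) cb(1) inner by (auto simp: column_def add_divide_distrib)
  have t: "\<bar>(sgn_of \<sigma> * Im a - profile (Re a)) - (sgn_of \<sigma> * Im b - profile (Re b))\<bar> \<le> 1 / N"
    using ca(2) cb(2) inner(3) by (auto simp only: row_def add_divide_distrib)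
  have "1 / real N \<le> 1" using N_pos by simp
  then have "\<bar>Re a\<bar> \<le> M + 1" "\<bar>Re b\<bar> \<le> M + 1" using re bN by linarith+
  then have p: "\<bar>profile (Re a) - profile (Re b)\<bar> < d / 3" using re N by (intro \<delta>) auto
  have "\<bar>Im a - Im b\<bar> < 1 / N + d / 3"
  proof (cases \<sigma>)
    case True
    then have "\<bar>(Im a - profile (Re a)) - (Im b - profile (Re b))\<bar> \<le> 1 / N" using t by simp
    then show ?thesis using p by linarith
  next
    case False
    then have "\<bar>(- Im a - profile (Re a)) - (- Im b - profile (Re b))\<bar> \<le> 1 / N" using t by simp
    then show ?thesis using p by linarith
  qed
  moreover have "dist a b \<le> \<bar>Re a - Re b\<bar> + \<bar>Im a - Im b\<bar>"
    using cmod_le[of "a - b"] by (simp add: dist_norm)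
  ultimately have "dist a b < d" using re N(3) by linarith
  then show False using d[OF a(2) b(2)] by simp
qed

end

text \<open>There are finitely many disjoint pairs of stars and middles, and each is separated for
  all large \<open>N\<close>; so one mesh serves all of them.\<close>

lemma (in surface_pattern) surface_euler_bound:
  fixes E :: "'v::finite set set"
  assumes simple: "simple_graph E" and emb: "embeds_in E surface"
    and girth: "\<And>z. z \<subseteq> E \<Longrightarrow> z \<noteq> {} \<Longrightarrow> (\<And>v. even (card {e\<in>z. v \<in> e})) \<Longrightarrow> g \<le> card z"
  shows "\<exists>f. card E \<le> (CARD('v) - 1) + r + (f - 1) \<and> f * g \<le> 2 * card E"
proof -
  obtain St :: "'v \<Rightarrow> complex option set set" and Md :: "'v set \<Rightarrow> complex option set set" where
    St: "\<And>v. connectedin surface (St v)" "\<And>v. closedin surface (St v)" "\<And>v. St v \<noteq> {}"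
    and Md: "\<And>e. e \<in> E \<Longrightarrow> connectedin surface (Md e)" "\<And>e. e \<in> E \<Longrightarrow> closedin surface (Md e)"
    and inc: "\<And>e v. e \<in> E \<Longrightarrow> v \<in> e \<Longrightarrow> Md e \<inter> St v \<noteq> {}"
    and disj: "\<And>u v. u \<noteq> v \<Longrightarrow> St u \<inter> St v = {}"
      "\<And>e e'. e \<in> E \<Longrightarrow> e' \<in> E \<Longrightarrow> e \<noteq> e' \<Longrightarrow> Md e \<inter> Md e' = {}"
      "\<And>e v. e \<in> E \<Longrightarrow> v \<notin> e \<Longrightarrow> Md e \<inter> St v = {}"
    by (rule embedding_stars[OF simple Hausdorff_surface emb]) (rule that)
  define \<C> where "\<C> = range St \<union> Md ` E"
  have \<C>: "finite \<C>" "\<And>P. P \<in> \<C> \<Longrightarrow> closedin surface P" using St(2) Md(2) by (auto simp: \<C>_def)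
  define \<P> where "\<P> = {(P, Q). P \<in> \<C> \<and> Q \<in> \<C> \<and> P \<inter> Q = {}}"
  have "finite \<P>" by (rule finite_subset[of _ "\<C> \<times> \<C>"]) (use \<C>(1) in \<open>auto simp: \<P>_def\<close>)
  then have "eventually (\<lambda>N. \<forall>(P, Q)\<in>\<P>. separating N P Q \<or> separating N Q P) sequentially"
    by (rule eventually_ball_finite) (auto simp: \<P>_def intro!: eventually_separating_either \<C>(2))
  moreover have "eventually (\<lambda>N. \<forall>j\<in>{..<r}. \<bar>A j\<bar> < int N \<and> \<bar>B j\<bar> < int N) sequentially"
  proof (rule eventually_ball_finite)
    show "\<forall>j\<in>{..<r}. eventually (\<lambda>N. \<bar>A j\<bar> < int N \<and> \<bar>B j\<bar> < int N) sequentially"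
    proof
      fix j
      show "eventually (\<lambda>N. \<bar>A j\<bar> < int N \<and> \<bar>B j\<bar> < int N) sequentially"
        by (rule eventually_sequentiallyI[of "nat (\<bar>A j\<bar> + \<bar>B j\<bar> + 1)"]) auto
    qed
  qed simp
  moreover have "eventually (\<lambda>N. 3 * m + 3 \<le> N) sequentially" by (rule eventually_ge_at_top)
  ultimately have "eventually (\<lambda>N. (\<forall>(P, Q)\<in>\<P>. separating N P Q \<or> separating N Q P) \<and>
      (\<forall>j\<in>{..<r}. \<bar>A j\<bar> < int N \<and> \<bar>B j\<bar> < int N) \<and> 3 * m + 3 \<le> N) sequentially"
    by eventually_elim blast
  then obtain N where separating: "\<And>P Q. (P, Q) \<in> \<P> \<Longrightarrow> separating N P Q \<or> separating N Q P"
    and AB: "\<And>j. j < r \<Longrightarrow> \<bar>A j\<bar> < int N \<and> \<bar>B j\<bar> < int N" and N: "3 * m + 3 \<le> N"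
    using eventually_happens[of _ sequentially] by fastforce
  interpret surface_grid m \<eta> \<epsilon> r A B N
    by unfold_locales (use AB N in auto)
  have sep: "meeting tile P \<inter> meeting tile Q = {}" if "P \<in> \<C>" "Q \<in> \<C>" "P \<inter> Q = {}" for P Q
  proof -
    have "separating N P Q \<or> separating N Q P" using that by (intro separating) (simp add: \<P>_def)
    then show ?thesis using separating_meeting_disjoint[of P Q] separating_meeting_disjoint[of Q P] by blast
  qed
  show ?thesis
  proof (rule tiled_euler_bound[of surface tile E St Md])
    show "meeting tile (St u) \<inter> meeting tile (St v) = {}" if "u \<noteq> v" for u v
      using disj(1)[OF that] by (intro sep) (auto simp: \<C>_def)
    show "meeting tile (Md e) \<inter> meeting tile (Md e') = {}" if "e \<in> E" "e' \<in> E" "e \<noteq> e'" for e e'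
      using disj(2)[OF that] that by (intro sep) (auto simp: \<C>_def)
    show "meeting tile (Md e) \<inter> meeting tile (St v) = {}" if "e \<in> E" "v \<notin> e" for e v
      using disj(3)[OF that] that by (intro sep) (auto simp: \<C>_def)
  qed (fact closedin_tile tiles_cover meeting_point_connected simple St(1) St(3) Md(1) inc girth)+
qed

lemma glue_cong: "r \<union> r\<inverse> = r' \<union> r'\<inverse> \<Longrightarrow> glue T r = glue T r'"
  by (simp add: glue_def)

text \<open>The antipodal map exchanges the two real points of each circle, so every crosscap
  contributes one pair.\<close>

lemma nonorientable_euler_bound:
  fixes E :: "'v::finite set set"
  assumes simple: "simple_graph E" and emb: "embeds_in E (nonorientable_surface k)"
    and girth: "\<And>z. z \<subseteq> E \<Longrightarrow> z \<noteq> {} \<Longrightarrow> (\<And>v. even (card {e\<in>z. v \<in> e})) \<Longrightarrow> g \<le> card z"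
  shows "\<exists>f. card E \<le> (CARD('v) - 1) + k + (f - 1) \<and> f * g \<le> 2 * card E"
proof -
  interpret surface_pattern k id "- 1" k "\<lambda>j. 3 * int j - 1" "\<lambda>j. 3 * int j + 1"
  proof
    show "3 * int j - 1 \<noteq> 3 * int j' + 1" for j j' by presburger
    show "3 * int j + d = 3 * int (id j) + - 1 * d \<or>
        (\<exists>i<k. {3 * int j + d, 3 * int (id j) + - 1 * d} = {3 * int i - 1, 3 * int i + 1})"
      if "j < k" "d = 1 \<or> d = - 1" for j d
      using that by (auto simp: insert_commute intro!: exI[of _ j])
  qed (auto simp: inj_on_def)
  have "Complex (real_of_int (- 1) * Re u) (- Im u) = - u" for u by (simp add: complex_eq_iff)
  then have "nonorientable_surface k = surface"
    unfolding nonorientable_surface_def rel_def by simp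
  then show ?thesis using surface_euler_bound[OF simple] emb girth by simp
qed

text \<open>Conjugation shifts the two real points of an even circle by 3 to those of the next
  circle. Every handle thus contributes two pairs; \<open>A\<close> enumerates their left members,
  the parity of the index selecting the left or right point of the circle.\<close>

lemma orientable_euler_bound:
  fixes E :: "'v::finite set set"
  assumes simple: "simple_graph E" and emb: "embeds_in E (orientable_surface h)"
    and girth: "\<And>z. z \<subseteq> E \<Longrightarrow> z \<noteq> {} \<Longrightarrow> (\<And>v. even (card {e\<in>z. v \<in> e})) \<Longrightarrow> g \<le> card z"
  shows "\<exists>f. card E \<le> (CARD('v) - 1) + 2 * h + (f - 1) \<and> f * g \<le> 2 * card E"
proof -
  define \<eta> :: "nat \<Rightarrow> nat" where "\<eta> j = (if even j then j + 1 else j - 1)" for j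
  define A :: "nat \<Rightarrow> int" where "A i = 6 * int (i div 2) + (if even i then - 1 else 1)" for i
  have A_even: "A (2 * a) = 6 * int a - 1" and A_odd: "A (2 * a + 1) = 6 * int a + 1" for a
    by (simp_all add: A_def)
  have A_cases: "(\<exists>a. i = 2 * a \<and> A i = 6 * int a - 1) \<or> (\<exists>a. i = 2 * a + 1 \<and> A i = 6 * int a + 1)" for i
    using A_even A_odd by (metis evenE oddE)
  have neq: "6 * p - 1 \<noteq> 6 * q + 1" "6 * p + 1 \<noteq> 6 * q - 1" "6 * p - 1 \<noteq> 6 * q - 1 + 3"
    "6 * p - 1 \<noteq> 6 * q + 1 + 3" "6 * p + 1 \<noteq> 6 * q - 1 + 3" "6 * p + 1 \<noteq> 6 * q + 1 + 3" for p q :: int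
    by presburger+
  have inj: "i = j" if "A i = A j" for i j
    using A_cases[of i] A_cases[of j] that neq by (elim disjE exE conjE) simp_all
  interpret surface_pattern "2 * h" \<eta> 1 "2 * h" A "\<lambda>i. A i + 3"
  proof
    show "\<eta> j < 2 * h" if "j < 2 * h" for j
      using that unfolding \<eta>_def by (auto elim!: evenE)
    show "\<eta> (\<eta> j) = j" for j by (auto simp: \<eta>_def)
    show "A j \<noteq> A j' + 3" for j j'
      using A_cases[of j] A_cases[of j'] neq by (elim disjE exE conjE) simp_all
    show "3 * int j + d = 3 * int (\<eta> j) + 1 * d \<or>
        (\<exists>i<2 * h. {3 * int j + d, 3 * int (\<eta> j) + 1 * d} = {A i, A i + 3})"
      if j: "j < 2 * h" and d: "d = 1 \<or> d = - 1" for j d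
    proof -
      obtain a where a: "j = 2 * a \<or> j = 2 * a + 1" by (metis evenE oddE)
      have "a < h" using a j by auto
      have set: "{3 * int j + d, 3 * int (\<eta> j) + 1 * d} = {6 * int a + d, 6 * int a + d + 3}"
        using a by (auto simp: \<eta>_def)
      from d show ?thesis
      proof
        assume "d = 1"
        then have "{3 * int j + d, 3 * int (\<eta> j) + 1 * d} = {A (2 * a + 1), A (2 * a + 1) + 3}"
          unfolding set A_odd by simp
        moreover have "2 * a + 1 < 2 * h" using \<open>a < h\<close> by simp
        ultimately show ?thesis by blast
      next
        assume "d = - 1"
        then have "{3 * int j + d, 3 * int (\<eta> j) + 1 * d} = {A (2 * a), A (2 * a) + 3}"
          unfolding set A_even by simp
        moreover have "2 * a < 2 * h" using \<open>a < h\<close> by simp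
        ultimately show ?thesis by blast
      qed
    qed
  qed (use inj in \<open>auto simp: inj_on_def\<close>)
  let ?r = "{(Some (hole_centre (2 * i) + u), Some (hole_centre (2 * i + 1) + cnj u)) |i u. i < h \<and> cmod u = 1}"
  have cnj: "Complex (real_of_int 1 * Re u) (- Im u) = cnj u" for u by (simp add: complex_eq_iff)
  \<comment> \<open>\<open>rel\<close> lists every gluing in both directions, \<open>?r\<close> only
    from even to odd circles; the symmetric closures agree.\<close>
  have "?r \<union> ?r\<inverse> = rel \<union> rel\<inverse>"
  proof -
    have rel': "rel = {(Some (hole_centre j + u), Some (hole_centre (\<eta> j) + cnj u)) |j u. j < 2 * h \<and> cmod u = 1}"
      unfolding rel_def cnj by simp
    have 1: "?r \<subseteq> rel"
    proof
      fix p assume "p \<in> ?r"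
      then obtain i u where p: "p = (Some (hole_centre (2 * i) + u), Some (hole_centre (2 * i + 1) + cnj u))"
        "i < h" "cmod u = 1" by blast
      then have "p = (Some (hole_centre (2 * i) + u), Some (hole_centre (\<eta> (2 * i)) + cnj u))" "2 * i < 2 * h"
        by (auto simp: \<eta>_def)
      then show "p \<in> rel" unfolding rel' using p(3) by blast
    qed
    have 2: "rel \<subseteq> ?r \<union> ?r\<inverse>"
    proof
      fix p assume "p \<in> rel"
      then obtain j u where p: "p = (Some (hole_centre j + u), Some (hole_centre (\<eta> j) + cnj u))"
        "j < 2 * h" "cmod u = 1" unfolding rel' by blast
      obtain a where "j = 2 * a \<or> j = 2 * a + 1" by (metis evenE oddE)
      then show "p \<in> ?r \<union> ?r\<inverse>"
      proof
        assume j: "j = 2 * a"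
        then have "p = (Some (hole_centre (2 * a) + u), Some (hole_centre (2 * a + 1) + cnj u))" "a < h"
          using p by (auto simp: \<eta>_def)
        then have "p \<in> ?r" using p(3) by blast
        then show ?thesis ..
      next
        assume j: "j = 2 * a + 1"
        then have "(snd p, fst p) = (Some (hole_centre (2 * a) + cnj u), Some (hole_centre (2 * a + 1) + cnj (cnj u)))" "a < h"
          using p by (auto simp: \<eta>_def)
        moreover have "cmod (cnj u) = 1" using p(3) by simp
        ultimately have "(snd p, fst p) \<in> ?r" by blast
        then have "(fst p, snd p) \<in> ?r\<inverse>" by (rule converseI)
        then show ?thesis by simp
      qed
    qed
    show ?thesis using 1 2 by blast
  qed
  then have "orientable_surface h = surface"
    unfolding orientable_surface_def by (rule glue_cong)
  then show ?thesis using surface_euler_bound[OF simple] emb girth by simp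
qed

theorem theorem5p1:
  fixes E :: "'v::finite set set" and n g :: nat and c :: int
  assumes "simple_graph E" and "regular_graph E" and "n = CARD('v)"
    and "girth E = enat g" and "g < n"
    and "has_euler_characteristic E c"
  shows "algebraic_connectivity E \<le>
    2 * real n / ((real n - real g) * (real g - 2)) * (2 - real g * real_of_int c / real n)"
proof -
  obtain d where d: "\<And>v. degree_of E v = d" using assms(2) by (auto simp: regular_graph_def)
  obtain vs where vs: "is_cycle E vs" "length vs = g" using girth_attained[OF assms(4)] by blast
  have g3: "3 \<le> g" using vs by (simp add: is_cycle_def)
  have gE: "g \<le> card E" using cycle_length_le_card[OF vs(1)] vs(2) by simp
  have nd: "n * d = 2 * card E" using handshake[OF assms(1)] d assms(3) by simp
  note even = girth_le_card_even_edge_set[OF assms(1,4)]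
  obtain f :: nat and r :: nat where f: "card E \<le> (n - 1) + r + (f - 1)" "f * g \<le> 2 * card E" and c: "c = 2 - int r"
  proof -
    from assms(6) consider h where "embeds_in E (orientable_surface h)" "c = 2 - 2 * int h"
      | k where "embeds_in E (nonorientable_surface k)" "c = 2 - int k"
      unfolding has_euler_characteristic_def has_orientable_genus_def has_nonorientable_genus_def by blast
    then show thesis
    proof cases
      case 1
      obtain f where "card E \<le> (n - 1) + 2 * h + (f - 1)" "f * g \<le> 2 * card E"
        using orientable_euler_bound[OF assms(1) 1(1) even] unfolding assms(3) by blast
      moreover have "c = 2 - int (2 * h)" using 1(2) by simp
      ultimately show thesis by (rule that)
    next
      case 2
      obtain f where "card E \<le> (n - 1) + k + (f - 1)" "f * g \<le> 2 * card E"
        using nonorientable_euler_bound[OF assms(1) 2(1) even] unfolding assms(3) by blast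
      then show thesis using 2(2) by (rule that)
    qed
  qed
  have "g * (card E + 2) \<le> g * (n + r) + 2 * card E"
  proof -
    \<comment> \<open>\<open>f - 1\<close> is truncated at zero, so \<open>f = 0\<close> has to be
      treated like \<open>f = 1\<close>; in that case \<open>g \<le> card E\<close> replaces the
      count of boundary edges.\<close>
    have "card E + 2 \<le> n + r + max f 1" using f(1) assms(5) by auto
    then have "g * (card E + 2) \<le> g * (n + r + max f 1)" by (rule mult_le_mono2)
    also have "\<dots> = g * (n + r) + g * max f 1" by (simp add: distrib_left)
    also have "g * max f 1 \<le> 2 * card E" using f(2) gE by (auto simp: max_def mult.commute)
    finally show ?thesis by simp
  qed
  then have euler: "real g * (real (card E) + 2) \<le> real g * (real n + real r) + 2 * real (card E)"
    by (metis (mono_tags, lifting) of_nat_add of_nat_le_iff of_nat_mult of_nat_numeral)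
  have m: "real (card E) = real n * real d / 2" using nd by (metis nonzero_mult_div_cancel_left of_nat_mult of_nat_numeral zero_neq_numeral)
  have rc: "real r = 2 - real_of_int c" using c by simp
  have pos: "0 < real n - real g" "0 < real g - 2" "0 < real n" using assms(5) g3 by auto
  have "algebraic_connectivity E \<le> real n * (real d - 2) / (real n - real g)"
    using algebraic_connectivity_le_cycle[OF assms(1) d vs(1)] vs(2) assms(3,5) by simp
  also have "\<dots> \<le> (2 * (2 * real n - real g * real_of_int c) / (real g - 2)) / (real n - real g)"
  proof (rule divide_right_mono)
    \<comment> \<open>With \<open>n * d = 2 * card E\<close> this is twice Euler's inequality,
      rearranged.\<close>
    have "real n * (real d - 2) * (real g - 2) \<le> 2 * (2 * real n - real g * real_of_int c)"
      using euler unfolding m rc by (simp add: algebra_simps)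
    then show "real n * (real d - 2) \<le> 2 * (2 * real n - real g * real_of_int c) / (real g - 2)"
      using pos by (simp add: pos_le_divide_eq)
  qed (use pos in simp)
  also have "\<dots> = 2 * real n / ((real n - real g) * (real g - 2)) * (2 - real g * real_of_int c / real n)"
  proof -
    have "2 * (2 * real n - real g * real_of_int c) = 2 * real n * (2 - real g * real_of_int c / real n)"
      using pos(3) by (simp add: right_diff_distrib)
    then show ?thesis
      by (simp only: divide_divide_eq_left times_divide_eq_left mult.commute[of "real g - 2"])
  qed
  finally show ?thesis .
qed

end
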